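(* Let $U(\cdot\,;k,M,p)$, $c(k,M,p)$ be the three-parameter family of periodic travelling waves of the Korteweg-de Vries equation described in the context, fix $(k_\star,M_\star,p_\star)$ and denote evaluation there by a subscript $\star$. Consider, for $\nu\in i\mathbb{R}$, the Bloch eigenvalue problem on $1$-periodic functions $$\lambda\hat u+k_\star(\tfrac{d}{dx}+\nu)\big((6U_\star-c_\star)\hat u\big)+k_\star^3(\tfrac{d}{dx}+\nu)^3\hat u=0 .\qquad(B)$$ If $\lambda(\nu)$, $\hat u(\nu)$ is a smooth solution curve of $(B)$ near $\nu=0$ with $\lambda=\nu k_\star\tilde\lambda_0+O(\nu^2)$ and $\hat u(0)\neq0$, then there is a nonzero $(k_0,M_0,p_0)\in\mathbb{C}^3$ with $$\begin{aligned}-c_\star k_0+\tilde\lambda_0k_0+\mathrm{d}[kc]_\star(k_0,M_0,p_0)&=0,\\(\tilde\lambda_0-c_\star)M_0+\mathrm{d}\langle3U^2\rangle_\star(k_0,M_0,p_0)&=0,\\\tfrac12(\tilde\lambda_0-c_\star)\,\mathrm{d}\langle U^2\rangle_\star(k_0,M_0,p_0)+\mathrm{d}\big\langle2U^3-\tfrac32k^2(U')^2\big\rangle_\star(k_0,M_0,p_0)&=0,\end{aligned}$$ i.e. $e^{\nu(X+\tilde\lambda_0T)}(k_0,M_0,p_0)$ solves the linearization about $(k_\star,M_\star,p_\star)$, in the co-moving frame $(X-c_\star T,T)$, of Whitham's system for KdV $$\partial_Tk+\partial_X(kc)=0,\qquad\partial_TM+\partial_X\langle3U^2\rangle=0,\qquad\tfrac12\partial_T\langle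 U^2\rangle+\partial_X\big\langle2U^3-\tfrac32k^2(U')^2\big\rangle=0 .\qquad(W)$$ Moreover, if the wave $U_\star$ is spectrally stable, i.e. for every $\nu\in i\mathbb{R}$ every $\lambda$ for which $(B)$ has a nonzero $1$-periodic solution satisfies $\operatorname{Re}\lambda\le0$, then $(W)$ is hyperbolic at $(k_\star,M_\star,p_\star)$, in the sense that its characteristic speeds there are real.
   Context: $\langle f\rangle=\int_0^1 f(y)\,dy$ for $1$-periodic $f$; $\mathrm{d}$ denotes the differential with respect to the parameters $(k,M,p)$. KdV family: for $k>0$, $M\in\mathbb{R}$, $p\in(0,1)$, $U(y;k,M,p)=M+\tilde U(y;k,p)$ and $c(k,M,p)=6M+\tilde c(k,p)$ with $$\tilde U(y;k,p)=8K(p)^2k^2\Big(\mathrm{dn}^2(2K(p)y)-\tfrac{E(p)}{K(p)}\Big),\qquad\tilde c(k,p)=16K(p)^2k^2\Big(2-p^2-3\tfrac{E(p)}{K(p)}\Big),$$ where $K,E$ are the complete elliptic integrals of first and second kind and $\mathrm{dn}$ is Jacobi's delta amplitude function, all of modulus $p$. These satisfy $-kcU'+6kUU'+k^3U'''=0$, $\langle U\rangle=M$, and give travelling waves $U(k(x-ct))$ of $\partial_tu+6u\,\partial_xu+\partial_x^3u=0$. On $1$-periodic functions the operator $\tilde{\mathcal L}_\star f=k_\star((6U_\star-c_\star)f)'+k_\star^3f'''$ is Fredholm of index $0$, its kernel is spanned by $U_\star'$ and $1-6(\partial_pc_\star)^{-1}\partial_pU_\star$, and the kernel of its adjoint is spanned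 by $1$ and $U_\star$. *)

theory Defs
  imports "HOL-Analysis.Analysis" "HOL-Library.Landau_Symbols"
begin

section \<open>Functions of class $C^n$ and $C^\infty$ on an open set\<close>

primrec higher_differentiable_on ::
  "'a::euclidean_space set \<Rightarrow> ('a \<Rightarrow> 'b::real_normed_vector) \<Rightarrow> nat \<Rightarrow> bool" where
  "higher_differentiable_on S f 0 \<longleftrightarrow> continuous_on S f"
| "higher_differentiable_on S f (Suc n) \<longleftrightarrow>
     (\<forall>x\<in>S. f differentiable (at x)) \<and>
     (\<forall>v. higher_differentiable_on S (\<lambda>x. frechet_derivative f (at x) v) n)"

definition smooth_on :: "'a::euclidean_space set \<Rightarrow> ('a \<Rightarrow> 'b::real_normed_vector) \<Rightarrow> bool" where
  "smooth_on S f \<longleftrightarrow> (\<forall>n. higher_differentiable_on S f n)"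


section \<open>Elliptic integrals and the delta amplitude, of modulus $p$\<close>

text \<open>All elliptic functions are parametrized by the modulus $p$, not by the parameter $m = p^2$.
  The integral below is oriented, so that it is an odd function of the amplitude.\<close>

definition elliptic_F :: "real \<Rightarrow> real \<Rightarrow> real" where
  "elliptic_F p \<phi> = (LBINT t=ereal 0..ereal \<phi>. 1 / sqrt (1 - p\<^sup>2 * (sin t)\<^sup>2))"

definition elliptic_K :: "real \<Rightarrow> real" where
  "elliptic_K p = elliptic_F p (pi / 2)"

definition elliptic_E :: "real \<Rightarrow> real" where
  "elliptic_E p = (LBINT t=ereal 0..ereal (pi / 2). sqrt (1 - p\<^sup>2 * (sin t)\<^sup>2))"

text \<open>For $0 < p < 1$ the map $\phi \mapsto F(p,\phi)$ is a bijection of the real line, and its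
  inverse is Jacobi's amplitude.\<close>

definition jacobi_am :: "real \<Rightarrow> real \<Rightarrow> real" where
  "jacobi_am p = inv (elliptic_F p)"

definition jacobi_dn :: "real \<Rightarrow> real \<Rightarrow> real" where
  "jacobi_dn p u = sqrt (1 - p\<^sup>2 * (sin (jacobi_am p u))\<^sup>2)"


section \<open>Periodic travelling waves of the Korteweg-de Vries equation\<close>

definition kdv_U :: "real \<Rightarrow> real \<Rightarrow> real \<Rightarrow> real \<Rightarrow> real" where
  "kdv_U k M p y =
     M + 8 * (elliptic_K p)\<^sup>2 * k\<^sup>2 *
         ((jacobi_dn p (2 * elliptic_K p * y))\<^sup>2 - elliptic_E p / elliptic_K p)"

definition kdv_c :: "real \<Rightarrow> real \<Rightarrow> real \<Rightarrow> real" where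
  "kdv_c k M p =
     6 * M + 16 * (elliptic_K p)\<^sup>2 * k\<^sup>2 * (2 - p\<^sup>2 - 3 * (elliptic_E p / elliptic_K p))"

definition mean :: "(real \<Rightarrow> real) \<Rightarrow> real" where
  "mean f = integral {0..1} f"


section \<open>The Bloch eigenvalue problem\<close>

definition bloch_D :: "complex \<Rightarrow> (real \<Rightarrow> complex) \<Rightarrow> real \<Rightarrow> complex" where
  "bloch_D \<nu> f = (\<lambda>x. vector_derivative f (at x) + \<nu> * f x)"

definition bloch_solution ::
  "real \<Rightarrow> real \<Rightarrow> real \<Rightarrow> complex \<Rightarrow> complex \<Rightarrow> (real \<Rightarrow> complex) \<Rightarrow> bool" where
  "bloch_solution k M p \<nu> lam u \<longleftrightarrow>
     higher_differentiable_on UNIV u 3 \<and>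
     (\<forall>x. u (x + 1) = u x) \<and>
     (\<forall>x. lam * u x
          + of_real k * bloch_D \<nu> (\<lambda>y. of_real (6 * kdv_U k M p y - kdv_c k M p) * u y) x
          + of_real (k ^ 3) * (bloch_D \<nu> ^^ 3) u x = 0)"

definition spectrally_stable :: "real \<Rightarrow> real \<Rightarrow> real \<Rightarrow> bool" where
  "spectrally_stable k M p \<longleftrightarrow>
     (\<forall>\<nu> lam. Re \<nu> = 0 \<longrightarrow>
        (\<exists>u. bloch_solution k M p \<nu> lam u \<and> (\<exists>x. u x \<noteq> 0)) \<longrightarrow> Re lam \<le> 0)"

text \<open>A curve of solutions depending smoothly on $\nu = i\xi$ for real $\xi$ near $0$. Because the
  eigenfunctions are $1$-periodic, smoothness jointly in $(\xi,x)$ is the same as smoothness of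
  $\xi \mapsto u(i\xi)$ with values in any of the spaces $C^m$ or $H^m$ of periodic functions,
  for solutions of the eigenvalue equation.\<close>

definition smooth_bloch_curve ::
  "real \<Rightarrow> real \<Rightarrow> real \<Rightarrow> (complex \<Rightarrow> complex) \<Rightarrow> (complex \<Rightarrow> real \<Rightarrow> complex) \<Rightarrow> bool" where
  "smooth_bloch_curve k M p lam u \<longleftrightarrow>
     (\<exists>\<epsilon>>0. smooth_on {-\<epsilon><..<\<epsilon>} (\<lambda>\<xi>. lam (\<i> * of_real \<xi>)) \<and>
            smooth_on ({-\<epsilon><..<\<epsilon>} \<times> UNIV) (\<lambda>(\<xi>, x). u (\<i> * of_real \<xi>) x) \<and>
            (\<forall>\<xi>\<in>{-\<epsilon><..<\<epsilon>}. bloch_solution k M p (\<i> * of_real \<xi>) (lam (\<i> * of_real \<xi>)) (u (\<i> * of_real \<xi>))))"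


section \<open>Whitham's modulation system\<close>

text \<open>The differential, with respect to the parameters $(k,M,p)$, of a real function of these
  parameters, extended complex-linearly to complex directions.\<close>

definition cdiff ::
  "(real \<times> real \<times> real \<Rightarrow> real) \<Rightarrow> real \<times> real \<times> real \<Rightarrow> complex \<times> complex \<times> complex \<Rightarrow> complex"
where
  "cdiff G s = (\<lambda>(a, b, d).
     Complex (frechet_derivative G (at s) (Re a, Re b, Re d))
             (frechet_derivative G (at s) (Im a, Im b, Im d)))"

definition flux_k :: "real \<times> real \<times> real \<Rightarrow> real" where
  "flux_k = (\<lambda>(k, M, p). k * kdv_c k M p)"

definition flux_M :: "real \<times> real \<times> real \<Rightarrow> real" where
  "flux_M = (\<lambda>(k, M, p). mean (\<lambda>y. 3 * (kdv_U k M p y)\<^sup>2))"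

definition mean_U2 :: "real \<times> real \<times> real \<Rightarrow> real" where
  "mean_U2 = (\<lambda>(k, M, p). mean (\<lambda>y. (kdv_U k M p y)\<^sup>2))"

definition flux_U2 :: "real \<times> real \<times> real \<Rightarrow> real" where
  "flux_U2 = (\<lambda>(k, M, p).
     mean (\<lambda>y. 2 * (kdv_U k M p y) ^ 3 - 3 / 2 * k\<^sup>2 * (deriv (kdv_U k M p) y)\<^sup>2))"

text \<open>The three conservation laws $\partial_T Q + \partial_X F = 0$ of Whitham's system, as pairs
  $(Q,F)$ of a density and a flux.\<close>

definition whitham_laws ::
  "((real \<times> real \<times> real \<Rightarrow> real) \<times> (real \<times> real \<times> real \<Rightarrow> real)) set" where
  "whitham_laws =
     {((\<lambda>(k, M, p). k), flux_k),
      ((\<lambda>(k, M, p). M), flux_M),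
      ((\<lambda>s. 1 / 2 * mean_U2 s), flux_U2)}"

text \<open>The linearization about the constant state $s$, in the frame moving with speed $c$: here
  $V$ is a function of $(X - cT, T)$.\<close>

definition solves_linearized_whitham ::
  "real \<times> real \<times> real \<Rightarrow> real \<Rightarrow> (real \<Rightarrow> real \<Rightarrow> complex \<times> complex \<times> complex) \<Rightarrow> bool" where
  "solves_linearized_whitham s c V \<longleftrightarrow>
     (\<forall>(Q, F)\<in>whitham_laws. \<forall>X T. \<exists>QT QX FX.
        ((\<lambda>t. cdiff Q s (V X t)) has_vector_derivative QT) (at T) \<and>
        ((\<lambda>x. cdiff Q s (V x T)) has_vector_derivative QX) (at X) \<and>
        ((\<lambda>x. cdiff F s (V x T)) has_vector_derivative FX) (at X) \<and>
        QT - of_real c * QX + FX = 0)"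

definition whitham_characteristic_speed :: "real \<times> real \<times> real \<Rightarrow> complex \<Rightarrow> bool" where
  "whitham_characteristic_speed s \<sigma> \<longleftrightarrow>
     (\<exists>V. V \<noteq> (0, 0, 0) \<and> (\<forall>(Q, F)\<in>whitham_laws. cdiff F s V = \<sigma> * cdiff Q s V))"

definition whitham_hyperbolic :: "real \<times> real \<times> real \<Rightarrow> bool" where
  "whitham_hyperbolic s \<longleftrightarrow> (\<forall>\<sigma>. whitham_characteristic_speed s \<sigma> \<longrightarrow> \<sigma> \<in> \<real>)"

end

(*
  Write U = M + kappa (D - m), where kappa = 8 K^2 k^2, D(x) = dn^2(2 K x) and m = E/K, and put
  s = 1 - p^2. Up to scaling, (B) and the linearized Whitham system then involve only D, s and m.

  Let G be the element of the kernel of (B) at nu = 0 which is not a multiple of U'. Testing (B)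
  against 1, U and the periodic primitives of U - M and G - <G> yields, at the first orders in nu,
  linear relations between the moments <u D^j>, j = 0, 1, 2, and their derivatives in nu. These
  relations are the linearized Whitham system. The derivative of U in p is not needed as a function:
  all variations of U are combinations of 1, D and Z D' - 2 D^2, where Z' = D - m.

  The determinant of the linearized Whitham system is a product of three linear factors in the
  spectral parameter, which gives the three characteristic speeds explicitly. They are real because
  s < m < 1.
*)
theory Submission
  imports Defs
begin

section \<open>Periodic profiles\<close>

text \<open>The obstacle is that pairing with 1 and U, the kernel of the adjoint, may give nothing
  at order \<nu>. Write u(0) = \<alpha> D' + \<beta> \<open>G\<close>. If \<beta> is nonzero, these
  pairings suffice: \<open>G\<close> varies the wave at fixed wavenumber and speed, so k_0 = 0 and
  the conservation of waves is automatic. If \<beta> = 0, then u(0) is a pure phase shift,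
  orthogonal to 1 and U; both conditions move to order \<nu>^2 and involve the unknown derivative of
  u in \<nu>. That derivative is never solved for. The primitives \<open>Z\<close> and
  \<open>Y\<close> are used as test functions because their derivatives D - m and G - <G> are sent
  to polynomials in D of degree at most 2 by the linearized profile operator. Thus only three
  moments of the unknown enter, and the four relations eliminate two of them. The amplitude \<alpha>
  of the phase shift becomes k_0 / k, since the wavenumber of a slowly modulated phase carries one
  more factor \<nu>; the mean of the derivative of u becomes M_0, up to scaling.\<close>

lemma has_integral_zero_mean_derivative:
  fixes \<Phi> :: "real \<Rightarrow> real"
  assumes "\<And>x. (\<Phi> has_real_derivative f x - c) (at x)" and "\<Phi> 1 = \<Phi> 0"
  shows "(f has_integral c) {0..1}"
proof -
  have "((\<lambda>x. f x - c) has_integral (\<Phi> 1 - \<Phi> 0)) {0..1}"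
    by (rule fundamental_theorem_of_calculus)
       (use assms(1) in \<open>auto simp: has_real_derivative_iff_has_vector_derivative
          intro: has_vector_derivative_at_within\<close>)
  then have "((\<lambda>x. f x - c) has_integral 0) {0..1}"
    using assms(2) by simp
  from has_integral_add[OF this has_integral_const_real[of c 0 1]] show ?thesis
    by simp
qed

text \<open>All that (B) needs to know about the wave: in the application \<open>D\<close> is
  dn^2(2Kx), \<open>W\<close> is E(am(2Kx))/(2K) with the incomplete integral of the second kind,
  and h = 1/(4K^2) absorbs the rescaling of x to period 1. \<open>nondegenerate\<close> says that
  \<open>C0\<close>, the constant to which the linearized profile operator sends \<open>G\<close>,
  is not zero.\<close>

locale kdv_profile =
  fixes D D1 W :: "real \<Rightarrow> real" and s m h :: real
  assumes h_pos: "h > 0" and s_pos: "0 < s" and s_less: "s < 1"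
    and deriv_D: "\<And>x. (D has_real_derivative D1 x) (at x)"
    and deriv_D1: "\<And>x. (D1 has_real_derivative (- 6 * (D x)\<^sup>2 + 4 * (1 + s) * D x - 2 * s) / h) (at x)"
    and D1_sq: "\<And>x. h * (D1 x)\<^sup>2 = 4 * D x * (1 - D x) * (D x - s)"
    and deriv_W: "\<And>x. (W has_real_derivative D x) (at x)"
    and D_period: "\<And>x. D (x + 1) = D x"
    and W_period: "\<And>x. W (x + 1) = W x + m"
    and D_0: "D 0 = 1" and W_0: "W 0 = 0"
    and nondegenerate: "2 * (1 - s + s\<^sup>2) * m \<noteq> s * (1 + s)"
begin

definition D2 where "D2 x = (- 6 * (D x)\<^sup>2 + 4 * (1 + s) * D x - 2 * s) / h"
definition Z where "Z x = W x - m * x"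

text \<open>The variance of \<open>D\<close>, and also the mean of \<open>G\<close>. The
  p-derivative of the speed c is 6 \<kappa> v / (s p), so \<open>v_nonzero\<close> below says that c
  really varies with p.\<close>

definition v where "v = (2 * (1 + s) * m - s) / 3 - m\<^sup>2"

text \<open>Up to a constant factor, \<open>G\<close> is the variation of the wave profile in the direction which
  leaves the phase speed unchanged. Here \<open>Q f = h/2 f'' + (6 D - 2 (1 + s)) f\<close> is the linearized
  profile operator.\<close>

definition G where
  "G x = Z x * D1 x - 2 * (D x)\<^sup>2 + 2 * (1 + s - m) * D x + 2 * (1 + s) * m / 3 - 4 * s / 3"
definition G1 where
  "G1 x = (D x - m) * D1 x + Z x * D2 x - 4 * D x * D1 x + 2 * (1 + s - m) * D1 x"
definition Y where "Y x = Z x * (D x - m) + h * D1 x / 2"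

definition Q1 where "Q1 x = 6 * D x - 2 * (1 + s)"
definition C0 where "C0 = - (2 / 3) * (2 * (1 - s + s\<^sup>2) * m - s * (1 + s))"

lemma h_D2: "h * D2 x = - 6 * (D x)\<^sup>2 + 4 * (1 + s) * D x - 2 * s"
  using h_pos by (simp add: D2_def)

lemma deriv_D1': "(D1 has_real_derivative D2 x) (at x)"
  using deriv_D1 by (simp add: D2_def)

definition D3 where "D3 x = (4 * (1 + s) - 12 * D x) * D1 x / h"

lemma deriv_D2: "(D2 has_real_derivative D3 x) (at x)"
  unfolding D2_def D3_def using h_pos
  by (auto intro!: derivative_eq_intros deriv_D simp: field_simps)

lemma deriv_Z: "(Z has_real_derivative D x - m) (at x)"
  unfolding Z_def by (auto intro!: derivative_eq_intros deriv_W)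

lemma deriv_Q1: "(Q1 has_real_derivative 6 * D1 x) (at x)"
  unfolding Q1_def by (auto intro!: derivative_eq_intros deriv_D)

lemma deriv_G: "(G has_real_derivative G1 x) (at x)"
  unfolding G_def G1_def
  by (auto intro!: derivative_eq_intros deriv_D deriv_D1' deriv_Z simp: algebra_simps)

definition G2 where
  "G2 x = D1 x * D1 x + 2 * (D x - m) * D2 x + Z x * D3 x - 4 * (D1 x)\<^sup>2 - 4 * D x * D2 x
     + 2 * (1 + s - m) * D2 x"

lemma deriv_G1: "(G1 has_real_derivative G2 x) (at x)"
  unfolding G1_def G2_def
  by (auto intro!: derivative_eq_intros deriv_D deriv_D1' deriv_D2 deriv_Z
      simp: algebra_simps power2_eq_square)

text \<open>Differentiating Z (D - m) produces the term Z D' of \<open>G\<close>, and what is then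
  left of G - v is exactly h D'' / 2.\<close>

lemma deriv_Y: "(Y has_real_derivative G x - v) (at x)"
proof -
  have "(Y has_real_derivative (D x - m) * (D x - m) + Z x * D1 x + h * D2 x / 2) (at x)"
    unfolding Y_def using h_pos
    by (auto intro!: derivative_eq_intros deriv_D deriv_D1' deriv_Z)
  also have "(D x - m) * (D x - m) + Z x * D1 x + h * D2 x / 2 = G x - v"
    unfolding h_D2 G_def v_def by (simp add: field_simps power2_eq_square)
  finally show ?thesis .
qed

lemma D1_period: "D1 (x + 1) = D1 x"
proof -
  have "((\<lambda>x. D (x + 1)) has_real_derivative D1 (x + 1)) (at x)"
    by (rule DERIV_shift[THEN iffD1, OF deriv_D])
  then show ?thesis
    using deriv_D[of x] by (simp add: D_period DERIV_unique)
qed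

lemma Z_period: "Z (x + 1) = Z x"
  unfolding Z_def W_period by (simp add: algebra_simps)

lemma D2_period: "D2 (x + 1) = D2 x"
  by (simp add: D2_def D_period)

lemma G_period: "G (x + 1) = G x" and Y_period: "Y (x + 1) = Y x"
  and G1_period: "G1 (x + 1) = G1 x"
  by (simp_all add: G_def G1_def Y_def Z_period D_period D1_period D2_period)

lemma profile_periods:
  "D 1 = D 0" "D1 1 = D1 0" "D2 1 = D2 0" "Z 1 = Z 0" "G 1 = G 0" "G1 1 = G1 0" "Y 1 = Y 0"
  using D_period[of 0] D1_period[of 0] D2_period[of 0] Z_period[of 0] G_period[of 0]
    G1_period[of 0] Y_period[of 0]
  by simp_all

subsection \<open>The linearized profile operator\<close>

lemma Q_D1: "Q1 x * D1 x + h / 2 * D3 x = 0"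
  unfolding Q1_def D3_def using h_pos by (simp add: field_simps)

lemma Q_D: "Q1 x * D x + h / 2 * D2 x = 3 * (D x)\<^sup>2 - s"
  using h_D2[of x] by (simp add: Q1_def algebra_simps power2_eq_square)

text \<open>The coefficient of Z vanishes because Q D' = 0; the first integral \<open>D1_sq\<close>
  and the equation for D'' turn the rest into a polynomial in D, of which only the constant
  survives. The operator of (B) at \<nu> = 0 is f -> (Q f)' up to scaling, so a constant image is
  what membership of its kernel means.\<close>

lemma Q_G: "Q1 x * G x + h / 2 * G2 x = C0"
proof -
  have h3: "h * D3 x = (4 * (1 + s) - 12 * D x) * D1 x"
    unfolding D3_def using h_pos by simp
  show ?thesis
    using D1_sq[of x] h_D2[of x] h3
    unfolding Q1_def G_def G2_def C0_def by (simp add: field_simps power2_eq_square) algebra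
qed

lemma C0_nonzero: "C0 \<noteq> 0"
  using nondegenerate by (simp add: C0_def)

subsection \<open>Moments\<close>

text \<open>The moments <D^2>, <D^3>, <D^4>: integrating the derivative of h D^n D' over a period,
  for n = 0, 1, 2, and inserting the two equations of the profile gives a recursion starting from
  <D> = m. \<open>\<Phi>2\<close>, \<open>\<Phi>3\<close>, \<open>\<Phi>4\<close> are the
  corresponding periodic primitives.\<close>

definition d2 where "d2 = (2 * (1 + s) * m - s) / 3"
definition d3 where "d3 = (4 * (1 + s) * d2 - 3 * s * m) / 5"
definition d4 where "d4 = (6 * (1 + s) * d3 - 5 * s * d2) / 7"

definition \<Phi>2 where "\<Phi>2 x = - h * D1 x / 6 + 2 * (1 + s) / 3 * Z x"
definition \<Phi>3 where "\<Phi>3 x = - h * (D x * D1 x) / 10 + 4 * (1 + s) / 5 * \<Phi>2 x - 3 * s / 5 * Z x"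
definition \<Phi>4 where
  "\<Phi>4 x = - h * ((D x)\<^sup>2 * D1 x) / 14 + 6 * (1 + s) / 7 * \<Phi>3 x - 5 * s / 7 * \<Phi>2 x"

lemma deriv_\<Phi>2: "(\<Phi>2 has_real_derivative (D x)\<^sup>2 - d2) (at x)"
proof -
  have "(\<Phi>2 has_real_derivative - (h * D2 x) / 6 + 2 * (1 + s) / 3 * (D x - m)) (at x)"
    unfolding \<Phi>2_def using h_pos
    by (auto intro!: derivative_eq_intros deriv_D1' deriv_Z)
  then show ?thesis
    unfolding h_D2 d2_def by (rule DERIV_cong) (simp add: field_simps)
qed

lemma deriv_\<Phi>3: "(\<Phi>3 has_real_derivative (D x)^3 - d3) (at x)"
proof -
  have "(\<Phi>3 has_real_derivative - (h * (D1 x)\<^sup>2 + D x * (h * D2 x)) / 10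
      + 4 * (1 + s) / 5 * ((D x)\<^sup>2 - d2) - 3 * s / 5 * (D x - m)) (at x)"
    unfolding \<Phi>3_def using h_pos
    by (auto intro!: derivative_eq_intros deriv_D deriv_D1' deriv_Z deriv_\<Phi>2
        simp: field_simps power2_eq_square)
  then show ?thesis
    unfolding h_D2 D1_sq d3_def
    by (rule DERIV_cong) (simp add: field_simps power2_eq_square power3_eq_cube)
qed

lemma deriv_\<Phi>4: "(\<Phi>4 has_real_derivative (D x)^4 - d4) (at x)"
proof -
  have "(\<Phi>4 has_real_derivative - (2 * D x * (h * (D1 x)\<^sup>2) + (D x)\<^sup>2 * (h * D2 x)) / 14
      + 6 * (1 + s) / 7 * ((D x)^3 - d3) - 5 * s / 7 * ((D x)\<^sup>2 - d2)) (at x)"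
    unfolding \<Phi>4_def using h_pos
    by (auto intro!: derivative_eq_intros deriv_D deriv_D1' deriv_\<Phi>3 deriv_\<Phi>2
        simp: field_simps power2_eq_square)
  then show ?thesis
    unfolding h_D2 D1_sq d4_def
    by (rule DERIV_cong) (simp add: field_simps power2_eq_square power3_eq_cube power4_eq_xxxx)
qed

text \<open>The pairings <G D> and <G D^2>. Integration by parts replaces Z D' D^j by - (D - m)
  D^(j+1) / (j+1), which reduces everything to moments of D.\<close>

definition g1 where "g1 = - (d3 - m * d2) / 2 - 2 * d3 + 2 * (1 + s - m) * d2
  + (2 * (1 + s) * m / 3 - 4 * s / 3) * m"
definition g2 where "g2 = - (d4 - m * d3) / 3 - 2 * d4 + 2 * (1 + s - m) * d3
  + (2 * (1 + s) * m / 3 - 4 * s / 3) * d2"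

definition \<Gamma>1 where "\<Gamma>1 x = (D x)\<^sup>2 * Z x / 2 - (\<Phi>3 x - m * \<Phi>2 x) / 2 - 2 * \<Phi>3 x
  + 2 * (1 + s - m) * \<Phi>2 x + (2 * (1 + s) * m / 3 - 4 * s / 3) * Z x"
definition \<Gamma>2 where "\<Gamma>2 x = (D x)^3 * Z x / 3 - (\<Phi>4 x - m * \<Phi>3 x) / 3 - 2 * \<Phi>4 x
  + 2 * (1 + s - m) * \<Phi>3 x + (2 * (1 + s) * m / 3 - 4 * s / 3) * \<Phi>2 x"

lemma deriv_\<Gamma>1: "(\<Gamma>1 has_real_derivative G x * D x - g1) (at x)"
  unfolding \<Gamma>1_def
  by (auto intro!: derivative_eq_intros deriv_D deriv_Z deriv_\<Phi>2 deriv_\<Phi>3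
        simp: g1_def G_def field_simps power2_eq_square power3_eq_cube)

lemma deriv_\<Gamma>2: "(\<Gamma>2 has_real_derivative G x * (D x)\<^sup>2 - g2) (at x)"
  unfolding \<Gamma>2_def
  by (auto intro!: derivative_eq_intros deriv_D deriv_Z deriv_\<Phi>2 deriv_\<Phi>3 deriv_\<Phi>4
        simp: g2_def G_def field_simps power2_eq_square power3_eq_cube power4_eq_xxxx)

lemma mean_D: "(D has_integral m) {0..1}"
  by (rule has_integral_zero_mean_derivative[OF deriv_Z]) (simp add: profile_periods)

lemma mean_D_sq: "((\<lambda>x. (D x)\<^sup>2) has_integral d2) {0..1}"
  by (rule has_integral_zero_mean_derivative[OF deriv_\<Phi>2]) (simp add: profile_periods \<Phi>2_def)

lemma mean_D_cube: "((\<lambda>x. (D x)^3) has_integral d3) {0..1}"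
  by (rule has_integral_zero_mean_derivative[OF deriv_\<Phi>3])
    (simp add: profile_periods \<Phi>2_def \<Phi>3_def)

lemma mean_G: "(G has_integral v) {0..1}"
  by (rule has_integral_zero_mean_derivative[OF deriv_Y]) (simp add: profile_periods)

lemma mean_G_D: "((\<lambda>x. G x * D x) has_integral g1) {0..1}"
  by (rule has_integral_zero_mean_derivative[OF deriv_\<Gamma>1])
    (simp add: profile_periods \<Phi>2_def \<Phi>3_def \<Gamma>1_def)

lemma mean_G_D_sq: "((\<lambda>x. G x * (D x)\<^sup>2) has_integral g2) {0..1}"
  by (rule has_integral_zero_mean_derivative[OF deriv_\<Gamma>2])
    (simp add: profile_periods \<Phi>2_def \<Phi>3_def \<Phi>4_def \<Gamma>2_def)

definition e2 where "e2 = 4 * (- d3 + (1 + s) * d2 - s * m)"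

lemma mean_D1_sq: "((\<lambda>x. h * (D1 x)\<^sup>2) has_integral e2) {0..1}"
proof -
  have "((\<lambda>x. 4 * (- ((D x)^3) + (1 + s) * (D x)\<^sup>2 - s * D x)) has_integral e2) {0..1}"
    unfolding e2_def
    by (intro has_integral_mult_right has_integral_add has_integral_diff has_integral_neg
        mean_D mean_D_sq mean_D_cube)
  then show ?thesis
    by (rule has_integral_eq[rotated])
      (simp only: D1_sq, simp add: algebra_simps power2_eq_square power3_eq_cube)
qed

lemma mean_D1: "(D1 has_integral 0) {0..1}"
  by (rule has_integral_zero_mean_derivative[of D]) (simp_all add: profile_periods deriv_D)

lemma mean_D1_D: "((\<lambda>x. D1 x * D x) has_integral 0) {0..1}"
  by (rule has_integral_zero_mean_derivative[of "\<lambda>x. (D x)\<^sup>2 / 2"])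
    (auto intro!: derivative_eq_intros deriv_D simp: profile_periods)

lemma mean_D1_D_sq: "((\<lambda>x. D1 x * (D x)\<^sup>2) has_integral 0) {0..1}"
  by (rule has_integral_zero_mean_derivative[of "\<lambda>x. (D x)^3 / 3"])
    (auto intro!: derivative_eq_intros deriv_D simp: profile_periods)

lemma v_eq: "v = d2 - m\<^sup>2"
  by (simp add: v_def d2_def)

lemma mean_D1_Z: "((\<lambda>x. D1 x * Z x) has_integral - v) {0..1}"
proof (rule has_integral_zero_mean_derivative)
  show "((\<lambda>x. D x * Z x - \<Phi>2 x + m * Z x) has_real_derivative D1 x * Z x - - v) (at x)" for x
    by (auto intro!: derivative_eq_intros deriv_D deriv_Z deriv_\<Phi>2
        simp: v_eq algebra_simps power2_eq_square)
qed (simp add: profile_periods \<Phi>2_def)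

definition z1 where "z1 = 6 * d3 - (4 * (1 + s) + 6 * m) * d2 + (4 * (1 + s) * m + 3 * s) * m - 3 * s * m"

text \<open>The pairing of D' with the order \<nu> image of the test function \<open>Z\<close>,
  whose second derivative is D'. As Q1 D' is the derivative of 3 D^2 - 2 (1 + s) D, one integration
  by parts removes Z.\<close>

lemma mean_D1_Q_Z: "((\<lambda>x. D1 x * (Q1 x * Z x + 3 * h / 2 * D1 x)) has_integral z1) {0..1}"
proof (rule has_integral_zero_mean_derivative)
  let ?\<Phi> = "\<lambda>x. (3 * (D x)\<^sup>2 - 2 * (1 + s) * D x) * Z x + 3 * h / 2 * (D1 x * (D x - m))
     + 6 * \<Phi>3 x - (4 * (1 + s) + 6 * m) * \<Phi>2 x + (4 * (1 + s) * m + 3 * s) * Z x"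
  show "(?\<Phi> has_real_derivative
      D1 x * (Q1 x * Z x + 3 * h / 2 * D1 x) - z1) (at x)" for x
  proof -
    have "(?\<Phi> has_real_derivative
      (6 * D x * D1 x - 2 * (1 + s) * D1 x) * Z x + (3 * (D x)\<^sup>2 - 2 * (1 + s) * D x) * (D x - m)
      + 3 / 2 * ((h * D2 x) * (D x - m) + h * (D1 x)\<^sup>2)
      + 6 * ((D x)^3 - d3) - (4 * (1 + s) + 6 * m) * ((D x)\<^sup>2 - d2)
      + (4 * (1 + s) * m + 3 * s) * (D x - m)) (at x)"
      by (auto intro!: derivative_eq_intros deriv_D deriv_D1' deriv_Z deriv_\<Phi>2 deriv_\<Phi>3
        simp: algebra_simps power2_eq_square)
    then show ?thesis
      unfolding h_D2
      by (rule DERIV_cong)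
        (simp add: z1_def Q1_def field_simps power2_eq_square power3_eq_cube)
  qed
qed (simp add: profile_periods \<Phi>2_def \<Phi>3_def)

lemma mean_D1_Y: "((\<lambda>x. D1 x * Y x) has_integral - (g1 - m * v)) {0..1}"
proof (rule has_integral_zero_mean_derivative)
  show "((\<lambda>x. D x * Y x - \<Gamma>1 x + v * Z x) has_real_derivative
      D1 x * Y x - - (g1 - m * v)) (at x)" for x
    by (auto intro!: derivative_eq_intros deriv_D deriv_Z deriv_Y deriv_\<Gamma>1
        simp: algebra_simps)
qed (simp add: profile_periods \<Phi>2_def \<Phi>3_def \<Gamma>1_def)

definition y1 where
  "y1 = 6 * g2 - 4 * (1 + s) * g1 + 3 * s * v + v * (3 * d2 - 2 * (1 + s) * m)"

lemma mean_D1_Q_Y: "((\<lambda>x. D1 x * (Q1 x * Y x + 3 * h / 2 * G1 x)) has_integral y1) {0..1}"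
proof (rule has_integral_zero_mean_derivative)
  let ?\<Phi> = "\<lambda>x. 3 * h / 2 * (D1 x * G x) + (3 * (D x)\<^sup>2 - 2 * (1 + s) * D x) * Y x
      + 6 * \<Gamma>2 x - 4 * (1 + s) * \<Gamma>1 x + 3 * s * Y x + v * (3 * \<Phi>2 x - 2 * (1 + s) * Z x)"
  show "(?\<Phi> has_real_derivative D1 x * (Q1 x * Y x + 3 * h / 2 * G1 x) - y1) (at x)" for x
  proof -
    have "(?\<Phi> has_real_derivative
      3 / 2 * ((h * D2 x) * G x) + 3 * h / 2 * (D1 x * G1 x)
      + (6 * D x * D1 x - 2 * (1 + s) * D1 x) * Y x
      + (3 * (D x)\<^sup>2 - 2 * (1 + s) * D x) * (G x - v)
      + 6 * (G x * (D x)\<^sup>2 - g2) - 4 * (1 + s) * (G x * D x - g1) + 3 * s * (G x - v)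
      + v * (3 * ((D x)\<^sup>2 - d2) - 2 * (1 + s) * (D x - m))) (at x)"
      by (auto intro!: derivative_eq_intros deriv_D deriv_D1' deriv_Z deriv_\<Phi>2 deriv_G deriv_Y
          deriv_\<Gamma>1 deriv_\<Gamma>2
        simp: algebra_simps power2_eq_square)
    then show ?thesis
      unfolding h_D2
      by (rule DERIV_cong)
        (simp add: y1_def Q1_def field_simps power2_eq_square power3_eq_cube)
  qed
qed (simp add: profile_periods \<Phi>2_def \<Phi>3_def \<Phi>4_def \<Gamma>1_def \<Gamma>2_def)

end

section \<open>The linearized Whitham system\<close>

definition whitham_v :: "'a::field \<Rightarrow> 'a \<Rightarrow> 'a" where
  "whitham_v s m = (2 * (1 + s) * m - s) / 3 - m\<^sup>2"

definition whitham_w :: "'a::field \<Rightarrow> 'a \<Rightarrow> 'a" where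
  "whitham_w s m = (2 * m * s\<^sup>2 - 12 * m\<^sup>2 * s + 12 * m^3 + 10 * m * s - 12 * m\<^sup>2 - s\<^sup>2 + 2 * m - s) / 3"

text \<open>The derivative of \<open>whitham_w\<close> in the direction e = 1: its partial
  derivatives in m and s are multiplied by \<delta>m = m^2 - 2 s m + s and \<delta>s = 2 s (1 - s),
  the latter from s = 1 - p^2 and p_0 = - s p e.\<close>

definition whitham_dw :: "'a::field \<Rightarrow> 'a \<Rightarrow> 'a" where
  "whitham_dw s m =
     (2 * s\<^sup>2 - 24 * m * s + 36 * m\<^sup>2 + 10 * s - 24 * m + 2) / 3 * (m\<^sup>2 - 2 * s * m + s)
     + (4 * m * s - 12 * m\<^sup>2 + 10 * m - 2 * s - 1) / 3 * (2 * s * (1 - s))"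

text \<open>\<open>s = 1 - p\<^sup>2\<close> and \<open>m = E / K\<close>; with \<open>U = M + \<kappa> (D - m)\<close>, the variance of \<open>D\<close> is \<open>whitham_v\<close>, and
  \<open>whitham_w\<close> is the part of \<open>\<langle>2 U\<^sup>3 - 3/2 k\<^sup>2 U'\<^sup>2\<rangle>\<close> which is cubic in \<open>\<kappa>\<close>. The unknowns are
  \<open>\<tau> = \<lambda> / \<kappa>\<close>, \<open>a = k\<^sub>0 / k\<close>, \<open>b = M\<^sub>0 / \<kappa>\<close> and \<open>e = - p\<^sub>0 / (s p)\<close>. The last scaling makes the
  variations polynomial: \<open>\<delta>K / K = - (m - s) e\<close> and \<open>\<delta>m = (m\<^sup>2 - 2 s m + s) e\<close>.\<close>

definition normal_whitham :: "'a::field \<Rightarrow> 'a \<Rightarrow> 'a \<Rightarrow> 'a \<Rightarrow> 'a \<Rightarrow> 'a \<Rightarrow> bool" where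
  "normal_whitham s m \<tau> a b e \<longleftrightarrow>
     (\<tau> + 4 * (1 + s) - 12 * m) * a + 6 * b - 6 * whitham_v s m * e = 0 \<and>
     12 * whitham_v s m * a + (\<tau> + 6 * m - 2 * (1 + s)) * b - 6 * (m * (1 - m) * (m - s)) * e = 0 \<and>
     (2 * whitham_v s m * (\<tau> + 6 * m - 2 * (1 + s)) + 6 * whitham_w s m) * a
       + 6 * whitham_v s m * b
       + (whitham_dw s m - 6 * (m - s) * whitham_w s m
          - (\<tau> + 6 * m - 2 * (1 + s)) * (m * (1 - m) * (m - s))) * e = 0"

text \<open>The bridge between the two sides: the averaged fluxes bring in the cubic quantity
  \<open>whitham_w\<close>, while the pairings with \<open>G\<close> only know the variance and m (1
  - m) (m - s). The identity removes \<open>whitham_w\<close> from the coefficient of e.\<close>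

lemma whitham_dw_eq:
  fixes s m :: "'a::field_char_0"
  shows "whitham_dw s m - 6 * (m - s) * whitham_w s m
    = 6 * (whitham_v s m)\<^sup>2 - 6 * (m * (1 - m) * (m - s)) * (1 + s - 3 * m)"
  unfolding whitham_v_def whitham_w_def whitham_dw_def
  by (simp add: field_simps power2_eq_square power3_eq_cube)

subsection \<open>Pairings\<close>

text \<open>Bilinear, with real test functions and no conjugation, so that the weak form of (B) is
  polynomial in \<nu>.\<close>

definition pair :: "(real \<Rightarrow> complex) \<Rightarrow> (real \<Rightarrow> real) \<Rightarrow> complex" where
  "pair u \<phi> = integral {0..1} (\<lambda>x. u x * of_real (\<phi> x))"

lemma pair_has_integral:
  assumes "continuous_on {0..1} u" and "continuous_on {0..1} \<phi>"
  shows "((\<lambda>x. u x * of_real (\<phi> x)) has_integral pair u \<phi>) {0..1}"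
  unfolding pair_def
  by (intro integrable_integral integrable_continuous_real continuous_intros assms)

lemma pairI: "((\<lambda>x. u x * of_real (\<phi> x)) has_integral y) {0..1} \<Longrightarrow> pair u \<phi> = y"
  unfolding pair_def by (rule integral_unique)

lemma has_integral_of_real_mult:
  fixes f :: "real \<Rightarrow> real" and c :: complex
  assumes "(f has_integral y) S"
  shows "((\<lambda>x. c * of_real (f x)) has_integral c * of_real y) S"
  using has_integral_mult_right[OF has_integral_linear[OF assms bounded_linear_of_real], of c]
  by (simp add: o_def)

lemma pair_combination:
  assumes "\<And>x. u x = \<alpha> * of_real (f x) + \<beta> * of_real (g x)"
    and "((\<lambda>x. f x * \<phi> x) has_integral y) {0..1}" and "((\<lambda>x. g x * \<phi> x) has_integral z) {0..1}"
  shows "pair u \<phi> = \<alpha> * of_real y + \<beta> * of_real z"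
proof (rule pairI)
  show "((\<lambda>x. u x * of_real (\<phi> x)) has_integral \<alpha> * of_real y + \<beta> * of_real z) {0..1}"
    using has_integral_add[OF has_integral_of_real_mult[OF assms(2), of \<alpha>]
        has_integral_of_real_mult[OF assms(3), of \<beta>]]
    by (simp add: assms(1) algebra_simps)
qed

lemma pair_multiple:
  assumes "\<And>x. u x = \<alpha> * of_real (f x)" and "((\<lambda>x. f x * \<phi> x) has_integral y) {0..1}"
  shows "pair u \<phi> = \<alpha> * of_real y"
  using pair_combination[of u \<alpha> f 0 "\<lambda>_. 0" \<phi> y 0] assms by simp

subsection \<open>Orders in the Bloch parameter\<close>

lemma has_vector_derivative_at_0_quotient:
  fixes f :: "real \<Rightarrow> complex"
  assumes "(f has_vector_derivative d) (at 0)" and "f 0 = 0"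
  shows "((\<lambda>\<xi>. f \<xi> / of_real \<xi>) \<longlongrightarrow> d) (at 0)"
proof -
  have lim: "((\<lambda>\<xi>. norm (f \<xi> - \<xi> *\<^sub>R d) / norm \<xi>) \<longlongrightarrow> 0) (at 0)"
    using assms by (simp add: has_vector_derivative_def has_derivative_at)
  have "((\<lambda>\<xi>. norm (f \<xi> / of_real \<xi> - d)) \<longlongrightarrow> 0) (at 0)"
  proof (rule Lim_transform_eventually[OF lim])
    have "norm (f \<xi> - \<xi> *\<^sub>R d) / norm \<xi> = norm (f \<xi> / of_real \<xi> - d)" if "\<xi> \<noteq> 0" for \<xi>
    proof -
      have "f \<xi> / of_real \<xi> - d = (f \<xi> - \<xi> *\<^sub>R d) / of_real \<xi>"
        using that by (simp add: field_simps scaleR_conv_of_real)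
      then show ?thesis by (simp add: norm_divide)
    qed
    then show "\<forall>\<^sub>F \<xi> in at 0. norm (f \<xi> - \<xi> *\<^sub>R d) / norm \<xi> = norm (f \<xi> / of_real \<xi> - d)"
      by (auto simp: eventually_at_filter)
  qed
  then show ?thesis
    by (simp add: tendsto_norm_zero_iff LIM_zero_iff)
qed

lemma tendsto_at_0_eq_0:
  fixes f :: "real \<Rightarrow> complex"
  assumes "(f \<longlongrightarrow> l) (at 0)" and "\<epsilon> > 0" and "\<And>\<xi>. \<lbrakk>\<xi> \<noteq> 0; \<bar>\<xi>\<bar> < \<epsilon>\<rbrakk> \<Longrightarrow> f \<xi> = 0"
  shows "l = 0"
proof -
  have "eventually (\<lambda>\<xi>. f \<xi> = 0) (at 0)"
    unfolding eventually_at using assms(2,3) by (auto intro!: exI[of _ \<epsilon>] simp: dist_real_def)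
  then have "(f \<longlongrightarrow> 0) (at 0)"
    by (rule tendsto_eventually)
  with assms(1) show ?thesis
    by (rule tendsto_unique[rotated]) simp
qed

text \<open>Divide by \<nu> = i \<xi> and let \<xi> tend to 0. The term \<open>B\<close>, the
  pairing with the image of the test function under the adjoint at \<nu> = 0, carries no factor
  \<nu>; since it vanishes at 0, the quotient tends to B' / i, its derivative in \<nu>.\<close>

lemma bloch_first_order:
  fixes A B C E :: "real \<Rightarrow> complex"
  assumes "\<epsilon> > 0"
    and eq: "\<And>\<xi>. \<bar>\<xi>\<bar> < \<epsilon> \<Longrightarrow> \<mu> \<xi> * A \<xi> - B \<xi> + (\<i> * of_real \<xi>) * C \<xi>
        - c1 * (\<i> * of_real \<xi>)\<^sup>2 * E \<xi> + c2 * (\<i> * of_real \<xi>)^3 * A \<xi> = 0"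
    and \<mu>: "((\<lambda>\<xi>. \<mu> \<xi> / (\<i> * of_real \<xi>)) \<longlongrightarrow> \<tau>) (at 0)"
    and A: "(A \<longlongrightarrow> A0) (at 0)" and C: "(C \<longlongrightarrow> C0) (at 0)" and E: "(E \<longlongrightarrow> E0) (at 0)"
    and B: "(B has_vector_derivative B') (at 0)" "B 0 = 0"
  shows "\<tau> * A0 - B' / \<i> + C0 = 0"
proof -
  let ?f = "\<lambda>\<xi>. \<mu> \<xi> / (\<i> * of_real \<xi>) * A \<xi> - B \<xi> / of_real \<xi> / \<i> + C \<xi>
    - c1 * (\<i> * of_real \<xi>) * E \<xi> + c2 * (\<i> * of_real \<xi>)\<^sup>2 * A \<xi>"
  have "(?f \<longlongrightarrow> \<tau> * A0 - B' / \<i> + C0 - c1 * (\<i> * of_real 0) * E0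
      + c2 * (\<i> * of_real 0)\<^sup>2 * A0) (at 0)"
    by (intro tendsto_intros \<mu> A C E has_vector_derivative_at_0_quotient[OF B]) simp_all
  then have "\<tau> * A0 - B' / \<i> + C0 - c1 * (\<i> * of_real 0) * E0 + c2 * (\<i> * of_real 0)\<^sup>2 * A0 = 0"
  proof (rule tendsto_at_0_eq_0[OF _ \<open>\<epsilon> > 0\<close>])
    fix \<xi> :: real assume "\<xi> \<noteq> 0" "\<bar>\<xi>\<bar> < \<epsilon>"
    then have "?f \<xi> = (\<mu> \<xi> * A \<xi> - B \<xi> + (\<i> * of_real \<xi>) * C \<xi>
        - c1 * (\<i> * of_real \<xi>)\<^sup>2 * E \<xi> + c2 * (\<i> * of_real \<xi>)^3 * A \<xi>) / (\<i> * of_real \<xi>)"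
      by (simp add: field_simps power2_eq_square power3_eq_cube)
    then show "?f \<xi> = 0" using eq[OF \<open>\<bar>\<xi>\<bar> < \<epsilon>\<close>] by simp
  qed
  then show ?thesis by simp
qed

text \<open>For test functions in the kernel of the adjoint there is no term \<open>B\<close>. If
  \<open>A\<close> and \<open>C\<close> also vanish at \<xi> = 0, the identity can be divided by
  \<nu>^2, and then \<open>E\<close> contributes its value at 0.\<close>

lemma bloch_second_order:
  fixes A C E :: "real \<Rightarrow> complex"
  assumes "\<epsilon> > 0"
    and eq: "\<And>\<xi>. \<bar>\<xi>\<bar> < \<epsilon> \<Longrightarrow> \<mu> \<xi> * A \<xi> + (\<i> * of_real \<xi>) * C \<xi>
        - c1 * (\<i> * of_real \<xi>)\<^sup>2 * E \<xi> + c2 * (\<i> * of_real \<xi>)^3 * A \<xi> = 0"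
    and \<mu>: "((\<lambda>\<xi>. \<mu> \<xi> / (\<i> * of_real \<xi>)) \<longlongrightarrow> \<tau>) (at 0)"
    and E: "(E \<longlongrightarrow> E0) (at 0)"
    and A: "(A has_vector_derivative A') (at 0)" "A 0 = 0"
    and C: "(C has_vector_derivative C') (at 0)" "C 0 = 0"
  shows "\<tau> * (A' / \<i>) + C' / \<i> - c1 * E0 = 0"
proof -
  have A_tendsto: "(A \<longlongrightarrow> 0) (at 0)"
    using has_vector_derivative_continuous[OF A(1)] A(2) by (simp add: continuous_within)
  let ?f = "\<lambda>\<xi>. \<mu> \<xi> / (\<i> * of_real \<xi>) * (A \<xi> / of_real \<xi> / \<i>) + C \<xi> / of_real \<xi> / \<i>
    - c1 * E \<xi> + c2 * (\<i> * of_real \<xi>) * A \<xi>"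
  have "(?f \<longlongrightarrow> \<tau> * (A' / \<i>) + C' / \<i> - c1 * E0 + c2 * (\<i> * of_real 0) * 0) (at 0)"
    by (intro tendsto_intros \<mu> A_tendsto E has_vector_derivative_at_0_quotient A C) simp_all
  then have "\<tau> * (A' / \<i>) + C' / \<i> - c1 * E0 + c2 * (\<i> * of_real 0) * 0 = 0"
  proof (rule tendsto_at_0_eq_0[OF _ \<open>\<epsilon> > 0\<close>])
    fix \<xi> :: real assume "\<xi> \<noteq> 0" "\<bar>\<xi>\<bar> < \<epsilon>"
    then have "?f \<xi> = (\<mu> \<xi> * A \<xi> + (\<i> * of_real \<xi>) * C \<xi>
        - c1 * (\<i> * of_real \<xi>)\<^sup>2 * E \<xi> + c2 * (\<i> * of_real \<xi>)^3 * A \<xi>) / (\<i> * of_real \<xi>)\<^sup>2"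
      by (simp add: field_simps power2_eq_square power3_eq_cube)
    then show "?f \<xi> = 0" using eq[OF \<open>\<bar>\<xi>\<bar> < \<epsilon>\<close>] by simp
  qed
  then show ?thesis by simp
qed

section \<open>The periodic kernel of the linearized operator\<close>

context kdv_profile
begin

definition R where "R = 1 - s + s\<^sup>2"
text \<open>Two non-periodic functions have constant images under Q: x D' + 2 D - 2 (1 + s) / 3,
  from the scaling and Galilean symmetries, is sent to 4 R / 3, and W D' - 2 D^2 + 2 (1 + s) D - 4 s
  / 3 is sent to 2 s (1 + s) / 3. In \<open>H\<close> they are combined so that the constants
  cancel; \<open>G\<close> is the second minus m times the first, so that the growth in x
  cancels.\<close>

definition H where
  "H x = 2 * R * (W x * D1 x - 2 * (D x)\<^sup>2 + 2 * (1 + s) * D x - 4 * s / 3)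
     - s * (1 + s) * (x * D1 x + 2 * D x - 2 * (1 + s) / 3)"
definition H1 where
  "H1 x = 2 * R * (W x * D2 x - 3 * D x * D1 x + 2 * (1 + s) * D1 x)
     - s * (1 + s) * (x * D2 x + 3 * D1 x)"
definition H2 where
  "H2 x = 2 * R * (W x * D3 x + D x * D2 x - 3 * (D1 x)\<^sup>2 - 3 * D x * D2 x + 2 * (1 + s) * D2 x)
     - s * (1 + s) * (x * D3 x + 4 * D2 x)"

lemma deriv_H: "(H has_real_derivative H1 x) (at x)"
  unfolding H_def H1_def
  by (auto intro!: derivative_eq_intros deriv_D deriv_D1' deriv_W simp: algebra_simps)

lemma deriv_H1: "(H1 has_real_derivative H2 x) (at x)"
  unfolding H1_def H2_def
  by (auto intro!: derivative_eq_intros deriv_D deriv_D1' deriv_D2 deriv_W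
      simp: algebra_simps power2_eq_square)

lemma Q_H: "Q1 x * H x + h / 2 * H2 x = 0"
proof -
  have h3: "h * D3 x = (4 * (1 + s) - 12 * D x) * D1 x"
    unfolding D3_def using h_pos by simp
  have "Q1 x * H x + h / 2 * H2 x = 2 * R * (Q1 x * (W x * D1 x - 2 * (D x)\<^sup>2 + 2 * (1 + s) * D x - 4 * s / 3)
      + (W x * (h * D3 x) - 2 * D x * (h * D2 x) - 3 * (h * (D1 x)\<^sup>2) + 2 * (1 + s) * (h * D2 x)) / 2)
      - s * (1 + s) * (Q1 x * (x * D1 x + 2 * D x - 2 * (1 + s) / 3) + (x * (h * D3 x) + 4 * (h * D2 x)) / 2)"
    unfolding H_def H2_def by (simp add: field_simps)
  also have "\<dots> = 0"
    unfolding h3 h_D2 D1_sq Q1_def R_def by (simp add: field_simps power2_eq_square)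
  finally show ?thesis .
qed

lemma H_shift: "H (x + 1) = H x + (2 * R * m - s * (1 + s)) * D1 x"
  unfolding H_def D_period D1_period W_period by (simp add: algebra_simps)

lemma D1_0: "D1 0 = 0"
  using D1_sq[of 0] h_pos by (simp add: D_0)

lemma D2_0: "D2 0 = - 2 * (1 - s) / h"
  by (simp add: D2_def D_0 field_simps)

text \<open>The equation Q f = 0 has no first-order term, so the Wronskian of two solutions is
  constant. It is evaluated at 0, where D = 1 and D' = W = 0, and is not zero because 0 < s <
  1.\<close>

lemma wronskian: "D1 x * H1 x - D2 x * H x = - 4 * s\<^sup>2 * (1 - s)\<^sup>2 / h"
proof -
  have "((\<lambda>x. D1 x * H1 x - D2 x * H x) has_real_derivative 0) (at x)" for x
  proof -
    have "((\<lambda>x. D1 x * H1 x - D2 x * H x) has_real_derivative D1 x * H2 x - D3 x * H x) (at x)"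
      by (auto intro!: derivative_eq_intros deriv_D1' deriv_D2 deriv_H deriv_H1)
    moreover have "h / 2 * (D1 x * H2 x - D3 x * H x) = 0"
    proof -
      have "h / 2 * (D1 x * H2 x - D3 x * H x)
          = D1 x * (Q1 x * H x + h / 2 * H2 x) - H x * (Q1 x * D1 x + h / 2 * D3 x)"
        by (simp add: algebra_simps)
      then show ?thesis unfolding Q_H Q_D1 by simp
    qed
    ultimately show ?thesis using h_pos by simp
  qed
  then have "D1 x * H1 x - D2 x * H x = D1 0 * H1 0 - D2 0 * H 0"
    by (intro DERIV_isconst_all) auto
  also have "\<dots> = - 4 * s\<^sup>2 * (1 - s)\<^sup>2 / h"
    using h_pos
    by (simp add: D1_0 D2_0 H_def D_0 W_0 R_def field_simps power2_eq_square)
  finally show ?thesis .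
qed

text \<open>A second homogeneous solution \<open>H\<close>, which is not periodic, determines all periodic
  solutions through Wronskians.\<close>

lemma linearized_kernel:
  fixes u u1 u2 u3 :: "real \<Rightarrow> complex"
  assumes u: "\<And>x. (u has_vector_derivative u1 x) (at x)"
    and u1: "\<And>x. (u1 has_vector_derivative u2 x) (at x)"
    and u2: "\<And>x. (u2 has_vector_derivative u3 x) (at x)"
    and per: "\<And>x. u (x + 1) = u x"
    and eq: "\<And>x. of_real (6 * D1 x) * u x + of_real (Q1 x) * u1 x + of_real (h / 2) * u3 x = 0"
  obtains \<alpha> \<beta> where "\<And>x. u x = \<alpha> * of_real (D1 x) + \<beta> * of_real (G x)"
proof -
  have const: "\<exists>c. \<forall>x. f x = c" if "\<And>x. (f has_vector_derivative 0) (at x)"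
    for f :: "real \<Rightarrow> complex"
    using has_vector_derivative_zero_constant[of UNIV f] that by (metis UNIV_I convex_UNIV)
  have "((\<lambda>x. of_real (Q1 x) * u x + of_real (h / 2) * u2 x) has_vector_derivative 0) (at x)" for x
    using has_vector_derivative_add[OF
        has_vector_derivative_mult[OF has_vector_derivative_of_real[OF deriv_Q1[of x]] u[of x]]
        has_vector_derivative_mult[OF has_vector_derivative_const[of "of_real (h / 2)"] u2[of x]]]
      eq[of x] by (simp add: add.commute)
  then obtain c where c: "\<And>x. of_real (Q1 x) * u x + of_real (h / 2) * u2 x = c"
    using const[of "\<lambda>x. of_real (Q1 x) * u x + of_real (h / 2) * u2 x"] by blast
  \<comment> \<open>Q u is the constant c and Q G = C0, so subtracting \<beta> G leaves a solution
    of the homogeneous second-order equation.\<close>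
  define \<beta> where "\<beta> = c / of_real C0"
  define f f1 f2 where "f x = u x - \<beta> * of_real (G x)" and "f1 x = u1 x - \<beta> * of_real (G1 x)"
    and "f2 x = u2 x - \<beta> * of_real (G2 x)" for x
  have f: "(f has_vector_derivative f1 x) (at x)" for x
    unfolding f_def f1_def
    using has_vector_derivative_diff[OF u[of x] has_vector_derivative_mult[OF
          has_vector_derivative_const[of \<beta>] has_vector_derivative_of_real[OF deriv_G[of x]]]]
    by simp
  have f1: "(f1 has_vector_derivative f2 x) (at x)" for x
    unfolding f1_def f2_def
    using has_vector_derivative_diff[OF u1[of x] has_vector_derivative_mult[OF
          has_vector_derivative_const[of \<beta>] has_vector_derivative_of_real[OF deriv_G1[of x]]]]
    by simp
  have Qf: "of_real (Q1 x) * f x + of_real (h / 2) * f2 x = 0" for x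
  proof -
    have "of_real (Q1 x) * f x + of_real (h / 2) * f2 x
        = (of_real (Q1 x) * u x + of_real (h / 2) * u2 x) - \<beta> * of_real (Q1 x * G x + h / 2 * G2 x)"
      by (simp add: f_def f2_def algebra_simps)
    then show ?thesis
      unfolding c Q_G using C0_nonzero by (simp add: \<beta>_def)
  qed
  have wr: "\<exists>a. \<forall>x. f x * of_real (g1 x) - f1 x * of_real (g x) = a"
    if g: "\<And>x. (g has_real_derivative g1 x) (at x)" and g1: "\<And>x. (g1 has_real_derivative g2 x) (at x)"
      and Qg: "\<And>x. Q1 x * g x + h / 2 * g2 x = 0" for g g1 g2
  proof (rule const)
    fix x
    have "((\<lambda>x. f x * of_real (g1 x) - f1 x * of_real (g x)) has_vector_derivative
        (f x * of_real (g2 x) + f1 x * of_real (g1 x))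
        - (f1 x * of_real (g1 x) + f2 x * of_real (g x))) (at x)"
      by (intro has_vector_derivative_diff has_vector_derivative_mult
          has_vector_derivative_of_real f f1 g g1)
    moreover have "of_real (h / 2) * (f x * of_real (g2 x) - f2 x * of_real (g x)) = 0"
    proof -
      have "complex_of_real (Q1 x) * of_real (g x) + of_real (h / 2) * of_real (g2 x) = 0"
        using Qg[of x] by (metis of_real_0 of_real_add of_real_mult)
      moreover have "of_real (h / 2) * (f x * of_real (g2 x) - f2 x * of_real (g x))
        = f x * (of_real (Q1 x) * of_real (g x) + of_real (h / 2) * of_real (g2 x))
          - of_real (g x) * (of_real (Q1 x) * f x + of_real (h / 2) * f2 x)"
        by (simp add: algebra_simps)
      ultimately show ?thesis
        unfolding Qf by simp
    qed
    ultimately show "((\<lambda>x. f x * of_real (g1 x) - f1 x * of_real (g x))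
        has_vector_derivative 0) (at x)"
      using h_pos by (simp add: algebra_simps)
  qed
  obtain a1 where a1: "\<And>x. f x * of_real (D2 x) - f1 x * of_real (D1 x) = a1"
    using wr[OF deriv_D1' deriv_D2 Q_D1] by blast
  obtain a2 where a2: "\<And>x. f x * of_real (H1 x) - f1 x * of_real (H x) = a2"
    using wr[OF deriv_H deriv_H1 Q_H] by blast
  define w where "w = complex_of_real (- 4 * s\<^sup>2 * (1 - s)\<^sup>2 / h)"
  have w: "w \<noteq> 0"
    using s_pos s_less h_pos by (simp add: w_def)
  have wf: "w * f x = a2 * of_real (D1 x) - a1 * of_real (H x)" for x
    unfolding w_def wronskian[of x, symmetric] a1[of x, symmetric] a2[of x, symmetric]
    by (simp add: algebra_simps)
  obtain x0 where x0: "D1 x0 \<noteq> 0"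
  proof -
    have "\<exists>x. D1 x \<noteq> 0"
    proof (rule ccontr)
      assume "\<nexists>x. D1 x \<noteq> 0"
      then have "D1 = (\<lambda>_. 0)" by auto
      then have "D2 0 = 0"
        using deriv_D1'[of 0] by (metis DERIV_const DERIV_unique)
      then show False using s_less h_pos by (simp add: D2_0)
    qed
    then show ?thesis using that by blast
  qed
  \<comment> \<open>Over one period \<open>H\<close> gains a multiple of D' whose factor is nonzero
    by \<open>nondegenerate\<close>, so periodicity of f at a point with nonzero D' removes the
    component along H.\<close>
  have "f (x0 + 1) = f x0"
    by (simp add: f_def per G_period)
  then have "w * f (x0 + 1) = w * f x0" by simp
  then have "a1 * of_real ((2 * R * m - s * (1 + s)) * D1 x0) = 0"
    unfolding wf H_shift D1_period by (simp add: algebra_simps)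
  moreover have "2 * R * m - s * (1 + s) \<noteq> 0"
    using nondegenerate by (simp add: R_def)
  ultimately have "a1 = 0"
    using x0 by (metis mult_eq_0_iff of_real_eq_0_iff)
  then have "f x = (a2 / w) * of_real (D1 x)" for x
    using wf[of x] w by (simp add: field_simps)
  then have "u x = (a2 / w) * of_real (D1 x) + \<beta> * of_real (G x)" for x
    by (simp add: f_def diff_eq_eq)
  then show ?thesis using that by blast
qed

end

section \<open>Elliptic functions\<close>

lemma oriented_integral_has_real_derivative:
  fixes f :: "real \<Rightarrow> real"
  assumes "continuous_on UNIV f"
  shows "((\<lambda>x. LBINT t=ereal 0..ereal x. f t) has_real_derivative f x) (at x)"
proof -
  define a b where "a = min 0 x - 1" and "b = max 0 x + 1"
  have "((\<lambda>x. LBINT t=ereal 0..ereal x. f t) has_vector_derivative f x) (at x within {a..b})"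
    using continuous_on_subset[OF assms] by (intro interval_integral_FTC2) (auto simp: a_def b_def)
  moreover have "at x within {a..b} = at x"
    by (rule at_within_interior) (auto simp: a_def b_def min_def max_def)
  ultimately show ?thesis
    by (simp add: has_real_derivative_iff_has_vector_derivative)
qed

lemma oriented_integral_eq_integral:
  fixes f :: "real \<Rightarrow> real"
  assumes "continuous_on UNIV f" and "0 \<le> x"
  shows "(LBINT t=ereal 0..ereal x. f t) = integral {0..x} f"
  using assms borel_integrable_atLeastAtMost'[OF continuous_on_subset[OF assms(1)]]
  by (intro interval_integral_eq_integral) auto

text \<open>F (x + pi) - F x is constant since f has period pi, and at x = - pi / 2 it equals 2 F
  (pi / 2) since F is odd. It serves the integrals of the first and second kind alike.\<close>

lemma primitive_shift_pi:
  fixes F f :: "real \<Rightarrow> real"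
  assumes F: "\<And>x. (F has_real_derivative f x) (at x)" and "F 0 = 0"
    and per: "\<And>x. f (x + pi) = f x" and even: "\<And>x. f (- x) = f x"
  shows "F (x + pi) = F x + 2 * F (pi / 2)"
proof -
  have "((\<lambda>x. F (x + pi) - F x) has_real_derivative 0) (at x)" for x
  proof -
    have "((\<lambda>x. F (x + pi) - F x) has_real_derivative f (x + pi) - f x) (at x)"
      by (intro derivative_intros F DERIV_shift[THEN iffD1])
    then show ?thesis by (simp add: per)
  qed
  then have "F (x + pi) - F x = F (- (pi / 2) + pi) - F (- (pi / 2))"
    by (intro DERIV_isconst_all) auto
  moreover have "((\<lambda>x. F x + F (- x)) has_real_derivative 0) (at x)" for x
  proof -
    have "((\<lambda>x. F x + F (- x)) has_real_derivative f x + f (- x) * (- 1)) (at x)"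
      by (intro derivative_intros F DERIV_chain2[of F])
    then show ?thesis by (simp add: even)
  qed
  then have "F (pi / 2) + F (- (pi / 2)) = F 0 + F (- 0)"
    by (intro DERIV_isconst_all[of "\<lambda>x. F x + F (- x)"]) auto
  ultimately show ?thesis
    using assms(2) by simp
qed

definition ell_Delta :: "real \<Rightarrow> real \<Rightarrow> real" where
  "ell_Delta p t = sqrt (1 - p\<^sup>2 * (sin t)\<^sup>2)"

definition ell_EE :: "real \<Rightarrow> real \<Rightarrow> real" where
  "ell_EE p x = (LBINT t=ereal 0..ereal x. ell_Delta p t)"

definition dn_sq :: "real \<Rightarrow> real \<Rightarrow> real" where
  "dn_sq p x = (jacobi_dn p (2 * elliptic_K p * x))\<^sup>2"

definition dn_sq_deriv :: "real \<Rightarrow> real \<Rightarrow> real" where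
  "dn_sq_deriv p x = (let \<phi> = jacobi_am p (2 * elliptic_K p * x) in
     - 4 * elliptic_K p * p\<^sup>2 * sin \<phi> * cos \<phi> * ell_Delta p \<phi>)"

definition dn_sq_prim :: "real \<Rightarrow> real \<Rightarrow> real" where
  "dn_sq_prim p x = ell_EE p (jacobi_am p (2 * elliptic_K p * x)) / (2 * elliptic_K p)"

locale elliptic_modulus =
  fixes p :: real
  assumes p_pos: "0 < p" and p_less: "p < 1"
begin

lemma p_sq: "0 < p\<^sup>2" "p\<^sup>2 < 1"
  using p_pos p_less by (auto simp: power_less_one_iff)

lemma radicand_ge: "1 - p\<^sup>2 \<le> 1 - p\<^sup>2 * (sin t)\<^sup>2"
proof -
  have "(sin t)\<^sup>2 \<le> 1" by (simp add: abs_square_le_1)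
  then show ?thesis using p_sq by (simp add: mult_left_le)
qed

lemma radicand_pos: "0 < 1 - p\<^sup>2 * (sin t)\<^sup>2"
  using radicand_ge[of t] p_sq by linarith

lemma Delta_pos: "0 < ell_Delta p t"
  using radicand_pos by (simp add: ell_Delta_def)

lemma Delta_sq: "(ell_Delta p t)\<^sup>2 = 1 - p\<^sup>2 * (sin t)\<^sup>2"
  using radicand_pos[of t] by (simp add: ell_Delta_def)

lemma Delta_le_1: "ell_Delta p t \<le> 1"
  using p_sq by (simp add: ell_Delta_def)

lemma deriv_Delta:
  "(ell_Delta p has_real_derivative - p\<^sup>2 * sin t * cos t / ell_Delta p t) (at t)"
  unfolding ell_Delta_def[abs_def] using radicand_pos[of t]
  by (auto intro!: derivative_eq_intros simp: field_simps)

lemma continuous_Delta: "continuous_on S (ell_Delta p)"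
  by (intro continuous_at_imp_continuous_on ballI DERIV_isCont[OF deriv_Delta])

lemma continuous_inverse_Delta: "continuous_on S (\<lambda>t. 1 / ell_Delta p t)"
  using Delta_pos by (intro continuous_intros continuous_Delta) (auto simp: less_imp_neq[symmetric])

lemma elliptic_F_eq: "elliptic_F p x = (LBINT t=ereal 0..ereal x. 1 / ell_Delta p t)"
  by (simp add: elliptic_F_def ell_Delta_def)

lemma deriv_F: "(elliptic_F p has_real_derivative 1 / ell_Delta p x) (at x)"
  unfolding elliptic_F_eq[abs_def]
  by (rule oriented_integral_has_real_derivative[OF continuous_inverse_Delta])

lemma deriv_EE: "(ell_EE p has_real_derivative ell_Delta p x) (at x)"
  unfolding ell_EE_def[abs_def]
  by (rule oriented_integral_has_real_derivative[OF continuous_Delta])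

lemma F_0: "elliptic_F p 0 = 0" and EE_0: "ell_EE p 0 = 0"
  by (simp_all add: elliptic_F_def ell_EE_def)

lemma E_eq: "elliptic_E p = ell_EE p (pi / 2)"
  by (simp add: elliptic_E_def ell_EE_def ell_Delta_def)

lemma Delta_shift: "ell_Delta p (x + pi) = ell_Delta p x" "ell_Delta p (- x) = ell_Delta p x"
  by (simp_all add: ell_Delta_def)

lemma F_shift: "elliptic_F p (x + pi) = elliptic_F p x + 2 * elliptic_K p"
  unfolding elliptic_K_def
  by (rule primitive_shift_pi[OF deriv_F F_0]) (simp_all add: Delta_shift)

lemma EE_shift: "ell_EE p (x + pi) = ell_EE p x + 2 * elliptic_E p"
  unfolding E_eq by (rule primitive_shift_pi[OF deriv_EE EE_0]) (simp_all add: Delta_shift)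

text \<open>The integrand 1 / \<Delta> is at least 1. This one comparison yields both strict
  monotonicity and unboundedness of F, hence that F is a bijection and \<open>inv\<close> in
  \<open>jacobi_am\<close> a genuine inverse.\<close>

lemma F_minus_id_mono: "x \<le> y \<Longrightarrow> elliptic_F p x - x \<le> elliptic_F p y - y"
proof (rule DERIV_nonneg_imp_nondecreasing[of x y "\<lambda>x. elliptic_F p x - x"])
  fix t
  have "((\<lambda>x. elliptic_F p x - x) has_real_derivative 1 / ell_Delta p t - 1) (at t)"
    by (auto intro!: derivative_eq_intros deriv_F)
  moreover have "0 \<le> 1 / ell_Delta p t - 1"
    using Delta_le_1[of t] Delta_pos[of t] by simp
  ultimately show "\<exists>y. ((\<lambda>x. elliptic_F p x - x) has_real_derivative y) (at t) \<and> 0 \<le> y"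
    by blast
qed

lemma F_strict_mono: "strict_mono (elliptic_F p)"
proof (rule strict_monoI)
  fix x y :: real assume "x < y"
  then show "elliptic_F p x < elliptic_F p y"
    using F_minus_id_mono[of x y] by linarith
qed

lemma F_surj: "\<exists>x. elliptic_F p x = y"
proof -
  have "elliptic_F p (- \<bar>y\<bar>) \<le> y" "y \<le> elliptic_F p \<bar>y\<bar>"
    using F_minus_id_mono[of "- \<bar>y\<bar>" 0] F_minus_id_mono[of 0 "\<bar>y\<bar>"] F_0 by auto
  then show ?thesis
    using IVT[of "elliptic_F p" "- \<bar>y\<bar>" y "\<bar>y\<bar>"] DERIV_isCont[OF deriv_F] by auto
qed

lemma am_F: "jacobi_am p (elliptic_F p x) = x"
  unfolding jacobi_am_def using strict_mono_imp_inj_on[OF F_strict_mono] by (rule inv_f_f)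

lemma F_am: "elliptic_F p (jacobi_am p x) = x"
  unfolding jacobi_am_def using F_surj[of x] by (metis f_inv_into_f rangeI)

lemma deriv_am: "(jacobi_am p has_real_derivative ell_Delta p (jacobi_am p u)) (at u)"
proof -
  define x where "x = jacobi_am p u"
  have "(jacobi_am p has_derivative (*) (ell_Delta p x)) (at (elliptic_F p x))"
  proof (rule has_derivative_inverse_strong[of UNIV x])
    show "continuous_on UNIV (elliptic_F p)"
      by (intro continuous_at_imp_continuous_on ballI DERIV_isCont[OF deriv_F])
    show "(elliptic_F p has_derivative (*) (1 / ell_Delta p x)) (at x)"
      using deriv_F[of x] by (simp add: has_field_derivative_def)
    show "(*) (1 / ell_Delta p x) \<circ> (*) (ell_Delta p x) = id"
      using Delta_pos[of x] by (auto simp: fun_eq_iff)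
  qed (simp_all add: am_F)
  then show ?thesis
    by (simp add: x_def F_am has_field_derivative_def)
qed

lemma am_0: "jacobi_am p 0 = 0"
  using am_F[of 0] F_0 by simp

lemma am_shift: "jacobi_am p (u + 2 * elliptic_K p) = jacobi_am p u + pi"
  by (metis F_am F_shift am_F)

lemma K_eq_integral: "elliptic_K p = integral {0..pi/2} (\<lambda>t. 1 / ell_Delta p t)"
  unfolding elliptic_K_def elliptic_F_eq
  by (rule oriented_integral_eq_integral[OF continuous_inverse_Delta]) simp

lemma E_eq_integral: "elliptic_E p = integral {0..pi/2} (ell_Delta p)"
  unfolding E_eq ell_EE_def by (rule oriented_integral_eq_integral[OF continuous_Delta]) simp

lemma K_pos: "0 < elliptic_K p"
proof -
  have "elliptic_F p 0 - 0 \<le> elliptic_F p (pi / 2) - pi / 2"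
    by (rule F_minus_id_mono) simp
  then show ?thesis
    unfolding elliptic_K_def F_0 using pi_half_gt_zero by linarith
qed

lemma K_has_integral: "((\<lambda>t. 1 / ell_Delta p t) has_integral elliptic_K p) {0..pi/2}"
  unfolding K_eq_integral
  by (intro integrable_integral integrable_continuous_real continuous_inverse_Delta)

lemma E_has_integral: "(ell_Delta p has_integral elliptic_E p) {0..pi/2}"
  unfolding E_eq_integral
  by (intro integrable_integral integrable_continuous_real continuous_Delta)

text \<open>With s = 1 - p^2, the difference \<Delta> - s / \<Delta>^3 is the derivative of p^2 sin
  t cos t / \<Delta>, which vanishes at both ends of the interval.\<close>

lemma inverse_Delta_cube_has_integral:
  "((\<lambda>t. 1 / (ell_Delta p t)^3) has_integral elliptic_E p / (1 - p\<^sup>2)) {0..pi/2}"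
proof -
  let ?\<Phi> = "\<lambda>t. p\<^sup>2 * sin t * cos t / ell_Delta p t"
  have "(?\<Phi> has_real_derivative ell_Delta p t - (1 - p\<^sup>2) / (ell_Delta p t)^3) (at t)" for t
  proof -
    let ?d = "ell_Delta p t"
    have d: "?d \<noteq> 0" using Delta_pos[of t] by simp
    have "(?\<Phi> has_real_derivative
        (p\<^sup>2 * ((cos t)\<^sup>2 - (sin t)\<^sup>2) * ?d - p\<^sup>2 * sin t * cos t * (- p\<^sup>2 * sin t * cos t / ?d))
          / (?d * ?d)) (at t)"
      using d by (auto intro!: derivative_eq_intros deriv_Delta simp: algebra_simps power2_eq_square)
    also have "(p\<^sup>2 * ((cos t)\<^sup>2 - (sin t)\<^sup>2) * ?d - p\<^sup>2 * sin t * cos t * (- p\<^sup>2 * sin t * cos t / ?d))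
          / (?d * ?d) = (p\<^sup>2 * ((cos t)\<^sup>2 - (sin t)\<^sup>2) * ?d\<^sup>2 + (p\<^sup>2 * sin t * cos t)\<^sup>2) / ?d^3"
      using d by (simp add: field_simps power2_eq_square power3_eq_cube)
    also have "p\<^sup>2 * ((cos t)\<^sup>2 - (sin t)\<^sup>2) * ?d\<^sup>2 + (p\<^sup>2 * sin t * cos t)\<^sup>2 = (?d\<^sup>2)\<^sup>2 - (1 - p\<^sup>2)"
      unfolding Delta_sq power_mult_distrib cos_squared_eq by (simp add: algebra_simps power2_eq_square)
    also have "((?d\<^sup>2)\<^sup>2 - (1 - p\<^sup>2)) / ?d^3 = ?d - (1 - p\<^sup>2) / ?d^3"
      using d by (simp add: field_simps power2_eq_square power3_eq_cube)
    finally show ?thesis .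
  qed
  then have "((\<lambda>t. ell_Delta p t - (1 - p\<^sup>2) / (ell_Delta p t)^3) has_integral
      (?\<Phi> (pi / 2) - ?\<Phi> 0)) {0..pi/2}"
    by (intro fundamental_theorem_of_calculus)
      (auto simp: has_real_derivative_iff_has_vector_derivative intro: has_vector_derivative_at_within)
  then have "((\<lambda>t. ell_Delta p t - (1 - p\<^sup>2) / (ell_Delta p t)^3) has_integral 0) {0..pi/2}"
    by simp
  from has_integral_mult_right[OF has_integral_diff[OF E_has_integral this], of "1 / (1 - p\<^sup>2)"]
  show ?thesis using p_sq by simp
qed

lemma continuous_inverse_Delta_cube: "continuous_on S (\<lambda>t. 1 / (ell_Delta p t)^3)"
  using Delta_pos by (intro continuous_intros continuous_Delta) (auto simp: less_imp_neq[symmetric])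

text \<open>With \<open>s = 1 - p\<^sup>2\<close>, both \<open>\<Delta>\<close> and \<open>s / \<Delta>\<^sup>3\<close> integrate to \<open>E\<close>, and their arithmetic mean
  dominates the geometric mean \<open>\<surd>s / \<Delta>\<close>.\<close>

lemma sqrt_less_E_over_K: "sqrt (1 - p\<^sup>2) < elliptic_E p / elliptic_K p"
proof -
  define q where "q = sqrt (1 - p\<^sup>2)"
  have q: "q\<^sup>2 = 1 - p\<^sup>2" "q < 1"
    using p_sq by (auto simp: q_def)
  let ?f = "\<lambda>t. ell_Delta p t + q\<^sup>2 * (1 / (ell_Delta p t)^3) - 2 * q * (1 / ell_Delta p t)"
  have f: "?f t = (((ell_Delta p t)\<^sup>2 - q)\<^sup>2) / (ell_Delta p t)^3" for t
    using Delta_pos[of t]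
    by (simp add: field_simps power2_eq_square power3_eq_cube)
  have int: "(?f has_integral (elliptic_E p + q\<^sup>2 * (elliptic_E p / (1 - p\<^sup>2))
      - 2 * q * elliptic_K p)) {0..pi/2}"
    by (intro has_integral_add has_integral_diff has_integral_mult_right E_has_integral
        K_has_integral inverse_Delta_cube_has_integral)
  have nonneg: "0 \<le> ?f t" for t
    unfolding f using Delta_pos[of t] by simp
  have "0 \<le> elliptic_E p + q\<^sup>2 * (elliptic_E p / (1 - p\<^sup>2)) - 2 * q * elliptic_K p"
    by (rule has_integral_nonneg[OF int]) (use nonneg in blast)
  moreover have "elliptic_E p + q\<^sup>2 * (elliptic_E p / (1 - p\<^sup>2)) - 2 * q * elliptic_K p \<noteq> 0"
  proof
    assume "elliptic_E p + q\<^sup>2 * (elliptic_E p / (1 - p\<^sup>2)) - 2 * q * elliptic_K p = 0"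
    with int have "(?f has_integral 0) (cbox 0 (pi/2))" by simp
    \<comment> \<open>Strictness: a continuous non-negative integrand with integral 0 would vanish
      at t = 0, where \<Delta> = 1 and its value is (1 - q)^2 > 0.\<close>
    then have "?f 0 = 0"
    proof (rule has_integral_0_cbox_imp_0[rotated 2])
      show "continuous_on (cbox 0 (pi / 2)) ?f"
        by (intro continuous_intros continuous_Delta continuous_inverse_Delta
            continuous_inverse_Delta_cube)
    qed (use nonneg pi_gt_zero in \<open>auto simp: not_le\<close>)
    then have "(1 - q)\<^sup>2 = 0"
      unfolding f by (simp add: ell_Delta_def)
    then show False using q(2) by simp
  qed
  moreover have "q\<^sup>2 * (elliptic_E p / (1 - p\<^sup>2)) = elliptic_E p"
    unfolding q(1) using p_sq by simp
  ultimately have "q * elliptic_K p < elliptic_E p"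
    by simp
  then show ?thesis using K_pos by (simp add: q_def pos_less_divide_eq)
qed

lemma E_over_K_less_1: "elliptic_E p / elliptic_K p < 1"
proof -
  have "integral {0..pi/2} (ell_Delta p) < integral {0..pi/2} (\<lambda>t. 1 / ell_Delta p t)"
  proof (rule integral_less_real)
    fix t :: real assume t: "t \<in> {0<..<pi/2}"
    then have "0 < sin t" by (intro sin_gt_zero) auto
    then have "(ell_Delta p t)\<^sup>2 < 1" using p_pos by (simp add: Delta_sq)
    then show "ell_Delta p t < 1 / ell_Delta p t"
      using Delta_pos[of t] by (simp add: field_simps power2_eq_square)
  qed (use pi_gt_zero in \<open>auto intro: continuous_Delta continuous_inverse_Delta simp: not_le\<close>)
  then show ?thesis
    using K_pos by (simp add: K_eq_integral[symmetric] E_eq_integral[symmetric])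
qed

lemma E_over_K_greater: "1 - p\<^sup>2 < elliptic_E p / elliptic_K p"
proof -
  have "1 - p\<^sup>2 < sqrt (1 - p\<^sup>2)"
    using p_sq by (intro real_less_rsqrt) (simp add: power_strict_decreasing power2_eq_square)
  then show ?thesis using sqrt_less_E_over_K by linarith
qed

text \<open>The bound m > s would not do: at m = s the claim amounts to (1 - s) (1 - 2 s) > 0, which
  is false for s >= 1/2. With m > q = sqrt s instead, the difference of the two sides at m = q
  factors as q (1 - q)^2 (2 q^2 + 3 q + 2).\<close>

lemma E_over_K_nondegenerate:
  fixes s defines "s \<equiv> 1 - p\<^sup>2"
  shows "s * (1 + s) < 2 * (1 - s + s\<^sup>2) * (elliptic_E p / elliptic_K p)"
proof -
  define q where "q = sqrt s"
  have q: "q\<^sup>2 = s" "0 < q"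
    using p_sq by (auto simp: q_def s_def)
  have "0 \<le> (1 - q)\<^sup>2 * (2 * q\<^sup>2 + 3 * q + 2) * q"
    using q(2) by simp
  then have "s * (1 + s) \<le> 2 * (1 - s + s\<^sup>2) * q"
    unfolding q(1)[symmetric] by (simp add: algebra_simps power2_eq_square)
  also have "0 < 2 * (1 - s + s\<^sup>2)"
    using p_sq by (auto simp: s_def power2_eq_square intro!: add_pos_nonneg)
  then have "2 * (1 - s + s\<^sup>2) * q < 2 * (1 - s + s\<^sup>2) * (elliptic_E p / elliptic_K p)"
    using sqrt_less_E_over_K unfolding q_def s_def by (intro mult_strict_left_mono)
  finally show ?thesis .
qed

lemma dn_sq_eq: "dn_sq p x = 1 - p\<^sup>2 * (sin (jacobi_am p (2 * elliptic_K p * x)))\<^sup>2"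
  unfolding dn_sq_def jacobi_dn_def by (rule real_sqrt_pow2[OF less_imp_le[OF radicand_pos]])

lemma deriv_am_scaled:
  "((\<lambda>x. jacobi_am p (2 * elliptic_K p * x)) has_real_derivative
      2 * elliptic_K p * ell_Delta p (jacobi_am p (2 * elliptic_K p * x))) (at x)"
  by (rule DERIV_cong[OF DERIV_chain2[OF deriv_am]]) (auto intro!: derivative_eq_intros)

text \<open>The equations of the profile follow from p^2 sin^2 = 1 - D, p^2 cos^2 = D - s and
  \<Delta>^2 = D along the amplitude. The shift of x by 1 is a shift of the argument by 2K, which
  advances the amplitude by pi.\<close>

sublocale kdv_profile "dn_sq p" "dn_sq_deriv p" "dn_sq_prim p" "1 - p\<^sup>2"
  "elliptic_E p / elliptic_K p" "1 / (4 * (elliptic_K p)\<^sup>2)"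
proof
  let ?K = "elliptic_K p" and ?am = "\<lambda>x. jacobi_am p (2 * elliptic_K p * x)"
  have dn: "ell_Delta p (?am x) = sqrt (dn_sq p x)" for x
    by (simp add: ell_Delta_def dn_sq_eq)
  have Dd: "(ell_Delta p (?am x))\<^sup>2 = dn_sq p x" for x
    by (simp add: Delta_sq dn_sq_eq)
  show "0 < 1 / (4 * ?K\<^sup>2)" using K_pos by simp
  show "0 < 1 - p\<^sup>2" "1 - p\<^sup>2 < 1" using p_sq by simp_all
  show "(dn_sq p has_real_derivative dn_sq_deriv p x) (at x)" for x
    unfolding dn_sq_eq[abs_def] dn_sq_deriv_def Let_def
    by (rule derivative_eq_intros deriv_am_scaled refl)+ simp
  show "1 / (4 * ?K\<^sup>2) * (dn_sq_deriv p x)\<^sup>2 = 4 * dn_sq p x * (1 - dn_sq p x) * (dn_sq p x - (1 - p\<^sup>2))" for x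
  proof -
    have c: "p\<^sup>2 * (cos (?am x))\<^sup>2 = dn_sq p x - (1 - p\<^sup>2)"
      by (simp add: dn_sq_eq cos_squared_eq algebra_simps)
    have s: "p\<^sup>2 * (sin (?am x))\<^sup>2 = 1 - dn_sq p x"
      by (simp add: dn_sq_eq)
    have "1 / (4 * ?K\<^sup>2) * (dn_sq_deriv p x)\<^sup>2
      = 4 * (ell_Delta p (?am x))\<^sup>2 * (p\<^sup>2 * (sin (?am x))\<^sup>2) * (p\<^sup>2 * (cos (?am x))\<^sup>2)"
      using K_pos by (simp add: dn_sq_deriv_def Let_def field_simps power2_eq_square)
    then show ?thesis unfolding Dd c s .
  qed
  show "(dn_sq_deriv p has_real_derivative (- 6 * (dn_sq p x)\<^sup>2 + 4 * (1 + (1 - p\<^sup>2)) * dn_sq p x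
      - 2 * (1 - p\<^sup>2)) / (1 / (4 * ?K\<^sup>2))) (at x)" for x
  proof -
    let ?S = "sin (?am x)" and ?C = "cos (?am x)" and ?d = "ell_Delta p (?am x)"
    have d: "?d \<noteq> 0" using Delta_pos[of "?am x"] by simp
    have deriv: "(dn_sq_deriv p has_real_derivative
       - 4 * ?K * p\<^sup>2 * (((?C * (2 * ?K * ?d)) * ?C + ?S * (- ?S * (2 * ?K * ?d))) * ?d
         + ?S * ?C * ((- p\<^sup>2 * ?S * ?C / ?d) * (2 * ?K * ?d)))) (at x)"
      unfolding dn_sq_deriv_def[abs_def] Let_def
      by (rule derivative_eq_intros deriv_am_scaled DERIV_chain2[OF deriv_Delta] refl)+
        (simp add: algebra_simps)
    have eq1: "- 4 * ?K * p\<^sup>2 * (((?C * (2 * ?K * ?d)) * ?C + ?S * (- ?S * (2 * ?K * ?d))) * ?d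
         + ?S * ?C * ((- p\<^sup>2 * ?S * ?C / ?d) * (2 * ?K * ?d)))
       = 4 * ?K\<^sup>2 * (- 2 * p\<^sup>2 * (?C\<^sup>2 - ?S\<^sup>2) * ?d\<^sup>2 + 2 * p\<^sup>2 * p\<^sup>2 * ?S\<^sup>2 * ?C\<^sup>2)"
      using d by (simp add: field_simps power2_eq_square)
    have eq2: "- 2 * p\<^sup>2 * (?C\<^sup>2 - ?S\<^sup>2) * ?d\<^sup>2 + 2 * p\<^sup>2 * p\<^sup>2 * ?S\<^sup>2 * ?C\<^sup>2
      = - 6 * (dn_sq p x)\<^sup>2 + 4 * (1 + (1 - p\<^sup>2)) * dn_sq p x - 2 * (1 - p\<^sup>2)"
      unfolding Delta_sq dn_sq_eq cos_squared_eq by (simp add: algebra_simps power2_eq_square)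
    show ?thesis
      by (rule DERIV_cong[OF deriv]) (unfold eq1 eq2, simp only: divide_divide_eq_right div_by_1 mult.commute)
  qed
  show "(dn_sq_prim p has_real_derivative dn_sq p x) (at x)" for x
  proof -
    have "(dn_sq_prim p has_real_derivative
        ell_Delta p (?am x) * (2 * ?K * ell_Delta p (?am x)) / (2 * ?K)) (at x)"
      unfolding dn_sq_prim_def[abs_def]
      by (intro DERIV_cdivide DERIV_chain2[OF deriv_EE] deriv_am_scaled)
    then show ?thesis
      using K_pos Dd[of x] by (simp add: power2_eq_square)
  qed
  have am: "?am (x + 1) = ?am x + pi" for x
    using am_shift[of "2 * ?K * x"] by (simp add: algebra_simps)
  show "dn_sq p (x + 1) = dn_sq p x" for x
    unfolding dn_sq_eq am by simp
  show "dn_sq_prim p (x + 1) = dn_sq_prim p x + elliptic_E p / ?K" for x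
    unfolding dn_sq_prim_def am EE_shift using K_pos by (simp add: field_simps)
  show "dn_sq p 0 = 1" "dn_sq_prim p 0 = 0"
    by (simp_all add: dn_sq_eq dn_sq_prim_def am_0 EE_0)
  show "2 * (1 - (1 - p\<^sup>2) + (1 - p\<^sup>2)\<^sup>2) * (elliptic_E p / ?K) \<noteq> (1 - p\<^sup>2) * (1 + (1 - p\<^sup>2))"
    using E_over_K_nondegenerate by simp
qed

end

subsection \<open>Derivatives of the complete elliptic integrals\<close>

lemma ell_Delta_integrable:
  assumes "0 < p" "p < 1"
  shows "(\<lambda>t. 1 / ell_Delta p t) integrable_on cbox 0 (pi/2)" "ell_Delta p integrable_on cbox 0 (pi/2)"
proof -
  have modulus: "elliptic_modulus p" using assms by unfold_locales
  show "(\<lambda>t. 1 / ell_Delta p t) integrable_on cbox 0 (pi/2)" "ell_Delta p integrable_on cbox 0 (pi/2)"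
    using elliptic_modulus.K_has_integral[OF modulus] elliptic_modulus.E_has_integral[OF modulus]
    by (auto simp: has_integral_integrable)
qed

lemma has_derivative_ell_Delta_modulus:
  fixes p t :: real
  assumes "0 < p" "p < 1"
  shows "((\<lambda>p. ell_Delta p t) has_real_derivative - p * (sin t)\<^sup>2 / ell_Delta p t) (at p)"
proof -
  have "elliptic_modulus p" using assms by unfold_locales
  then show ?thesis
    unfolding ell_Delta_def using elliptic_modulus.radicand_pos[of p t]
    by (auto intro!: derivative_eq_intros simp: field_simps)
qed

lemma continuous_ell_Delta_joint:
  "continuous_on ({0<..<1} \<times> cbox 0 (pi/2)) (\<lambda>x. ell_Delta (fst x) (snd x))"
  unfolding ell_Delta_def by (intro continuous_intros)

lemma ell_Delta_nonzero: "0 < p \<Longrightarrow> p < 1 \<Longrightarrow> ell_Delta p t \<noteq> 0"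
  using elliptic_modulus.Delta_pos[of p t] by (simp add: elliptic_modulus_def)

context elliptic_modulus
begin

text \<open>Differentiation under the integral gives p sin^2 / \<Delta>^3 = (1 / \<Delta>^3 - 1 /
  \<Delta>) / p, and the integral of 1 / \<Delta>^3 is known in terms of E.\<close>

lemma deriv_K:
  "(elliptic_K has_real_derivative (elliptic_E p - (1 - p\<^sup>2) * elliptic_K p) / (p * (1 - p\<^sup>2))) (at p)"
proof -
  have "((\<lambda>p. integral (cbox 0 (pi/2)) (\<lambda>t. 1 / ell_Delta p t)) has_real_derivative
      integral (cbox 0 (pi/2)) (\<lambda>t. p * (sin t)\<^sup>2 / (ell_Delta p t)^3)) (at p within {0<..<1})"
  proof (rule leibniz_rule_field_derivative)
    show "((\<lambda>p. 1 / ell_Delta p t) has_real_derivative p * (sin t)\<^sup>2 / (ell_Delta p t)^3)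
        (at p within {0<..<1})" if "p \<in> {0<..<1}" for p t
    proof -
      have p: "0 < p" "p < 1" using that by auto
      have "((\<lambda>p. 1 / ell_Delta p t) has_real_derivative p * (sin t)\<^sup>2 / (ell_Delta p t)^3) (at p)"
        using ell_Delta_nonzero[OF p, of t]
        by (auto intro!: derivative_eq_intros has_derivative_ell_Delta_modulus p simp: field_simps power2_eq_square power3_eq_cube)
      then show ?thesis by (rule has_field_derivative_at_within)
    qed
    show "continuous_on ({0<..<1} \<times> cbox 0 (pi/2)) (\<lambda>(p, t). p * (sin t)\<^sup>2 / (ell_Delta p t)^3)"
      unfolding case_prod_beta using ell_Delta_nonzero
      by (intro continuous_intros continuous_ell_Delta_joint) auto
  qed (use p_pos p_less ell_Delta_integrable in auto)
  moreover have "integral (cbox 0 (pi/2)) (\<lambda>t. p * (sin t)\<^sup>2 / (ell_Delta p t)^3)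
      = (elliptic_E p - (1 - p\<^sup>2) * elliptic_K p) / (p * (1 - p\<^sup>2))"
  proof (rule integral_unique)
    have "((\<lambda>t. (1 / p) * (1 / (ell_Delta p t)^3 - 1 / ell_Delta p t)) has_integral
        (1 / p) * (elliptic_E p / (1 - p\<^sup>2) - elliptic_K p)) {0..pi/2}"
      by (intro has_integral_mult_right has_integral_diff inverse_Delta_cube_has_integral K_has_integral)
    moreover have "(1 / p) * (1 / (ell_Delta p t)^3 - 1 / ell_Delta p t)
        = p * (sin t)\<^sup>2 / (ell_Delta p t)^3" for t
    proof -
      have "(1 / p) * (1 / (ell_Delta p t)^3 - 1 / ell_Delta p t)
          = (1 / p) * (1 - (ell_Delta p t)\<^sup>2) / (ell_Delta p t)^3"
        using Delta_pos[of t] by (simp add: field_simps power2_eq_square power3_eq_cube)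
      then show ?thesis
        unfolding Delta_sq using p_pos by (simp add: power2_eq_square)
    qed
    ultimately show "((\<lambda>t. p * (sin t)\<^sup>2 / (ell_Delta p t)^3) has_integral
        (elliptic_E p - (1 - p\<^sup>2) * elliptic_K p) / (p * (1 - p\<^sup>2))) (cbox 0 (pi/2))"
      using p_pos p_sq by (simp add: field_simps)
  qed
  ultimately have "((\<lambda>p. integral (cbox 0 (pi/2)) (\<lambda>t. 1 / ell_Delta p t)) has_real_derivative
      (elliptic_E p - (1 - p\<^sup>2) * elliptic_K p) / (p * (1 - p\<^sup>2))) (at p)"
    using p_pos p_less by (simp add: at_within_open[of p "{0<..<1}"])
  then show ?thesis
    by (rule has_field_derivative_transform_within_open[of _ _ _ "{0<..<1}"])
      (use p_pos p_less in \<open>auto simp: elliptic_modulus.K_eq_integral elliptic_modulus_def\<close>)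
qed

lemma deriv_E:
  "(elliptic_E has_real_derivative (elliptic_E p - elliptic_K p) / p) (at p)"
proof -
  have "((\<lambda>p. integral (cbox 0 (pi/2)) (ell_Delta p)) has_real_derivative
      integral (cbox 0 (pi/2)) (\<lambda>t. - p * (sin t)\<^sup>2 / ell_Delta p t)) (at p within {0<..<1})"
  proof (rule leibniz_rule_field_derivative)
    show "((\<lambda>p. ell_Delta p t) has_real_derivative - p * (sin t)\<^sup>2 / ell_Delta p t)
        (at p within {0<..<1})" if "p \<in> {0<..<1}" for p t
      using that has_derivative_ell_Delta_modulus by (auto intro: has_field_derivative_at_within)
    show "continuous_on ({0<..<1} \<times> cbox 0 (pi/2)) (\<lambda>(p, t). - p * (sin t)\<^sup>2 / ell_Delta p t)"
      unfolding case_prod_beta using ell_Delta_nonzero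
      by (intro continuous_intros continuous_ell_Delta_joint) auto
  qed (use p_pos p_less ell_Delta_integrable in auto)
  moreover have "integral (cbox 0 (pi/2)) (\<lambda>t. - p * (sin t)\<^sup>2 / ell_Delta p t)
      = (elliptic_E p - elliptic_K p) / p"
  proof (rule integral_unique)
    have "((\<lambda>t. (1 / p) * (ell_Delta p t - 1 / ell_Delta p t)) has_integral
        (1 / p) * (elliptic_E p - elliptic_K p)) {0..pi/2}"
      by (intro has_integral_mult_right has_integral_diff E_has_integral K_has_integral)
    moreover have "(1 / p) * (ell_Delta p t - 1 / ell_Delta p t) = - p * (sin t)\<^sup>2 / ell_Delta p t" for t
    proof -
      have "(1 / p) * (ell_Delta p t - 1 / ell_Delta p t)
          = (1 / p) * ((ell_Delta p t)\<^sup>2 - 1) / ell_Delta p t"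
        using Delta_pos[of t] by (simp add: field_simps power2_eq_square)
      then show ?thesis
        unfolding Delta_sq using p_pos by (simp add: power2_eq_square)
    qed
    ultimately show "((\<lambda>t. - p * (sin t)\<^sup>2 / ell_Delta p t) has_integral
        (elliptic_E p - elliptic_K p) / p) (cbox 0 (pi/2))"
      by simp
  qed
  ultimately have "((\<lambda>p. integral (cbox 0 (pi/2)) (ell_Delta p)) has_real_derivative
      (elliptic_E p - elliptic_K p) / p) (at p)"
    using p_pos p_less by (simp add: at_within_open[of p "{0<..<1}"])
  then show ?thesis
    by (rule has_field_derivative_transform_within_open[of _ _ _ "{0<..<1}"])
      (use p_pos p_less in \<open>auto simp: elliptic_modulus.E_eq_integral elliptic_modulus_def\<close>)
qed

end

section \<open>The cnoidal family\<close>

definition wave_amp :: "real \<Rightarrow> real" where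
  "wave_amp p = 8 * (elliptic_K p)\<^sup>2"

definition ell_ratio :: "real \<Rightarrow> real" where
  "ell_ratio p = elliptic_E p / elliptic_K p"

lemma kdv_U_eq: "kdv_U k M p y = M + wave_amp p * k\<^sup>2 * (dn_sq p y - ell_ratio p)"
  by (simp add: kdv_U_def wave_amp_def dn_sq_def ell_ratio_def)

lemma kdv_c_eq: "kdv_c k M p = 6 * M + 2 * (wave_amp p * k\<^sup>2) * (1 + (1 - p\<^sup>2) - 3 * ell_ratio p)"
  by (simp add: kdv_c_def wave_amp_def ell_ratio_def)

context elliptic_modulus
begin

abbreviation "cs \<equiv> 1 - p\<^sup>2"
abbreviation "ek \<equiv> ell_ratio p"

lemma wave_amp_pos: "0 < wave_amp p"
  using K_pos by (simp add: wave_amp_def)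

lemma ell_ratio_bounds: "cs < ek" "ek < 1"
  using E_over_K_greater E_over_K_less_1 by (simp_all add: ell_ratio_def)

lemma deriv_wave_amp:
  "(wave_amp has_real_derivative 2 * wave_amp p * (ek - cs) / (cs * p)) (at p)"
proof -
  have "(wave_amp has_real_derivative 8 * (2 * elliptic_K p *
      ((elliptic_E p - cs * elliptic_K p) / (p * cs)))) (at p)"
    unfolding wave_amp_def[abs_def]
    by (auto intro!: derivative_eq_intros deriv_K)
  then show ?thesis
    by (rule DERIV_cong)
      (use K_pos p_pos p_sq in \<open>simp add: wave_amp_def ell_ratio_def field_simps power2_eq_square\<close>)
qed

lemma deriv_ell_ratio:
  "(ell_ratio has_real_derivative - (ek\<^sup>2 - 2 * cs * ek + cs) / (cs * p)) (at p)"
proof -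
  have deriv: "(ell_ratio has_real_derivative
      ((elliptic_E p - elliptic_K p) / p * elliptic_K p
        - elliptic_E p * ((elliptic_E p - cs * elliptic_K p) / (p * cs)))
      / (elliptic_K p * elliptic_K p)) (at p)"
    unfolding ell_ratio_def[abs_def] using K_pos
    by (intro DERIV_divide deriv_E deriv_K) simp
  have "((E - K) / p * K - E * ((E - S * K) / (p * S))) / (K * K)
     = - ((E / K)\<^sup>2 - 2 * S * (E / K) + S) / (S * p)" if "K \<noteq> 0" "S \<noteq> 0" for E K S :: real
    using that p_pos by (simp add: field_simps power2_eq_square)
  note eq = this
  show ?thesis
    by (rule DERIV_cong[OF deriv], unfold ell_ratio_def, rule eq) (use K_pos p_sq in auto)
qed

definition whitham_r where "whitham_r = ek * (1 - ek) * (ek - cs)"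

text \<open>Split so that the first term cancels later: at fixed k the amplitude satisfies
  \<delta>\<kappa> / \<kappa> = - 2 (m - s) e, hence \<delta>(\<kappa>^2 v) = - 2 \<kappa>^2 m (1 -
  m) (m - s) e. This is the origin of \<open>whitham_r\<close>.\<close>

lemma deriv_whitham_v:
  "((\<lambda>p. whitham_v (1 - p\<^sup>2) (ell_ratio p)) has_real_derivative
     - (4 * (ek - cs) * whitham_v cs ek - 2 * whitham_r) / (cs * p)) (at p)"
proof -
  define r where "r = - (ek\<^sup>2 - 2 * cs * ek + cs) / (cs * p)"
  have r: "(ell_ratio has_real_derivative r) (at p)"
    unfolding r_def by (rule deriv_ell_ratio)
  have deriv: "((\<lambda>p. whitham_v (1 - p\<^sup>2) (ell_ratio p)) has_real_derivative
     (2 * ((- 2 * p) * ek + (1 + cs) * r) + 2 * p) / 3 - 2 * ek * r) (at p)"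
    unfolding whitham_v_def
    by (auto intro!: derivative_eq_intros r simp: field_simps)
  have eq: "(2 * ((- 2 * p) * m + (1 + S) * (- (m\<^sup>2 - 2 * S * m + S) / (S * p))) + 2 * p) / 3
     - 2 * m * (- (m\<^sup>2 - 2 * S * m + S) / (S * p))
     = - (4 * (m - S) * whitham_v S m - 2 * (m * (1 - m) * (m - S))) / (S * p)"
    if "S \<noteq> 0" "p\<^sup>2 = 1 - S" for S m
  proof -
    have "(2 * ((- 2 * p) * m + (1 + S) * (- (m\<^sup>2 - 2 * S * m + S) / (S * p))) + 2 * p) / 3
     - 2 * m * (- (m\<^sup>2 - 2 * S * m + S) / (S * p))
     = - ((4 * (p\<^sup>2 * S) * m + 2 * (1 + S) * (m\<^sup>2 - 2 * S * m + S) - 2 * (p\<^sup>2 * S)) / 3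
      - 2 * m * (m\<^sup>2 - 2 * S * m + S)) / (S * p)"
      using that(1) p_pos by (simp add: field_simps power2_eq_square)
    then show ?thesis
      unfolding that(2) whitham_v_def
      by (simp add: field_simps power2_eq_square)
  qed
  show ?thesis
    by (rule DERIV_cong[OF deriv], unfold r_def whitham_r_def, rule eq) (use p_sq in auto)
qed

lemma deriv_whitham_w:
  "((\<lambda>p. whitham_w (1 - p\<^sup>2) (ell_ratio p)) has_real_derivative
     - whitham_dw cs ek / (cs * p)) (at p)"
proof -
  define r where "r = - (ek\<^sup>2 - 2 * cs * ek + cs) / (cs * p)"
  have r: "(ell_ratio has_real_derivative r) (at p)"
    unfolding r_def by (rule deriv_ell_ratio)
  have deriv: "((\<lambda>p. whitham_w (1 - p\<^sup>2) (ell_ratio p)) has_real_derivative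
     (2 * cs\<^sup>2 - 24 * ek * cs + 36 * ek\<^sup>2 + 10 * cs - 24 * ek + 2) / 3 * r
     + (4 * ek * cs - 12 * ek\<^sup>2 + 10 * ek - 2 * cs - 1) / 3 * (- 2 * p)) (at p)"
    unfolding whitham_w_def
    by (auto intro!: derivative_eq_intros r simp: field_simps power2_eq_square)
  have eq: "A * (- B / (S * p)) + C * (- 2 * p) = - (A * B + C * (2 * S * (1 - S))) / (S * p)"
    if "S \<noteq> 0" "1 - S = p\<^sup>2" for A B C S
    unfolding that(2) using that(1) p_pos by (simp add: field_simps power2_eq_square)
  show ?thesis
    by (rule DERIV_cong[OF deriv], unfold r_def whitham_dw_def, rule eq) (use p_sq in auto)
qed

subsection \<open>Mean values along the family\<close>

lemma d2_eq: "d2 = whitham_v cs ek + ek\<^sup>2"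
  by (simp add: d2_def whitham_v_def ell_ratio_def)

lemma mean_kdv_U_sq:
  "mean (\<lambda>y. (kdv_U k M p y)\<^sup>2) = M\<^sup>2 + (wave_amp p * k\<^sup>2)\<^sup>2 * whitham_v cs ek"
  unfolding mean_def
proof (rule integral_unique)
  let ?A = "wave_amp p * k\<^sup>2"
  have "((\<lambda>y. (M - ?A * ek)\<^sup>2 * 1 + 2 * (M - ?A * ek) * ?A * dn_sq p y + ?A\<^sup>2 * (dn_sq p y)\<^sup>2)
      has_integral (M - ?A * ek)\<^sup>2 * 1 + 2 * (M - ?A * ek) * ?A * ek + ?A\<^sup>2 * d2) {0..1}"
    using has_integral_const_real[of "1::real" 0 1] mean_D
    by (intro has_integral_add has_integral_mult_right mean_D_sq) (simp_all add: ell_ratio_def)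
  then show "((\<lambda>y. (kdv_U k M p y)\<^sup>2) has_integral M\<^sup>2 + ?A\<^sup>2 * whitham_v cs ek) {0..1}"
    unfolding kdv_U_eq d2_eq by (simp add: algebra_simps power2_eq_square)
qed

lemma deriv_kdv_U: "deriv (kdv_U k M p) y = wave_amp p * k\<^sup>2 * dn_sq_deriv p y"
  unfolding kdv_U_eq[abs_def]
  by (rule DERIV_imp_deriv) (auto intro!: derivative_eq_intros deriv_D)

lemma mean_kdv_flux:
  "mean (\<lambda>y. 2 * (kdv_U k M p y) ^ 3 - 3 / 2 * k\<^sup>2 * (deriv (kdv_U k M p) y)\<^sup>2)
    = 2 * M ^ 3 + 6 * M * (wave_amp p * k\<^sup>2)\<^sup>2 * whitham_v cs ek + (wave_amp p * k\<^sup>2) ^ 3 * whitham_w cs ek"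
  unfolding mean_def
proof (rule integral_unique)
  let ?A = "wave_amp p * k\<^sup>2" and ?h = "1 / (4 * (elliptic_K p)\<^sup>2)"
  define B where "B = M - ?A * ek"
  have "((\<lambda>y. 2 * B^3 * 1 + 6 * B\<^sup>2 * ?A * dn_sq p y + 6 * B * ?A\<^sup>2 * (dn_sq p y)\<^sup>2
        + 2 * ?A^3 * (dn_sq p y)^3 - 3 / 4 * ?A^3 * (?h * (dn_sq_deriv p y)\<^sup>2))
      has_integral 2 * B^3 * 1 + 6 * B\<^sup>2 * ?A * ek + 6 * B * ?A\<^sup>2 * d2 + 2 * ?A^3 * d3
        - 3 / 4 * ?A^3 * e2) {0..1}"
    using has_integral_const_real[of "1::real" 0 1] mean_D
    by (intro has_integral_add has_integral_diff has_integral_mult_right mean_D_sq mean_D_cube mean_D1_sq)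
      (simp_all add: ell_ratio_def)
  moreover have "2 * B^3 * 1 + 6 * B\<^sup>2 * ?A * y + 6 * B * ?A\<^sup>2 * y\<^sup>2
        + 2 * ?A^3 * y^3 - 3 / 4 * ?A^3 * (?h * z\<^sup>2)
      = 2 * (M + ?A * (y - ek))^3 - 3 / 2 * k\<^sup>2 * (?A * z)\<^sup>2" for y z
  proof -
    have "3 / 4 * ?A^3 * (?h * z\<^sup>2) = 3 / 4 * ?A\<^sup>2 * (?A * ?h) * z\<^sup>2"
      by (simp add: power2_eq_square power3_eq_cube)
    \<comment> \<open>Expressing k^2 by the amplitude makes k^2 U'^2 cubic in \<kappa>, with the
      factor h D'^2 whose mean is known.\<close>
    also have "?A * ?h = 2 * k\<^sup>2"
      using K_pos by (simp add: wave_amp_def)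
    finally show ?thesis
      unfolding B_def by (simp add: algebra_simps power2_eq_square power3_eq_cube)
  qed
  moreover have "2 * B^3 * 1 + 6 * B\<^sup>2 * ?A * ek + 6 * B * ?A\<^sup>2 * d2 + 2 * ?A^3 * d3
        - 3 / 4 * ?A^3 * e2 = 2 * M ^ 3 + 6 * M * ?A\<^sup>2 * whitham_v cs ek + ?A ^ 3 * whitham_w cs ek"
  proof -
    define A S where "A = ?A" and "S = cs"
    have d: "d2 = (2 * (1 + cs) * ek - cs) / 3" "d3 = (4 * (1 + cs) * d2 - 3 * cs * ek) / 5"
      "e2 = 4 * (- d3 + (1 + cs) * d2 - cs * ek)"
      by (simp_all add: d2_def d3_def e2_def ell_ratio_def)
    show ?thesis
      unfolding B_def d(3) unfolding d(2) unfolding d(1)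
      unfolding whitham_v_def whitham_w_def A_def[symmetric] S_def[symmetric]
      by (simp add: field_simps power2_eq_square power3_eq_cube)
  qed
  ultimately show "((\<lambda>y. 2 * (kdv_U k M p y) ^ 3 - 3 / 2 * k\<^sup>2 * (deriv (kdv_U k M p) y)\<^sup>2)
      has_integral 2 * M ^ 3 + 6 * M * ?A\<^sup>2 * whitham_v cs ek + ?A ^ 3 * whitham_w cs ek) {0..1}"
    unfolding deriv_kdv_U kdv_U_eq by simp
qed

end

section \<open>Differentials of densities and fluxes in the parameters\<close>

lemma cdiff_linear_form:
  assumes "(g has_derivative (\<lambda>(x, y, z). \<alpha> * x + \<beta> * y + \<gamma> * z)) (at s)"
  shows "cdiff g s (a, b, d) = of_real \<alpha> * a + of_real \<beta> * b + of_real \<gamma> * d"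
proof -
  have "frechet_derivative g (at s) = (\<lambda>(x, y, z). \<alpha> * x + \<beta> * y + \<gamma> * z)"
    using frechet_derivative_at[OF assms] by simp
  then show ?thesis by (simp add: cdiff_def complex_eq_iff)
qed

lemma has_derivative_composite_third:
  assumes "(f has_real_derivative f') (at p)"
  shows "((\<lambda>x. f (snd (snd x))) has_derivative (\<lambda>d. snd (snd d) * f')) (at (k, M, p))"
  by (rule DERIV_compose_FDERIV) (auto intro!: derivative_eq_intros assms)

text \<open>The closed forms of the averages hold for 0 < p < 1; since this set of parameters is
  open, they may be differentiated in place of the averages.\<close>

lemma has_derivative_transform_modulus:
  fixes f g :: "real \<times> real \<times> real \<Rightarrow> real"
  assumes "(f has_derivative f') (at (k, M, p))" and "0 < p" "p < 1"
    and "\<And>k M p. \<lbrakk>0 < p; p < 1\<rbrakk> \<Longrightarrow> f (k, M, p) = g (k, M, p)"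
  shows "(g has_derivative f') (at (k, M, p))"
proof (rule has_derivative_transform_within_open[OF assms(1)])
  show "open ((UNIV::real set) \<times> (UNIV::real set) \<times> {0<..<1::real})"
    by (intro open_Times) auto
qed (use assms(2-4) in auto)

context elliptic_modulus
begin

lemma flux_k_has_derivative:
  assumes "k > 0"
  shows "(flux_k has_derivative (\<lambda>(x, y, z).
      (kdv_c k M p + wave_amp p * k\<^sup>2 * (4 * (1 + cs) - 12 * ek)) * x + 6 * k * y
      + 6 * whitham_v cs ek * k * (wave_amp p * k\<^sup>2) / (cs * p) * z)) (at (k, M, p))"
proof -
  define S r L l where "S = cs" and "r = - (ek\<^sup>2 - 2 * cs * ek + cs) / (cs * p)"
    and "L = wave_amp p" and "l = 2 * wave_amp p * (ek - cs) / (cs * p)"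
  note dL = has_derivative_composite_third[OF deriv_wave_amp, of k M]
    and dm = has_derivative_composite_third[OF deriv_ell_ratio, of k M]
  let ?f = "\<lambda>x. fst x * (6 * fst (snd x) + 2 * (wave_amp (snd (snd x)) * (fst x)\<^sup>2)
    * (1 + (1 - (snd (snd x))\<^sup>2) - 3 * ell_ratio (snd (snd x))))"
  have D: "(?f has_derivative (\<lambda>x. fst x * (6 * M + 2 * (L * k\<^sup>2) * (1 + S - 3 * ek))
      + k * (6 * fst (snd x) + 2 * (snd (snd x) * l * k\<^sup>2 + L * (2 * k * fst x)) * (1 + S - 3 * ek)
         + 2 * (L * k\<^sup>2) * (- 2 * p * snd (snd x) - 3 * (snd (snd x) * r))))) (at (k, M, p))"
    unfolding S_def r_def L_def l_def
    by (rule derivative_eq_intros dL dm refl)+ (simp add: fun_eq_iff algebra_simps)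
  have eq: "(\<lambda>x. fst x * (6 * M + 2 * (L * k\<^sup>2) * (1 + S - 3 * ek))
      + k * (6 * fst (snd x) + 2 * (snd (snd x) * l * k\<^sup>2 + L * (2 * k * fst x)) * (1 + S - 3 * ek)
         + 2 * (L * k\<^sup>2) * (- 2 * p * snd (snd x) - 3 * (snd (snd x) * r))))
    = (\<lambda>(x, y, z).
      (kdv_c k M p + wave_amp p * k\<^sup>2 * (4 * (1 + cs) - 12 * ek)) * x + 6 * k * y
      + 6 * whitham_v cs ek * k * (wave_amp p * k\<^sup>2) / (cs * p) * z)"
  proof -
    have "l = 2 * L * (ek - S) / (S * p)" "r = - (ek\<^sup>2 - 2 * S * ek + S) / (S * p)"
      "- 2 * p = - 2 * (1 - S) * S / (S * p)"
      using p_sq p_pos by (simp_all add: l_def r_def S_def L_def field_simps power2_eq_square)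
    note eqs = this
    have "S \<noteq> 0" "p \<noteq> 0" using p_sq p_pos by (auto simp: S_def)
    then show ?thesis
      unfolding kdv_c_eq L_def[symmetric] S_def[symmetric] whitham_v_def eqs
      by (simp add: fun_eq_iff field_simps power2_eq_square)
  qed
  show ?thesis
    by (rule has_derivative_transform_modulus[OF D[unfolded eq] p_pos p_less])
      (simp_all add: flux_k_def kdv_c_eq)
qed

lemma mean_U2_has_derivative:
  assumes "k > 0"
  shows "(mean_U2 has_derivative (\<lambda>(x, y, z).
      4 * whitham_v cs ek * (wave_amp p * k\<^sup>2)\<^sup>2 / k * x + 2 * M * y
      + 2 * whitham_r * (wave_amp p * k\<^sup>2)\<^sup>2 / (cs * p) * z)) (at (k, M, p))"
proof -
  define V L where "V = whitham_v cs ek" and "L = wave_amp p"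
  define V' l where "V' = - (4 * (ek - cs) * V - 2 * whitham_r) / (cs * p)"
    and "l = 2 * L * (ek - cs) / (cs * p)"
  note dL = has_derivative_composite_third[OF deriv_wave_amp, of k M]
    and dV = has_derivative_composite_third[OF deriv_whitham_v, of k M]
  let ?f = "\<lambda>x. (fst (snd x))\<^sup>2 + (wave_amp (snd (snd x)) * (fst x)\<^sup>2)\<^sup>2
    * whitham_v (1 - (snd (snd x))\<^sup>2) (ell_ratio (snd (snd x)))"
  have D: "(?f has_derivative (\<lambda>x. 2 * M * fst (snd x)
     + 2 * (L * k\<^sup>2) * (snd (snd x) * l * k\<^sup>2 + L * (2 * k * fst x)) * V
     + (L * k\<^sup>2)\<^sup>2 * (snd (snd x) * V'))) (at (k, M, p))"
    unfolding V'_def V_def L_def l_def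
    by (rule derivative_eq_intros dL dV refl)+ (simp add: fun_eq_iff algebra_simps)
  have eq: "(\<lambda>x. 2 * M * fst (snd x)
     + 2 * (L * k\<^sup>2) * (snd (snd x) * l * k\<^sup>2 + L * (2 * k * fst x)) * V
     + (L * k\<^sup>2)\<^sup>2 * (snd (snd x) * V'))
    = (\<lambda>(x, y, z). 4 * V * (L * k\<^sup>2)\<^sup>2 / k * x + 2 * M * y + 2 * whitham_r * (L * k\<^sup>2)\<^sup>2 / (cs * p) * z)"
  proof -
    define S where "S = cs"
    have "S \<noteq> 0" "p \<noteq> 0" using p_sq p_pos by (auto simp: S_def)
    then show ?thesis
      unfolding V'_def l_def S_def[symmetric] using assms
      by (simp add: fun_eq_iff field_simps power2_eq_square)
  qed
  show ?thesis
    unfolding V_def[symmetric] L_def[symmetric]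
    by (rule has_derivative_transform_modulus[OF D[unfolded eq] p_pos p_less])
      (simp_all add: mean_U2_def elliptic_modulus.mean_kdv_U_sq elliptic_modulus_def)
qed

lemma flux_M_has_derivative:
  assumes "k > 0"
  shows "(flux_M has_derivative (\<lambda>(x, y, z).
      12 * whitham_v cs ek * (wave_amp p * k\<^sup>2)\<^sup>2 / k * x + 6 * M * y
      + 6 * whitham_r * (wave_amp p * k\<^sup>2)\<^sup>2 / (cs * p) * z)) (at (k, M, p))"
proof -
  have "flux_M = (\<lambda>x. 3 * mean_U2 x)"
    by (auto simp: fun_eq_iff flux_M_def mean_U2_def mean_def)
  show ?thesis
    unfolding \<open>flux_M = _\<close>
    by (rule has_derivative_eq_rhs[OF has_derivative_mult_right[OF mean_U2_has_derivative[OF assms], of 3]])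
      (simp add: fun_eq_iff algebra_simps)
qed

lemma flux_U2_has_derivative:
  assumes "k > 0"
  shows "(flux_U2 has_derivative (\<lambda>(x, y, z).
      (24 * M * (wave_amp p * k\<^sup>2)\<^sup>2 * whitham_v cs ek + 6 * (wave_amp p * k\<^sup>2)^3 * whitham_w cs ek) / k * x
      + (6 * M\<^sup>2 + 6 * (wave_amp p * k\<^sup>2)\<^sup>2 * whitham_v cs ek) * y
      + (12 * M * (wave_amp p * k\<^sup>2)\<^sup>2 * whitham_r
         - (wave_amp p * k\<^sup>2)^3 * (whitham_dw cs ek - 6 * (ek - cs) * whitham_w cs ek)) / (cs * p) * z))
     (at (k, M, p))"
proof -
  define V Wt L where "V = whitham_v cs ek" and "Wt = whitham_w cs ek" and "L = wave_amp p"
  define V' W' l where "V' = - (4 * (ek - cs) * V - 2 * whitham_r) / (cs * p)"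
    and "W' = - whitham_dw cs ek / (cs * p)" and "l = 2 * L * (ek - cs) / (cs * p)"
  note dL = has_derivative_composite_third[OF deriv_wave_amp, of k M]
    and dV = has_derivative_composite_third[OF deriv_whitham_v, of k M]
    and dW = has_derivative_composite_third[OF deriv_whitham_w, of k M]
  let ?f = "\<lambda>x. 2 * (fst (snd x))^3 + 6 * fst (snd x) * (wave_amp (snd (snd x)) * (fst x)\<^sup>2)\<^sup>2
      * whitham_v (1 - (snd (snd x))\<^sup>2) (ell_ratio (snd (snd x)))
    + (wave_amp (snd (snd x)) * (fst x)\<^sup>2)^3
      * whitham_w (1 - (snd (snd x))\<^sup>2) (ell_ratio (snd (snd x)))"
  let ?D = "\<lambda>x. 6 * M\<^sup>2 * fst (snd x) + 6 * fst (snd x) * (L * k\<^sup>2)\<^sup>2 * V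
     + 6 * M * (2 * (L * k\<^sup>2) * (snd (snd x) * l * k\<^sup>2 + L * (2 * k * fst x)) * V
     + (L * k\<^sup>2)\<^sup>2 * (snd (snd x) * V'))
     + 3 * (L * k\<^sup>2)\<^sup>2 * (snd (snd x) * l * k\<^sup>2 + L * (2 * k * fst x)) * Wt
     + (L * k\<^sup>2)^3 * (snd (snd x) * W')"
  have D: "(?f has_derivative ?D) (at (k, M, p))"
    unfolding V'_def V_def Wt_def W'_def L_def l_def
    by (rule derivative_eq_intros dL dV dW refl)+
      (simp add: fun_eq_iff algebra_simps power2_eq_square)
  have eq: "?D = (\<lambda>(x, y, z).
      (24 * M * (L * k\<^sup>2)\<^sup>2 * V + 6 * (L * k\<^sup>2)^3 * Wt) / k * x
      + (6 * M\<^sup>2 + 6 * (L * k\<^sup>2)\<^sup>2 * V) * y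
      + (12 * M * (L * k\<^sup>2)\<^sup>2 * whitham_r
         - (L * k\<^sup>2)^3 * (whitham_dw cs ek - 6 * (ek - cs) * Wt)) / (cs * p) * z)"
  proof -
    define S where "S = cs"
    have "S \<noteq> 0" "p \<noteq> 0" using p_sq p_pos by (auto simp: S_def)
    then show ?thesis
      unfolding V'_def W'_def l_def S_def[symmetric] using assms
      by (simp add: fun_eq_iff field_simps power2_eq_square power3_eq_cube)
  qed
  show ?thesis
    unfolding V_def[symmetric] Wt_def[symmetric] L_def[symmetric]
    by (rule has_derivative_transform_modulus[OF D[unfolded eq] p_pos p_less])
      (simp only: flux_U2_def prod.case fst_conv snd_conv elliptic_modulus.mean_kdv_flux
        elliptic_modulus_def simp_thms)
qed

end

lemma proj_k: "((\<lambda>(k, M, p). k) has_derivative (\<lambda>(x, y, z). 1 * x + 0 * y + 0 * z)) (at (k, M, p))"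
  and proj_M: "((\<lambda>(k, M, p). M) has_derivative (\<lambda>(x, y, z). 0 * x + 1 * y + 0 * z)) (at (k, M, p))"
  for k M p :: real
  by (auto simp: case_prod_beta intro!: derivative_eq_intros)

lemma cdiff_k: "cdiff (\<lambda>(k, M, p). k) (k, M, p) (k0, M0, p0) = k0"
  and cdiff_M: "cdiff (\<lambda>(k, M, p). M) (k, M, p) (k0, M0, p0) = M0"
  using cdiff_linear_form[OF proj_k] cdiff_linear_form[OF proj_M] by simp_all

section \<open>The linearized system in normal form and its exponential solutions\<close>

context elliptic_modulus
begin

text \<open>M disappears from the normal form by Galilean invariance: the term 6 M of the speed
  cancels against the variation of the fluxes, and the third equation is M times the second plus a
  part free of M.\<close>

lemma linearized_whitham_iff_normal:
  fixes lam k0 M0 p0 :: complex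
  assumes "k > 0"
  defines "\<kappa> \<equiv> wave_amp p * k\<^sup>2"
  shows "- of_real (kdv_c k M p) * k0 + lam * k0 + cdiff flux_k (k, M, p) (k0, M0, p0) = 0 \<and>
     (lam - of_real (kdv_c k M p)) * M0 + cdiff flux_M (k, M, p) (k0, M0, p0) = 0 \<and>
     1 / 2 * (lam - of_real (kdv_c k M p)) * cdiff mean_U2 (k, M, p) (k0, M0, p0)
       + cdiff flux_U2 (k, M, p) (k0, M0, p0) = 0 \<longleftrightarrow>
     normal_whitham (of_real cs) (of_real ek) (lam / of_real \<kappa>) (k0 / of_real k)
       (M0 / of_real \<kappa>) (- p0 / of_real (cs * p))"
proof -
  define K S m P where "K = complex_of_real \<kappa>" and "S = complex_of_real cs"
    and "m = complex_of_real ek" and "P = complex_of_real p"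
  define q N where "q = complex_of_real k" and "N = complex_of_real M"
  define V Wt Wd r where "V = whitham_v S m" and "Wt = whitham_w S m" and "Wd = whitham_dw S m"
    and "r = m * (1 - m) * (m - S)"
  define \<tau> a b e where "\<tau> = lam / K" and "a = k0 / q" and "b = M0 / K" and "e = - p0 / (S * P)"
  have nz: "K \<noteq> 0" "q \<noteq> 0" "S \<noteq> 0" "P \<noteq> 0"
    using assms(1) wave_amp_pos p_pos p_sq
    unfolding K_def q_def S_def P_def \<kappa>_def of_real_eq_0_iff by auto
  have params: "lam = K * \<tau>" "k0 = q * a" "M0 = K * b" "p0 = - (S * P * e)"
    using nz by (simp_all add: \<tau>_def a_def b_def e_def)
  have coeffs: "of_real (whitham_v cs ek) = V" "of_real (whitham_w cs ek) = Wt"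
    "of_real (whitham_dw cs ek) = Wd" "of_real whitham_r = r"
    by (simp_all add: whitham_v_def whitham_w_def whitham_dw_def whitham_r_def V_def Wt_def Wd_def r_def
        S_def m_def)
  have c: "of_real (kdv_c k M p) = 6 * N + 2 * K * (1 + S - 3 * m)"
    by (simp add: kdv_c_eq K_def S_def m_def N_def \<kappa>_def)
  note * = flux_k_has_derivative[OF assms(1), of M, folded \<kappa>_def]
    flux_M_has_derivative[OF assms(1), of M, folded \<kappa>_def]
    mean_U2_has_derivative[OF assms(1), of M, folded \<kappa>_def]
    flux_U2_has_derivative[OF assms(1), of M, folded \<kappa>_def]
  have fk: "cdiff flux_k (k, M, p) (k0, M0, p0)
      = (of_real (kdv_c k M p) + K * (4 * (1 + S) - 12 * m)) * k0 + 6 * q * M0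
        + 6 * V * q * K / (S * P) * p0"
    unfolding cdiff_linear_form[OF *(1)] coeffs[symmetric]
    by (simp add: K_def S_def m_def q_def P_def)
  have fM: "cdiff flux_M (k, M, p) (k0, M0, p0)
      = 12 * V * K\<^sup>2 / q * k0 + 6 * N * M0 + 6 * r * K\<^sup>2 / (S * P) * p0"
    unfolding cdiff_linear_form[OF *(2)] coeffs[symmetric]
    by (simp add: K_def S_def m_def q_def P_def N_def)
  have fU: "cdiff mean_U2 (k, M, p) (k0, M0, p0)
      = 4 * V * K\<^sup>2 / q * k0 + 2 * N * M0 + 2 * r * K\<^sup>2 / (S * P) * p0"
    unfolding cdiff_linear_form[OF *(3)] coeffs[symmetric]
    by (simp add: K_def S_def m_def q_def P_def N_def)
  have fF: "cdiff flux_U2 (k, M, p) (k0, M0, p0)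
      = (24 * N * K\<^sup>2 * V + 6 * K^3 * Wt) / q * k0 + (6 * N\<^sup>2 + 6 * K\<^sup>2 * V) * M0
        + (12 * N * K\<^sup>2 * r - K^3 * (Wd - 6 * (m - S) * Wt)) / (S * P) * p0"
    unfolding cdiff_linear_form[OF *(4)] coeffs[symmetric]
    by (simp add: K_def S_def m_def q_def P_def N_def)
  let ?E1 = "- of_real (kdv_c k M p) * k0 + lam * k0 + cdiff flux_k (k, M, p) (k0, M0, p0)"
  let ?E2 = "(lam - of_real (kdv_c k M p)) * M0 + cdiff flux_M (k, M, p) (k0, M0, p0)"
  let ?E3 = "1 / 2 * (lam - of_real (kdv_c k M p)) * cdiff mean_U2 (k, M, p) (k0, M0, p0)
       + cdiff flux_U2 (k, M, p) (k0, M0, p0)"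
  let ?N1 = "(\<tau> + 4 * (1 + S) - 12 * m) * a + 6 * b - 6 * V * e"
  let ?N2 = "12 * V * a + (\<tau> + 6 * m - 2 * (1 + S)) * b - 6 * r * e"
  let ?N3 = "(2 * V * (\<tau> + 6 * m - 2 * (1 + S)) + 6 * Wt) * a + 6 * V * b
       + (Wd - 6 * (m - S) * Wt - (\<tau> + 6 * m - 2 * (1 + S)) * r) * e"
  have E1: "?E1 = q * K * ?N1"
    unfolding fk c unfolding params using nz by (simp add: field_simps)
  have E2: "?E2 = K\<^sup>2 * ?N2"
    unfolding fM c unfolding params using nz by (simp add: field_simps power2_eq_square)
  have E3: "?E3 = N * ?E2 + K^3 * ?N3"
    unfolding fM fU fF c unfolding params using nz
    by (simp add: field_simps power2_eq_square power3_eq_cube)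
  have "?E1 = 0 \<and> ?E2 = 0 \<and> ?E3 = 0 \<longleftrightarrow> ?N1 = 0 \<and> ?N2 = 0 \<and> ?N3 = 0"
    unfolding E3 unfolding E1 E2 using nz by auto
  also have "\<dots> \<longleftrightarrow> normal_whitham S m \<tau> a b e"
    by (simp add: normal_whitham_def V_def Wt_def Wd_def r_def)
  finally show ?thesis
    by (simp add: S_def m_def \<tau>_def a_def b_def e_def K_def q_def P_def)
qed

lemma half_mean_U2_has_derivative:
  assumes "k > 0"
  shows "((\<lambda>s. 1 / 2 * mean_U2 s) has_derivative (\<lambda>(x, y, z).
      (2 * whitham_v cs ek * (wave_amp p * k\<^sup>2)\<^sup>2 / k) * x + M * y
      + (whitham_r * (wave_amp p * k\<^sup>2)\<^sup>2 / (cs * p)) * z)) (at (k, M, p))"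
  by (rule has_derivative_eq_rhs[OF has_derivative_mult_right[OF
        mean_U2_has_derivative[OF assms], of "1 / 2"]])
    (simp add: fun_eq_iff algebra_simps)

lemma cdiff_half_mean_U2:
  assumes "k > 0"
  shows "cdiff (\<lambda>s. 1 / 2 * mean_U2 s) (k, M, p) (k0, M0, p0)
    = 1 / 2 * cdiff mean_U2 (k, M, p) (k0, M0, p0)"
  unfolding cdiff_linear_form[OF half_mean_U2_has_derivative[OF assms]]
    cdiff_linear_form[OF mean_U2_has_derivative[OF assms]]
  by (simp add: algebra_simps)

text \<open>The differentials are complex linear, so the exponential factors out of every law and
  leaves \<nu> times the scalar equation (lam - c) q + f = 0 for the variations q of the density and
  f of the flux.\<close>

lemma exponential_solves_linearized_whitham:
  assumes "k > 0"
    and eq1: "- of_real c * k0 + lam * k0 + cdiff flux_k (k, M, p) (k0, M0, p0) = 0"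
    and eq2: "(lam - of_real c) * M0 + cdiff flux_M (k, M, p) (k0, M0, p0) = 0"
    and eq3: "1 / 2 * (lam - of_real c) * cdiff mean_U2 (k, M, p) (k0, M0, p0)
       + cdiff flux_U2 (k, M, p) (k0, M0, p0) = 0"
  shows "solves_linearized_whitham (k, M, p) c
    (\<lambda>X T. let e = exp (\<nu> * (of_real X + lam * of_real T)) in (e * k0, e * M0, e * p0))"
proof -
  have linear: "cdiff g (k, M, p) (e * k0, e * M0, e * p0) = e * cdiff g (k, M, p) (k0, M0, p0)"
    if "(g has_derivative (\<lambda>(x, y, z). \<alpha> * x + \<beta> * y + \<gamma> * z)) (at (k, M, p))" for g \<alpha> \<beta> \<gamma> e
    unfolding cdiff_linear_form[OF that] by (simp add: algebra_simps)
  have law: "\<exists>QT QX FX.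
      ((\<lambda>t. exp (\<nu> * (of_real X + lam * of_real t)) * q) has_vector_derivative QT) (at T) \<and>
      ((\<lambda>x. exp (\<nu> * (of_real x + lam * of_real T)) * q) has_vector_derivative QX) (at X) \<and>
      ((\<lambda>x. exp (\<nu> * (of_real x + lam * of_real T)) * f) has_vector_derivative FX) (at X) \<and>
      QT - of_real c * QX + FX = 0"
    if "(lam - of_real c) * q + f = 0" for q f X T
  proof (intro exI conjI)
    let ?e = "exp (\<nu> * (of_real X + lam * of_real T))"
    have dT: "((\<lambda>t. exp (\<nu> * (of_real X + lam * of_real t)) * y) has_vector_derivative
        \<nu> * lam * ?e * y) (at T)" for y
      by (rule has_vector_derivative_real_field[of "\<lambda>t. exp (\<nu> * (of_real X + lam * t)) * y"])
        (auto intro!: derivative_eq_intros)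
    have dX: "((\<lambda>x. exp (\<nu> * (of_real x + lam * of_real T)) * y) has_vector_derivative
        \<nu> * ?e * y) (at X)" for y
      by (rule has_vector_derivative_real_field[of "\<lambda>x. exp (\<nu> * (x + lam * of_real T)) * y"])
        (auto intro!: derivative_eq_intros)
    show "((\<lambda>t. exp (\<nu> * (of_real X + lam * of_real t)) * q) has_vector_derivative \<nu> * lam * ?e * q) (at T)"
      by (rule dT)
    show "((\<lambda>x. exp (\<nu> * (of_real x + lam * of_real T)) * q) has_vector_derivative \<nu> * ?e * q) (at X)"
      "((\<lambda>x. exp (\<nu> * (of_real x + lam * of_real T)) * f) has_vector_derivative \<nu> * ?e * f) (at X)"
      by (rule dX)+
    have "\<nu> * lam * ?e * q - of_real c * (\<nu> * ?e * q) + \<nu> * ?e * f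
        = \<nu> * ?e * ((lam - of_real c) * q + f)"
      by (simp add: algebra_simps)
    then show "\<nu> * lam * ?e * q - of_real c * (\<nu> * ?e * q) + \<nu> * ?e * f = 0"
      unfolding that by simp
  qed
  show ?thesis
    unfolding solves_linearized_whitham_def whitham_laws_def Let_def ball_simps prod.case
      linear[OF proj_k] linear[OF proj_M]
      linear[OF half_mean_U2_has_derivative[OF assms(1)]]
      linear[OF flux_k_has_derivative[OF assms(1)]]
      linear[OF flux_M_has_derivative[OF assms(1)]] linear[OF flux_U2_has_derivative[OF assms(1)]]
    unfolding cdiff_k cdiff_M cdiff_half_mean_U2[OF assms(1)]
  proof (intro conjI allI TrueI)
    fix X T
    show "\<exists>QT QX FX.
      ((\<lambda>t. exp (\<nu> * (of_real X + lam * of_real t)) * k0) has_vector_derivative QT) (at T) \<and>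
      ((\<lambda>x. exp (\<nu> * (of_real x + lam * of_real T)) * k0) has_vector_derivative QX) (at X) \<and>
      ((\<lambda>x. exp (\<nu> * (of_real x + lam * of_real T)) * cdiff flux_k (k, M, p) (k0, M0, p0))
        has_vector_derivative FX) (at X) \<and> QT - of_real c * QX + FX = 0"
      by (rule law) (use eq1 in \<open>simp add: algebra_simps\<close>)
    show "\<exists>QT QX FX.
      ((\<lambda>t. exp (\<nu> * (of_real X + lam * of_real t)) * M0) has_vector_derivative QT) (at T) \<and>
      ((\<lambda>x. exp (\<nu> * (of_real x + lam * of_real T)) * M0) has_vector_derivative QX) (at X) \<and>
      ((\<lambda>x. exp (\<nu> * (of_real x + lam * of_real T)) * cdiff flux_M (k, M, p) (k0, M0, p0))
        has_vector_derivative FX) (at X) \<and> QT - of_real c * QX + FX = 0"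
      by (rule law) (rule eq2)
    show "\<exists>QT QX FX.
      ((\<lambda>t. exp (\<nu> * (of_real X + lam * of_real t)) * (1 / 2 * cdiff mean_U2 (k, M, p) (k0, M0, p0)))
        has_vector_derivative QT) (at T) \<and>
      ((\<lambda>x. exp (\<nu> * (of_real x + lam * of_real T)) * (1 / 2 * cdiff mean_U2 (k, M, p) (k0, M0, p0)))
        has_vector_derivative QX) (at X) \<and>
      ((\<lambda>x. exp (\<nu> * (of_real x + lam * of_real T)) * cdiff flux_U2 (k, M, p) (k0, M0, p0))
        has_vector_derivative FX) (at X) \<and> QT - of_real c * QX + FX = 0"
      by (rule law) (use eq3 in \<open>simp add: algebra_simps\<close>)
  qed
qed

end

section \<open>From the Bloch waves to the Whitham system\<close>

lemma has_vector_derivative_periodic: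
  fixes f f' :: "real \<Rightarrow> 'a::real_normed_vector"
  assumes "\<And>x. (f has_vector_derivative f' x) (at x)" and "\<And>x. f (x + 1) = f x"
  shows "f' (x + 1) = f' x"
proof -
  have "((\<lambda>x. x + 1) has_vector_derivative 1) (at x)"
    by (auto intro!: derivative_eq_intros)
  from vector_diff_chain_at[OF this assms(1)]
  have "(f has_vector_derivative f' (x + 1)) (at x)"
    by (simp add: o_def assms(2))
  then show ?thesis using assms(1) vector_derivative_unique_at by blast
qed

lemma pair_zero [simp]: "pair u (\<lambda>_. 0) = 0"
  by (simp add: pair_def)

\<comment> \<open>Certificate for the elimination of the moments: ?x, ?y, ?z stand for n_0, n_1,
  n_2, ?a for \<alpha> and ?F for <h D'^2>. The right side combines the four tested relations so
  that ?y, ?z and ?F cancel; its last summand vanishes by the definition of the variance.\<close>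
schematic_goal second_order_elimination:
  "6 * (?V :: 'a::field_char_0) * ((2 * ?V * (?t + 6 * ?M - 2 * (1 + ?S)) + 6 * ?W) * ?a + 6 * ?V * ?x)
      + (6 * ?V\<^sup>2 - 6 * (?M * (1 - ?M) * (?M - ?S)) * (1 + ?S - 3 * ?M)
          - (?t + 6 * ?M - 2 * (1 + ?S)) * (?M * (1 - ?M) * (?M - ?S)))
        * (6 * ?x + (?t + 4 * (1 + ?S) - 12 * ?M) * ?a)
    = 6 * ?V * ((?t * ?y + (- 3 * ?z + 4 * (1 + ?S) * ?y - 3 * ?S * ?x) - 3 / 2 * ?a * ?F)
          - ?M * (?t * ?x + (6 * ?y - 2 * (1 + ?S) * ?x))
          - (- ?t * ?a * ?V - (3 * ?z - ?S * ?x - ?M * (6 * ?y - 2 * (1 + ?S) * ?x))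
             + ?a * (2 * (4 * (1 + ?S) - 12 * ?M) * ?V - 6 * ?W - 3 / 2 * ?F)))
      - (?t + (4 * (1 + ?S) - 12 * ?M))
        * (?t * ?a * (?M * (1 - ?M) * (?M - ?S))
           - ((6 * ?M * ?V - 2 * (1 + ?S) * ?V - 6 * (?M * (1 - ?M) * (?M - ?S))) * ?x
              - ?V * (6 * ?y - 2 * (1 + ?S) * ?x))
           + ?a * (- 12 * ?V\<^sup>2 + (?M * (1 - ?M) * (?M - ?S)) * (4 * (1 + ?S) - 12 * ?M)))
      + 6 * ?V * ?x * (12 * ?V - (8 * (1 + ?S) * ?M - 4 * ?S - 12 * ?M\<^sup>2))"
  by (simp add: field_simps power2_eq_square)

context kdv_profile
begin

text \<open>Integration by parts over a period with \<nu> kept as a parameter: in the expansion of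
  (d/dx + \<nu>)^3 the odd powers of d/dx change sign and the even ones do not. Each choice of
  \<phi> gives one scalar relation for u.\<close>

lemma bloch_weak_form:
  fixes u u1 u2 u3 :: "real \<Rightarrow> complex" and \<phi> \<phi>1 \<phi>2 \<phi>3 :: "real \<Rightarrow> real"
  assumes u: "\<And>x. (u has_vector_derivative u1 x) (at x)"
    and u1: "\<And>x. (u1 has_vector_derivative u2 x) (at x)"
    and u2: "\<And>x. (u2 has_vector_derivative u3 x) (at x)"
    and per: "u 1 = u 0" "u1 1 = u1 0" "u2 1 = u2 0"
    and \<phi>: "\<And>x. (\<phi> has_real_derivative \<phi>1 x) (at x)"
    and \<phi>1: "\<And>x. (\<phi>1 has_real_derivative \<phi>2 x) (at x)"
    and \<phi>2: "\<And>x. (\<phi>2 has_real_derivative \<phi>3 x) (at x)"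
    and \<phi>_per: "\<phi> 1 = \<phi> 0" "\<phi>1 1 = \<phi>1 0" "\<phi>2 1 = \<phi>2 0"
    and \<phi>3: "continuous_on {0..1} \<phi>3"
    and eq: "\<And>x. \<mu> * u x
        + (of_real (6 * D1 x) * u x + of_real (Q1 x) * u1 x + \<nu> * of_real (Q1 x) * u x)
        + of_real (h / 2) * (u3 x + 3 * \<nu> * u2 x + 3 * \<nu>\<^sup>2 * u1 x + \<nu>^3 * u x) = 0"
  shows "\<mu> * pair u \<phi> - pair u (\<lambda>x. Q1 x * \<phi>1 x + h / 2 * \<phi>3 x)
      + \<nu> * pair u (\<lambda>x. Q1 x * \<phi> x + 3 * h / 2 * \<phi>2 x)
      - of_real (3 * h / 2) * \<nu>\<^sup>2 * pair u \<phi>1 + of_real (h / 2) * \<nu>^3 * pair u \<phi> = 0"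
proof -
  let ?r = "complex_of_real"
  let ?B = "\<lambda>x. ?r (Q1 x) * u x * ?r (\<phi> x) + ?r (h / 2)
    * (u2 x * ?r (\<phi> x) - u1 x * ?r (\<phi>1 x) + u x * ?r (\<phi>2 x)
       + 3 * \<nu> * (u1 x * ?r (\<phi> x) - u x * ?r (\<phi>1 x)) + 3 * \<nu>\<^sup>2 * (u x * ?r (\<phi> x)))"
  let ?B' = "\<lambda>x. (?r (Q1 x) * u x * ?r (\<phi>1 x)
       + (?r (Q1 x) * u1 x + ?r (6 * D1 x) * u x) * ?r (\<phi> x))
     + ?r (h / 2) * (u3 x * ?r (\<phi> x) + u x * ?r (\<phi>3 x)
       + 3 * \<nu> * (u2 x * ?r (\<phi> x) - u x * ?r (\<phi>2 x))
       + 3 * \<nu>\<^sup>2 * (u x * ?r (\<phi>1 x) + u1 x * ?r (\<phi> x)))"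
  have dB: "(?B has_vector_derivative ?B' x) (at x)" for x
  proof -
    have "(?B has_vector_derivative (?r (Q1 x) * u x * ?r (\<phi>1 x)
       + (?r (Q1 x) * u1 x + ?r (6 * D1 x) * u x) * ?r (\<phi> x))
     + (?r (h / 2) * (((u2 x * ?r (\<phi>1 x) + u3 x * ?r (\<phi> x)) - (u1 x * ?r (\<phi>2 x) + u2 x * ?r (\<phi>1 x))
         + (u x * ?r (\<phi>3 x) + u1 x * ?r (\<phi>2 x)))
       + (3 * \<nu> * ((u1 x * ?r (\<phi>1 x) + u2 x * ?r (\<phi> x)) - (u x * ?r (\<phi>2 x) + u1 x * ?r (\<phi>1 x)))
           + 0 * (u1 x * ?r (\<phi> x) - u x * ?r (\<phi>1 x)))
       + (3 * \<nu>\<^sup>2 * (u x * ?r (\<phi>1 x) + u1 x * ?r (\<phi> x)) + 0 * (u x * ?r (\<phi> x))))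
       + 0 * (u2 x * ?r (\<phi> x) - u1 x * ?r (\<phi>1 x) + u x * ?r (\<phi>2 x)
       + 3 * \<nu> * (u1 x * ?r (\<phi> x) - u x * ?r (\<phi>1 x)) + 3 * \<nu>\<^sup>2 * (u x * ?r (\<phi> x))))) (at x)"
      by (intro has_vector_derivative_add has_vector_derivative_diff has_vector_derivative_mult
          has_vector_derivative_const has_vector_derivative_of_real u u1 u2 \<phi> \<phi>1 \<phi>2 deriv_Q1)
    then show ?thesis
      by (rule has_vector_derivative_eq_rhs) (simp add: algebra_simps)
  qed
  have "(?B' has_integral (?B 1 - ?B 0)) {0..1}"
    by (rule fundamental_theorem_of_calculus)
      (simp, rule has_vector_derivative_at_within[OF dB])
  then have int_B: "(?B' has_integral 0) {0..1}"
    using per \<phi>_per profile_periods by (simp add: Q1_def)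
  have cont_u: "continuous_on {0..1} u"
    by (intro continuous_at_imp_continuous_on ballI has_vector_derivative_continuous[OF u])
  have cont: "continuous_on {0..1} \<phi>" "continuous_on {0..1} \<phi>1" "continuous_on {0..1} \<phi>2"
    "continuous_on {0..1} Q1"
    by (intro continuous_at_imp_continuous_on ballI DERIV_isCont[OF \<phi>] DERIV_isCont[OF \<phi>1]
        DERIV_isCont[OF \<phi>2] DERIV_isCont[OF deriv_Q1])+
  let ?F = "\<lambda>x. \<mu> * (u x * ?r (\<phi> x)) - u x * ?r (Q1 x * \<phi>1 x + h / 2 * \<phi>3 x)
     + \<nu> * (u x * ?r (Q1 x * \<phi> x + 3 * h / 2 * \<phi>2 x)) - ?r (3 * h / 2) * \<nu>\<^sup>2 * (u x * ?r (\<phi>1 x))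
     + ?r (h / 2) * \<nu>^3 * (u x * ?r (\<phi> x))"
  have "(?F has_integral (\<mu> * pair u \<phi> - pair u (\<lambda>x. Q1 x * \<phi>1 x + h / 2 * \<phi>3 x)
      + \<nu> * pair u (\<lambda>x. Q1 x * \<phi> x + 3 * h / 2 * \<phi>2 x)
      - of_real (3 * h / 2) * \<nu>\<^sup>2 * pair u \<phi>1 + of_real (h / 2) * \<nu>^3 * pair u \<phi>)) {0..1}"
    by (intro has_integral_add has_integral_diff has_integral_mult_right pair_has_integral cont_u
        continuous_intros cont \<phi>3)
  moreover have "(?F has_integral 0) {0..1}"
  proof -
    have "?F x = - ?B' x" for x
    proof -
      have "?F x + ?B' x = (\<mu> * u x
        + (of_real (6 * D1 x) * u x + of_real (Q1 x) * u1 x + \<nu> * of_real (Q1 x) * u x)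
        + of_real (h / 2) * (u3 x + 3 * \<nu> * u2 x + 3 * \<nu>\<^sup>2 * u1 x + \<nu>^3 * u x)) * ?r (\<phi> x)"
        by (simp add: algebra_simps)
      then show ?thesis
        unfolding eq mult_zero_left by (rule eq_neg_iff_add_eq_0[THEN iffD2])
    qed
    then show ?thesis using has_integral_neg[OF int_B] by simp
  qed
  ultimately show ?thesis by (rule has_integral_unique)
qed

lemma profile_continuous:
  "continuous_on S D" "continuous_on S D1" "continuous_on S D2" "continuous_on S D3"
  "continuous_on S Q1" "continuous_on S Z" "continuous_on S G" "continuous_on S G1"
  "continuous_on S G2" "continuous_on S Y"
proof -
  show *: "continuous_on S D" "continuous_on S D1" "continuous_on S D2"
    "continuous_on S Q1" "continuous_on S Z" "continuous_on S G" "continuous_on S G1"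
    "continuous_on S Y"
    by (intro continuous_at_imp_continuous_on ballI DERIV_isCont[OF deriv_D]
        DERIV_isCont[OF deriv_D1'] DERIV_isCont[OF deriv_D2] DERIV_isCont[OF deriv_Q1]
        DERIV_isCont[OF deriv_Z] DERIV_isCont[OF deriv_G] DERIV_isCont[OF deriv_G1]
        DERIV_isCont[OF deriv_Y])+
  show "continuous_on S D3"
    unfolding D3_def using h_pos by (intro continuous_intros *) auto
  then show "continuous_on S G2"
    unfolding G2_def by (intro continuous_intros *)
qed

definition moment :: "(real \<Rightarrow> complex) \<Rightarrow> nat \<Rightarrow> complex" where
  "moment u j = pair u (\<lambda>x. D x ^ j)"

text \<open>All images of test functions that are paired with the unknown derivative of u are
  quadratics in D, so three moments describe it completely.\<close>

lemma pair_quadratic: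
  assumes "continuous_on {0..1} u"
    and "\<And>x. \<phi> x = a0 + a1 * D x + a2 * (D x)\<^sup>2"
  shows "pair u \<phi> = of_real a0 * moment u 0 + of_real a1 * moment u 1 + of_real a2 * moment u 2"
proof (rule pairI)
  have "((\<lambda>x. of_real a0 * (u x * of_real (D x ^ 0)) + of_real a1 * (u x * of_real (D x ^ 1))
      + of_real a2 * (u x * of_real (D x ^ 2))) has_integral
      of_real a0 * moment u 0 + of_real a1 * moment u 1 + of_real a2 * moment u 2) {0..1}"
    unfolding moment_def
    by (intro has_integral_add has_integral_mult_right pair_has_integral assms(1)
        continuous_intros profile_continuous)
  then show "((\<lambda>x. u x * of_real (\<phi> x)) has_integral
      of_real a0 * moment u 0 + of_real a1 * moment u 1 + of_real a2 * moment u 2) {0..1}"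
    by (rule has_integral_eq[rotated]) (simp add: assms(2) algebra_simps power2_eq_square)
qed

text \<open>Zero variance would make D constant on the unit interval, equal to D(0) = 1, whereas h
  D'' = - 2 (1 - s) wherever D = 1.\<close>

lemma v_nonzero: "v \<noteq> 0"
proof
  assume "v = 0"
  have "((\<lambda>x. (D x)\<^sup>2 - 2 * m * D x + m\<^sup>2) has_integral d2 - 2 * m * m + m\<^sup>2 * (1 - 0)) {0..1}"
    using has_integral_const_real[of "m\<^sup>2" 0 1]
    by (intro has_integral_add has_integral_diff has_integral_mult_right mean_D mean_D_sq) simp
  then have int: "((\<lambda>x. (D x - m)\<^sup>2) has_integral 0) {0..1}"
    using \<open>v = 0\<close> by (simp add: v_eq power2_eq_square algebra_simps)
  have const: "D x = m" if "x \<in> {0..1}" for x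
  proof -
    have "(D x - m)\<^sup>2 = 0"
      by (rule has_integral_0_cbox_imp_0[of 0 1 "\<lambda>x. (D x - m)\<^sup>2"])
        (use that int in \<open>auto intro!: continuous_intros profile_continuous\<close>)
    then show ?thesis by simp
  qed
  have "m = 1" using const[of 0] D_0 by simp
  have D1: "D1 x = 0" if "x \<in> {0<..<1}" for x
  proof (rule DERIV_unique[OF deriv_D])
    show "(D has_real_derivative 0) (at x)"
      by (rule has_field_derivative_transform_within_open[where f = "\<lambda>_. m" and S = "{0<..<1}"])
        (use that const in auto)
  qed
  have "D2 (1 / 2) = 0"
  proof (rule DERIV_unique[OF deriv_D1'])
    show "(D1 has_real_derivative 0) (at (1 / 2))"
      by (rule has_field_derivative_transform_within_open[where f = "\<lambda>_. 0" and S = "{0<..<1}"])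
        (use D1 in auto)
  qed
  then show False
    using h_D2[of "1 / 2"] const[of "1 / 2"] \<open>m = 1\<close> s_less by simp
qed

lemma g1_eq: "g1 = m * v - m * (1 - m) * (m - s)"
  unfolding g1_def d3_def d2_def v_def
  by (simp add: field_simps power2_eq_square power3_eq_cube)

text \<open>Arranged for the relation with test function D: subtracting m times the relation with
  test function 1 leaves \<tau> (g1 - m v) + 12 v^2 - r (4 (1 + s) - 12 m), where r = m (1 - m) (m -
  s). By \<open>g1_eq\<close> and \<open>whitham_dw_eq\<close> this is the third Whitham equation in
  the direction a = 0, b = v, e = 1.\<close>

lemma g2_eq:
  "g2 = (4 * (1 + s) * g1 - 3 * s * v + 2 * (1 + s) * m * v - 6 * m * g1 - 12 * v\<^sup>2
     + m * (1 - m) * (m - s) * (4 * (1 + s) - 12 * m)) / 3"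
  unfolding g2_def g1_def d4_def d3_def d2_def v_def
  by (simp add: field_simps power2_eq_square power3_eq_cube)

lemma C0_eq: "C0 = 6 * m * v - 2 * (1 + s) * v - 6 * (m * (1 - m) * (m - s))"
  unfolding C0_def v_def
  by (simp add: field_simps power2_eq_square power3_eq_cube)

lemma y1_eq: "y1 = - 12 * v\<^sup>2 + m * (1 - m) * (m - s) * (4 * (1 + s) - 12 * m)"
  unfolding y1_def g2_def g1_def d4_def d3_def d2_def v_def
  by (simp add: field_simps power2_eq_square power3_eq_cube)

lemma z1_eq: "z1 = 2 * (4 * (1 + s) - 12 * m) * v - 6 * whitham_w s m - 3 / 2 * e2"
  unfolding z1_def e2_def d3_def d2_def v_def whitham_w_def
  by (simp add: field_simps power2_eq_square power3_eq_cube)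

lemma of_real_whitham_v: "of_real v = (whitham_v (of_real s) (of_real m) :: complex)"
  by (simp add: v_def whitham_v_def)

text \<open>The direction (0, v, 1) is that of \<open>G\<close>: wavenumber and phase speed are
  fixed and the mean changes by <G>. The first equation holds identically, and the pairings with 1
  and D give the other two.\<close>

lemma normal_whitham_first_order:
  fixes \<tau> :: complex
  assumes "(\<tau> - 2 * (1 + of_real s)) * of_real v + 6 * of_real g1 = 0"
    and "(\<tau> + 4 * (1 + of_real s)) * of_real g1 - 3 * of_real g2 - 3 * of_real s * of_real v = 0"
  shows "normal_whitham (of_real s) (of_real m) \<tau> 0 (of_real v) 1"
proof -
  define S M V where "S = complex_of_real s" and "M = complex_of_real m" and "V = complex_of_real v"
  have V: "whitham_v S M = V"
    by (simp add: S_def M_def V_def of_real_whitham_v)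
  have g1: "of_real g1 = M * V - M * (1 - M) * (M - S)"
    by (simp add: g1_eq S_def M_def V_def)
  have g2: "of_real g2 = (4 * (1 + S) * of_real g1 - 3 * S * V + 2 * (1 + S) * M * V
      - 6 * M * of_real g1 - 12 * V\<^sup>2 + M * (1 - M) * (M - S) * (4 * (1 + S) - 12 * M)) / 3"
    by (simp add: g2_eq S_def M_def V_def)
  have e0: "(\<tau> - 2 * (1 + S)) * V + 6 * of_real g1 = 0"
    and e1: "(\<tau> + 4 * (1 + S)) * of_real g1 - 3 * of_real g2 - 3 * S * V = 0"
    using assms unfolding S_def V_def by blast+
  show ?thesis
    unfolding normal_whitham_def S_def[symmetric] M_def[symmetric] V_def[symmetric] V whitham_dw_eq
    using e0 e1 unfolding g2 unfolding g1 by (intro conjI) (simp, algebra, algebra)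
qed

text \<open>The case u(0) = \<alpha> D', with n_j the moments of the \<nu>-derivative of the Bloch
  wave. \<open>T0\<close> and \<open>T1\<close> come from the test functions 1 and D at order
  \<nu>^2, \<open>T2\<close> and \<open>T3\<close> from \<open>Z\<close> and \<open>Y\<close> at
  order \<nu>.\<close>

lemma normal_whitham_second_order:
  fixes \<tau> \<alpha> n0 n1 n2 :: complex
  assumes T0: "\<tau> * n0 + (6 * n1 - 2 * (1 + of_real s) * n0) = 0"
    and T1: "\<tau> * n1 + (- 3 * n2 + 4 * (1 + of_real s) * n1 - 3 * of_real s * n0)
      - 3 / 2 * \<alpha> * of_real e2 = 0"
    and T2: "- \<tau> * \<alpha> * of_real v - (3 * n2 - of_real s * n0
      - of_real m * (6 * n1 - 2 * (1 + of_real s) * n0)) + \<alpha> * of_real z1 = 0"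
    and T3: "- \<tau> * \<alpha> * of_real (g1 - m * v) - (of_real C0 * n0
      - of_real v * (6 * n1 - 2 * (1 + of_real s) * n0)) + \<alpha> * of_real y1 = 0"
  shows "\<exists>e. normal_whitham (of_real s) (of_real m) \<tau> \<alpha> n0 e"
proof -
  define S M V Wt where "S = complex_of_real s" and "M = complex_of_real m"
    and "V = complex_of_real v" and "Wt = complex_of_real (whitham_w s m)"
  \<comment> \<open>Forced by the first Whitham equation, which can be solved for e because the
    variance does not vanish.\<close>
  define e where "e = (6 * n0 + (\<tau> + 4 * (1 + S) - 12 * M) * \<alpha>) / (6 * V)"
  have V: "whitham_v S M = V" and Wt: "whitham_w S M = Wt"
    by (simp_all add: S_def M_def V_def Wt_def of_real_whitham_v whitham_w_def)
  have nz: "V \<noteq> 0" using v_nonzero by (simp add: V_def)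
  have Ve: "6 * V * e = 6 * n0 + (\<tau> + 4 * (1 + S) - 12 * M) * \<alpha>"
    using nz by (simp add: e_def)
  have v_eq: "12 * V = 8 * (1 + S) * M - 4 * S - 12 * M\<^sup>2"
    unfolding V[symmetric] whitham_v_def by algebra
  let ?r = "M * (1 - M) * (M - S)" and ?L = "4 * (1 + S) - 12 * M"
  let ?t = "\<tau> + 6 * M - 2 * (1 + S)"
  let ?T0 = "\<tau> * n0 + (6 * n1 - 2 * (1 + S) * n0)"
  let ?T1 = "\<tau> * n1 + (- 3 * n2 + 4 * (1 + S) * n1 - 3 * S * n0) - 3 / 2 * \<alpha> * of_real e2"
  let ?T2 = "- \<tau> * \<alpha> * V - (3 * n2 - S * n0 - M * (6 * n1 - 2 * (1 + S) * n0))
    + \<alpha> * (2 * ?L * V - 6 * Wt - 3 / 2 * of_real e2)"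
  let ?T3 = "\<tau> * \<alpha> * ?r - ((6 * M * V - 2 * (1 + S) * V - 6 * ?r) * n0
    - V * (6 * n1 - 2 * (1 + S) * n0)) + \<alpha> * (- 12 * V\<^sup>2 + ?r * ?L)"
  have T: "?T0 = 0" "?T1 = 0" "?T2 = 0" "?T3 = 0"
    using T0 T1 T2 T3 unfolding S_def M_def V_def Wt_def z1_eq y1_eq C0_eq g1_eq by simp_all
  \<comment> \<open>\<open>?T0\<close> and \<open>?T3\<close> contain n_1 only through 6 n_1 - 2 (1
    + S) n_0, so V times the first minus the second is free of it.\<close>
  have "V * (12 * V * \<alpha> + ?t * n0 - 6 * ?r * e) = V * (12 * V * \<alpha> + ?t * n0) - ?r * (6 * V * e)"
    by algebra
  also have "\<dots> = V * ?T0 - ?T3"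
    unfolding Ve by algebra
  also have "\<dots> = 0" unfolding T by simp
  finally have eq2: "12 * V * \<alpha> + ?t * n0 - 6 * ?r * e = 0"
    using nz by simp
  let ?c = "6 * V\<^sup>2 - 6 * ?r * (1 + S - 3 * M) - ?t * ?r"
  have "6 * V * ((2 * V * ?t + 6 * Wt) * \<alpha> + 6 * V * n0 + ?c * e)
      = 6 * V * ((2 * V * ?t + 6 * Wt) * \<alpha> + 6 * V * n0) + ?c * (6 * V * e)"
    by algebra
  also have "\<dots> = 6 * V * (?T1 - M * ?T0 - ?T2) - (\<tau> + ?L) * ?T3
      + 6 * V * n0 * (12 * V - (8 * (1 + S) * M - 4 * S - 12 * M\<^sup>2))"
    unfolding Ve by (rule second_order_elimination)
  also have "\<dots> = 0" unfolding T v_eq by simp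
  finally have eq3: "(2 * V * ?t + 6 * Wt) * \<alpha> + 6 * V * n0 + ?c * e = 0"
    using nz by simp
  have "normal_whitham S M \<tau> \<alpha> n0 e"
    unfolding normal_whitham_def whitham_dw_eq unfolding V Wt
    using eq2 eq3 Ve by (simp add: algebra_simps)
  then show ?thesis unfolding S_def M_def by blast
qed

text \<open>\<open>u \<xi>\<close> stands for the Bloch wave of exponent \<open>\<nu> = i \<xi>\<close>, and \<open>u'\<close> for its
  \<open>\<xi>\<close>-derivative at \<open>0\<close>. Here \<open>\<mu> = \<lambda> / (k \<kappa>)\<close>, where \<open>U = M + \<kappa> (D - m)\<close>.\<close>

lemma bloch_curve_normal_whitham:
  fixes u :: "real \<Rightarrow> real \<Rightarrow> complex" and u' :: "real \<Rightarrow> complex"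
  assumes "\<epsilon> > 0"
    and d1: "\<And>\<xi> x. \<bar>\<xi>\<bar> < \<epsilon> \<Longrightarrow> (u \<xi> has_vector_derivative u1 \<xi> x) (at x)"
    and d2: "\<And>\<xi> x. \<bar>\<xi>\<bar> < \<epsilon> \<Longrightarrow> (u1 \<xi> has_vector_derivative u2 \<xi> x) (at x)"
    and d3: "\<And>\<xi> x. \<bar>\<xi>\<bar> < \<epsilon> \<Longrightarrow> (u2 \<xi> has_vector_derivative u3 \<xi> x) (at x)"
    and per: "\<And>\<xi> x. \<bar>\<xi>\<bar> < \<epsilon> \<Longrightarrow> u \<xi> (x + 1) = u \<xi> x"
    and eq: "\<And>\<xi> x. \<bar>\<xi>\<bar> < \<epsilon> \<Longrightarrow> \<mu> \<xi> * u \<xi> x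
        + (of_real (6 * D1 x) * u \<xi> x + of_real (Q1 x) * u1 \<xi> x
           + (\<i> * of_real \<xi>) * of_real (Q1 x) * u \<xi> x)
        + of_real (h / 2) * (u3 \<xi> x + 3 * (\<i> * of_real \<xi>) * u2 \<xi> x
           + 3 * (\<i> * of_real \<xi>)\<^sup>2 * u1 \<xi> x + (\<i> * of_real \<xi>)^3 * u \<xi> x) = 0"
    and \<mu>0: "\<mu> 0 = 0"
    and \<mu>: "((\<lambda>\<xi>. \<mu> \<xi> / (\<i> * of_real \<xi>)) \<longlongrightarrow> \<tau>) (at 0)"
    and cont_u': "continuous_on {0..1} u'"
    and deriv_pair: "\<And>\<phi>. continuous_on {0..1} \<phi> \<Longrightarrow>
        ((\<lambda>\<xi>. pair (u \<xi>) \<phi>) has_vector_derivative pair u' \<phi>) (at 0)"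
    and nz: "u 0 x0 \<noteq> 0"
  shows "\<exists>a b e. (a, b, e) \<noteq> (0, 0, 0) \<and> normal_whitham (of_real s) (of_real m) \<tau> a b e"
proof -
  have u1_per: "u1 \<xi> (x + 1) = u1 \<xi> x" if "\<bar>\<xi>\<bar> < \<epsilon>" for \<xi> x
    using has_vector_derivative_periodic[OF d1 per] that by blast
  have u2_per: "u2 \<xi> (x + 1) = u2 \<xi> x" if "\<bar>\<xi>\<bar> < \<epsilon>" for \<xi> x
    using has_vector_derivative_periodic[OF d2 u1_per] that by blast
  have periods: "u \<xi> 1 = u \<xi> 0" "u1 \<xi> 1 = u1 \<xi> 0" "u2 \<xi> 1 = u2 \<xi> 0" if "\<bar>\<xi>\<bar> < \<epsilon>" for \<xi>
    using per[OF that, of 0] u1_per[OF that, of 0] u2_per[OF that, of 0] by simp_all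
  have cont_u0: "continuous_on {0..1} (u 0)"
    using \<open>\<epsilon> > 0\<close>
    by (intro continuous_at_imp_continuous_on ballI has_vector_derivative_continuous[OF d1]) simp
  have lim_pair: "((\<lambda>\<xi>. pair (u \<xi>) \<phi>) \<longlongrightarrow> pair (u 0) \<phi>) (at 0)" if "continuous_on {0..1} \<phi>" for \<phi>
    using has_vector_derivative_continuous[OF deriv_pair[OF that]] by (simp add: continuous_within)
  note weak = bloch_weak_form[OF d1 d2 d3 periods]
  have cont: "continuous_on {0..1} \<phi>" if "\<And>x. (\<phi> has_real_derivative \<phi>' x) (at x)" for \<phi> \<phi>'
    by (intro continuous_at_imp_continuous_on ballI DERIV_isCont[OF that])
  \<comment> \<open>Relations at order \<nu>. Hypothesis \<open>0\<close> is the relation at order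
    zero: for the test functions 1 and D the image Q1 \<phi>' + h/2 \<phi>''' itself is zero, for
    \<open>Z\<close> and \<open>Y\<close> it is a polynomial in D to which D' is orthogonal.\<close>
  have first: "\<tau> * pair (u 0) \<phi> - pair u' (\<lambda>x. Q1 x * \<phi>1 x + h / 2 * \<phi>3 x) / \<i>
      + pair (u 0) (\<lambda>x. Q1 x * \<phi> x + 3 * h / 2 * \<phi>2 x) = 0"
    if \<phi>: "\<And>x. (\<phi> has_real_derivative \<phi>1 x) (at x)"
      "\<And>x. (\<phi>1 has_real_derivative \<phi>2 x) (at x)" "\<And>x. (\<phi>2 has_real_derivative \<phi>3 x) (at x)"
      "\<phi> 1 = \<phi> 0" "\<phi>1 1 = \<phi>1 0" "\<phi>2 1 = \<phi>2 0" "continuous_on {0..1} \<phi>3"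
      and 0: "pair (u 0) (\<lambda>x. Q1 x * \<phi>1 x + h / 2 * \<phi>3 x) = 0" for \<phi> \<phi>1 \<phi>2 \<phi>3
  proof (rule bloch_first_order[OF \<open>\<epsilon> > 0\<close> _ \<mu>
        lim_pair[OF cont[OF \<phi>(1)]] lim_pair lim_pair[OF cont[OF \<phi>(2)]] deriv_pair 0])
    show "\<mu> \<xi> * pair (u \<xi>) \<phi> - pair (u \<xi>) (\<lambda>x. Q1 x * \<phi>1 x + h / 2 * \<phi>3 x)
       + \<i> * of_real \<xi> * pair (u \<xi>) (\<lambda>x. Q1 x * \<phi> x + 3 * h / 2 * \<phi>2 x)
       - of_real (3 * h / 2) * (\<i> * of_real \<xi>)\<^sup>2 * pair (u \<xi>) \<phi>1
       + of_real (h / 2) * (\<i> * of_real \<xi>)^3 * pair (u \<xi>) \<phi> = 0" if "\<bar>\<xi>\<bar> < \<epsilon>" for \<xi>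
      by (rule weak[OF that that that that that that \<phi> eq[OF that]])
  qed (intro continuous_intros profile_continuous cont[OF \<phi>(1)] cont[OF \<phi>(2)] cont[OF \<phi>(3)] \<phi>(7))+
  \<comment> \<open>Relations at order \<nu>^2, for test functions whose order \<nu> relation is
    void because both pairings with u(0) vanish.\<close>
  have second: "\<tau> * (pair u' \<phi> / \<i>) + pair u' (\<lambda>x. Q1 x * \<phi> x + 3 * h / 2 * \<phi>2 x) / \<i>
      - of_real (3 * h / 2) * pair (u 0) \<phi>1 = 0"
    if \<phi>: "\<And>x. (\<phi> has_real_derivative \<phi>1 x) (at x)"
      "\<And>x. (\<phi>1 has_real_derivative \<phi>2 x) (at x)" "\<And>x. (\<phi>2 has_real_derivative \<phi>3 x) (at x)"
      "\<phi> 1 = \<phi> 0" "\<phi>1 1 = \<phi>1 0" "\<phi>2 1 = \<phi>2 0" "continuous_on {0..1} \<phi>3"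
      and Q: "\<And>x. Q1 x * \<phi>1 x + h / 2 * \<phi>3 x = 0"
      and 0: "pair (u 0) \<phi> = 0" "pair (u 0) (\<lambda>x. Q1 x * \<phi> x + 3 * h / 2 * \<phi>2 x) = 0"
    for \<phi> \<phi>1 \<phi>2 \<phi>3
  proof (rule bloch_second_order[OF \<open>\<epsilon> > 0\<close> _ \<mu>
        lim_pair[OF cont[OF \<phi>(2)]] deriv_pair[OF cont[OF \<phi>(1)]] 0(1) deriv_pair 0(2)])
    show "\<mu> \<xi> * pair (u \<xi>) \<phi>
       + \<i> * of_real \<xi> * pair (u \<xi>) (\<lambda>x. Q1 x * \<phi> x + 3 * h / 2 * \<phi>2 x)
       - of_real (3 * h / 2) * (\<i> * of_real \<xi>)\<^sup>2 * pair (u \<xi>) \<phi>1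
       + of_real (h / 2) * (\<i> * of_real \<xi>)^3 * pair (u \<xi>) \<phi> = 0" if "\<bar>\<xi>\<bar> < \<epsilon>" for \<xi>
      using weak[OF that that that that that that \<phi> eq[OF that]] unfolding Q pair_zero by simp
  qed (intro continuous_intros profile_continuous cont[OF \<phi>(1)] cont[OF \<phi>(2)] cont[OF \<phi>(3)])+
  have zero: "\<bar>0::real\<bar> < \<epsilon>" using \<open>\<epsilon> > 0\<close> by simp
  have eq0: "of_real (6 * D1 x) * u 0 x + of_real (Q1 x) * u1 0 x + of_real (h / 2) * u3 0 x = 0" for x
    using eq[OF zero, of x] by (simp add: \<mu>0)
  obtain \<alpha> \<beta> where u0: "\<And>x. u 0 x = \<alpha> * of_real (D1 x) + \<beta> * of_real (G x)"
    using linearized_kernel[OF d1[OF zero] d2[OF zero] d3[OF zero] per[OF zero] eq0] by blast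
  have Q_1: "Q1 x * 1 + 3 * h / 2 * 0 = - 2 * (1 + s) + 6 * D x + 0 * (D x)\<^sup>2" for x
    by (simp add: Q1_def)
  have Q_2: "Q1 x * D x + 3 * h / 2 * D2 x = - 3 * s + 4 * (1 + s) * D x + (- 3) * (D x)\<^sup>2" for x
    using h_D2[of x] by (simp add: Q1_def algebra_simps power2_eq_square)
  note quad = pair_quadratic[OF cont_u0] pair_quadratic[OF cont_u']
  have Q_D1': "Q1 x * D1 x + h / 2 * D3 x = 0" for x by (rule Q_D1)
  show ?thesis
  proof (cases "\<beta> = 0")
    case False
    have mom: "moment (u 0) 0 = \<beta> * of_real v" "moment (u 0) 1 = \<beta> * of_real g1"
      "moment (u 0) 2 = \<beta> * of_real g2"
      unfolding moment_def
      using pair_combination[of "u 0" \<alpha> D1 \<beta> G "\<lambda>x. D x ^ 0" 0 v] mean_D1 mean_G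
        pair_combination[of "u 0" \<alpha> D1 \<beta> G "\<lambda>x. D x ^ 1" 0 g1] mean_D1_D mean_G_D
        pair_combination[of "u 0" \<alpha> D1 \<beta> G "\<lambda>x. D x ^ 2" 0 g2] mean_D1_D_sq mean_G_D_sq u0
      by simp_all
    have "\<tau> * pair (u 0) (\<lambda>_. 1) - pair u' (\<lambda>x. Q1 x * 0 + h / 2 * 0) / \<i>
      + pair (u 0) (\<lambda>x. Q1 x * 1 + 3 * h / 2 * 0) = 0"
      by (rule first) (auto simp: pair_def)
    moreover have "pair (u 0) (\<lambda>_. 1) = \<beta> * of_real v"
      using mom(1) by (simp add: moment_def)
    ultimately have b0: "\<beta> * ((\<tau> - 2 * (1 + of_real s)) * of_real v + 6 * of_real g1) = 0"
      unfolding quad(1)[OF Q_1, unfolded mom] by (simp add: algebra_simps)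
    have "\<tau> * pair (u 0) D - pair u' (\<lambda>x. Q1 x * D1 x + h / 2 * D3 x) / \<i>
      + pair (u 0) (\<lambda>x. Q1 x * D x + 3 * h / 2 * D2 x) = 0"
      by (rule first[OF deriv_D deriv_D1' deriv_D2])
        (simp_all only: profile_periods profile_continuous Q_D1' pair_zero)
    moreover have "pair (u 0) D = \<beta> * of_real g1"
      using mom(2) by (simp add: moment_def)
    ultimately have b1: "\<beta> * ((\<tau> + 4 * (1 + of_real s)) * of_real g1 - 3 * of_real g2 - 3 * of_real s * of_real v) = 0"
      unfolding quad(1)[OF Q_2, unfolded mom] Q_D1' pair_zero by (simp add: algebra_simps)
    have "normal_whitham (of_real s) (of_real m) \<tau> 0 (of_real v) 1"
      using False b0 b1 by (intro normal_whitham_first_order) auto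
    then show ?thesis by (intro exI conjI) auto
  next
    case True
    have u0': "u 0 x = \<alpha> * of_real (D1 x)" for x
      using u0[of x] True by simp
    then have "\<alpha> \<noteq> 0" using nz by auto
    have mom: "moment (u 0) 0 = 0" "moment (u 0) 1 = 0" "moment (u 0) 2 = 0"
      unfolding moment_def
      using pair_multiple[of "u 0" \<alpha> D1 "\<lambda>x. D x ^ 0" 0] mean_D1
        pair_multiple[of "u 0" \<alpha> D1 "\<lambda>x. D x ^ 1" 0] mean_D1_D
        pair_multiple[of "u 0" \<alpha> D1 "\<lambda>x. D x ^ 2" 0] mean_D1_D_sq u0'
      by simp_all
    define n where "n j = moment u' j / \<i>" for j
    have T0: "\<tau> * n 0 + (6 * n 1 - 2 * (1 + of_real s) * n 0) = 0"
    proof -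
      have "\<tau> * (pair u' (\<lambda>_. 1) / \<i>) + pair u' (\<lambda>x. Q1 x * 1 + 3 * h / 2 * 0) / \<i>
        - of_real (3 * h / 2) * pair (u 0) (\<lambda>_. 0) = 0"
        by (rule second[of "\<lambda>_. 1" "\<lambda>_. 0" "\<lambda>_. 0" "\<lambda>_. 0"])
          (use quad(1)[OF Q_1, unfolded mom] mom in \<open>auto simp: moment_def\<close>)
      then show ?thesis
        unfolding quad(2)[OF Q_1] by (simp add: n_def moment_def pair_def[of _ "\<lambda>_. 0"] field_simps)
    qed
    have "pair (u 0) D1 = \<alpha> * of_real (e2 / h)"
      by (rule pair_multiple[OF u0'])
        (use has_integral_mult_right[OF mean_D1_sq, of "1 / h"] h_pos in \<open>simp add: power2_eq_square\<close>)
    then have E0: "of_real (3 * h / 2) * pair (u 0) D1 = 3 / 2 * \<alpha> * of_real e2"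
      using h_pos by simp
    have T1: "\<tau> * n 1 + (- 3 * n 2 + 4 * (1 + of_real s) * n 1 - 3 * of_real s * n 0)
      - 3 / 2 * \<alpha> * of_real e2 = 0"
    proof -
      have zeros: "pair (u 0) D = 0" "pair (u 0) (\<lambda>x. Q1 x * D x + 3 * h / 2 * D2 x) = 0"
        using mom(2) by (simp add: moment_def, unfold quad(1)[OF Q_2] mom, simp)
      have "\<tau> * (pair u' D / \<i>) + pair u' (\<lambda>x. Q1 x * D x + 3 * h / 2 * D2 x) / \<i>
        - of_real (3 * h / 2) * pair (u 0) D1 = 0"
        by (rule second[OF deriv_D deriv_D1' deriv_D2 _ _ _ _ Q_D1' zeros])
          (simp_all only: profile_periods profile_continuous)
      then show ?thesis
        unfolding quad(2)[OF Q_2] E0 by (simp add: n_def moment_def field_simps)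
    qed
    \<comment> \<open>This is the image of Z' = D - m under Q. It is quadratic in D, so the
      first-order relation for \<open>Z\<close> sees u' only through its moments.\<close>
    have Q_3: "Q1 x * (D x - m) + h / 2 * D2 x = (2 * (1 + s) * m - s) + (- 6 * m) * D x + 3 * (D x)\<^sup>2" for x
      using Q_D[of x] by (simp add: Q1_def algebra_simps)
    have T2: "- \<tau> * \<alpha> * of_real v - (3 * n 2 - of_real s * n 0
      - of_real m * (6 * n 1 - 2 * (1 + of_real s) * n 0)) + \<alpha> * of_real z1 = 0"
    proof -
      have deriv: "((\<lambda>x. D x - m) has_real_derivative D1 x) (at x)" for x
        by (auto intro!: derivative_eq_intros deriv_D)
      have "\<tau> * pair (u 0) Z - pair u' (\<lambda>x. Q1 x * (D x - m) + h / 2 * D2 x) / \<i>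
        + pair (u 0) (\<lambda>x. Q1 x * Z x + 3 * h / 2 * D1 x) = 0"
        by (rule first[OF deriv_Z deriv deriv_D1'])
          (simp_all only: profile_periods profile_continuous quad(1)[OF Q_3] mom mult_zero_right add_0)
      then show ?thesis
        unfolding quad(2)[OF Q_3] pair_multiple[OF u0' mean_D1_Z] pair_multiple[OF u0' mean_D1_Q_Z]
        by (simp add: n_def field_simps)
    qed
    have Q_4: "Q1 x * (G x - v) + h / 2 * G2 x = (C0 + 2 * (1 + s) * v) + (- 6 * v) * D x + 0 * (D x)\<^sup>2" for x
      using Q_G[of x] by (simp add: Q1_def algebra_simps)
    have T3: "- \<tau> * \<alpha> * of_real (g1 - m * v) - (of_real C0 * n 0
      - of_real v * (6 * n 1 - 2 * (1 + of_real s) * n 0)) + \<alpha> * of_real y1 = 0"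
    proof -
      have deriv: "((\<lambda>x. G x - v) has_real_derivative G1 x) (at x)" for x
        by (auto intro!: derivative_eq_intros deriv_G)
      have "\<tau> * pair (u 0) Y - pair u' (\<lambda>x. Q1 x * (G x - v) + h / 2 * G2 x) / \<i>
        + pair (u 0) (\<lambda>x. Q1 x * Y x + 3 * h / 2 * G1 x) = 0"
        by (rule first[OF deriv_Y deriv deriv_G1])
          (simp_all only: profile_periods profile_continuous quad(1)[OF Q_4] mom mult_zero_right add_0)
      then show ?thesis
        unfolding quad(2)[OF Q_4] pair_multiple[OF u0' mean_D1_Y] pair_multiple[OF u0' mean_D1_Q_Y]
        by (simp add: n_def field_simps)
    qed
    obtain e where "normal_whitham (of_real s) (of_real m) \<tau> \<alpha> (n 0) e"
      using normal_whitham_second_order[OF T0 T1 T2 T3] by blast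
    then show ?thesis using \<open>\<alpha> \<noteq> 0\<close> by (intro exI conjI) auto
  qed
qed

end

section \<open>Smooth Bloch curves of the wave in terms of the profile\<close>

lemma higher_differentiable_on_Suc_vector_derivative:
  fixes f :: "real \<Rightarrow> 'a::real_normed_vector"
  assumes "higher_differentiable_on UNIV f (Suc n)"
  shows "(f has_vector_derivative vector_derivative f (at x)) (at x)"
    and "higher_differentiable_on UNIV (\<lambda>x. vector_derivative f (at x)) n"
proof -
  have diff: "f differentiable (at x)" for x
    using assms by simp
  then show "(f has_vector_derivative vector_derivative f (at x)) (at x)"
    by (simp add: vector_derivative_works[symmetric])
  have "higher_differentiable_on UNIV (\<lambda>x. frechet_derivative f (at x) 1) n"
    using assms by simp
  then show "higher_differentiable_on UNIV (\<lambda>x. vector_derivative f (at x)) n"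
    by (simp add: frechet_derivative_eq_vector_derivative[OF diff])
qed

lemma bloch_D_eq:
  assumes "\<And>x. (f has_vector_derivative f' x) (at x)"
  shows "bloch_D \<nu> f = (\<lambda>x. f' x + \<nu> * f x)"
  using vector_derivative_at[OF assms] by (simp add: bloch_D_def)

lemma bloch_D_cube:
  assumes u: "\<And>x. (u has_vector_derivative u1 x) (at x)"
    and u1: "\<And>x. (u1 has_vector_derivative u2 x) (at x)"
    and u2: "\<And>x. (u2 has_vector_derivative u3 x) (at x)"
  shows "(bloch_D \<nu> ^^ 3) u x = u3 x + 3 * \<nu> * u2 x + 3 * \<nu>\<^sup>2 * u1 x + \<nu>^3 * u x"
proof -
  have 1: "bloch_D \<nu> u = (\<lambda>x. u1 x + \<nu> * u x)"
    by (rule bloch_D_eq[OF u])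
  have 2: "bloch_D \<nu> (\<lambda>x. u1 x + \<nu> * u x) = (\<lambda>x. (u2 x + \<nu> * u1 x) + \<nu> * (u1 x + \<nu> * u x))"
    by (rule bloch_D_eq) (auto intro!: derivative_eq_intros u u1)
  have 3: "bloch_D \<nu> (\<lambda>x. (u2 x + \<nu> * u1 x) + \<nu> * (u1 x + \<nu> * u x))
      = (\<lambda>x. ((u3 x + \<nu> * u2 x) + \<nu> * (u2 x + \<nu> * u1 x))
           + \<nu> * ((u2 x + \<nu> * u1 x) + \<nu> * (u1 x + \<nu> * u x)))"
    by (rule bloch_D_eq) (auto intro!: derivative_eq_intros u u1 u2)
  show ?thesis
    by (simp add: numeral_3_eq_3 1 2 3) (simp add: algebra_simps power2_eq_square)
qed

lemma frechet_partial_first: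
  fixes w :: "real \<times> real \<Rightarrow> 'a::real_normed_vector"
  assumes "w differentiable (at (\<xi>, x))"
  shows "((\<lambda>\<xi>. w (\<xi>, x)) has_vector_derivative frechet_derivative w (at (\<xi>, x)) (1, 0)) (at \<xi>)"
proof -
  have w: "(w has_derivative frechet_derivative w (at (\<xi>, x))) (at (\<xi>, x))"
    using assms by (simp add: frechet_derivative_works)
  have "((\<lambda>\<xi>. (\<xi>, x)) has_derivative (\<lambda>h. (h, 0))) (at \<xi>)"
    by (auto intro!: derivative_eq_intros)
  from has_derivative_compose[OF this w]
  have deriv: "((\<lambda>\<xi>. w (\<xi>, x)) has_derivative (\<lambda>h. frechet_derivative w (at (\<xi>, x)) (h, 0))) (at \<xi>)" .
  have eq: "frechet_derivative w (at (\<xi>, x)) (h, 0) = h *\<^sub>R frechet_derivative w (at (\<xi>, x)) (1, 0)" for h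
    using linear_cmul[OF has_derivative_linear[OF w], of h "(1, 0)"] by simp
  show ?thesis
    unfolding has_vector_derivative_def eq[symmetric] by (rule deriv)
qed

lemma pair_has_vector_derivative:
  fixes w :: "real \<times> real \<Rightarrow> complex"
  assumes "\<epsilon> > 0" and smooth: "smooth_on ({-\<epsilon><..<\<epsilon>} \<times> UNIV) w"
    and \<phi>: "continuous_on {0..1} \<phi>"
  shows "((\<lambda>\<xi>. pair (\<lambda>x. w (\<xi>, x)) \<phi>) has_vector_derivative
      pair (\<lambda>x. frechet_derivative w (at (0, x)) (1, 0)) \<phi>) (at 0)"
proof -
  let ?U = "{-\<epsilon><..<\<epsilon>}" and ?w' = "\<lambda>z. frechet_derivative w (at z) (1, 0)"
  have h0: "higher_differentiable_on (?U \<times> UNIV) w 0" and h1: "higher_differentiable_on (?U \<times> UNIV) w (Suc 0)"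
    using smooth unfolding smooth_on_def by blast+
  have diff: "w differentiable (at (\<xi>, x))" if "\<xi> \<in> ?U" for \<xi> x
    using h1 that by simp
  have cont_w: "continuous_on (?U \<times> UNIV) w" and cont_w': "continuous_on (?U \<times> UNIV) ?w'"
    using h0 h1 by simp_all
  have "((\<lambda>\<xi>. integral (cbox 0 1) (\<lambda>x. w (\<xi>, x) * of_real (\<phi> x))) has_vector_derivative
      integral (cbox 0 1) (\<lambda>x. ?w' (0, x) * of_real (\<phi> x))) (at 0 within ?U)"
  proof (rule leibniz_rule_vector_derivative[where fx = "\<lambda>\<xi> x. ?w' (\<xi>, x) * of_real (\<phi> x)"])
    show "((\<lambda>\<xi>. w (\<xi>, x) * of_real (\<phi> x)) has_vector_derivative ?w' (\<xi>, x) * of_real (\<phi> x))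
        (at \<xi> within ?U)" if "\<xi> \<in> ?U" for \<xi> x
      using has_vector_derivative_mult_left[OF frechet_partial_first[OF diff[OF that]]]
      by (rule has_vector_derivative_at_within)
    show "(\<lambda>x. w (\<xi>, x) * of_real (\<phi> x)) integrable_on cbox 0 1" if "\<xi> \<in> ?U" for \<xi>
    proof -
      have "continuous_on {0..1} (\<lambda>x. w (\<xi>, x))"
        by (rule continuous_on_compose2[OF cont_w]) (use that in \<open>auto intro!: continuous_intros\<close>)
      then show ?thesis
        using \<phi> by (auto intro!: integrable_continuous_real continuous_intros)
    qed
    have "continuous_on (?U \<times> cbox 0 1) (\<lambda>z. ?w' z * of_real (\<phi> (snd z)))"
      by (intro continuous_intros continuous_on_subset[OF cont_w'] continuous_on_compose2[OF \<phi>]) auto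
    then show "continuous_on (?U \<times> cbox 0 1) (\<lambda>(\<xi>, x). ?w' (\<xi>, x) * of_real (\<phi> x))"
      by (simp add: case_prod_beta)
  qed (use \<open>\<epsilon> > 0\<close> in auto)
  moreover have "at 0 within ?U = at (0::real)"
    using \<open>\<epsilon> > 0\<close> by (intro at_within_open) auto
  ultimately show ?thesis
    by (simp add: pair_def)
qed

text \<open>The expansion is given along the imaginary axis, so the estimate is pulled back along
  \<xi> -> i \<xi>.\<close>

lemma curve_slope_at_0:
  fixes lam :: "complex \<Rightarrow> complex"
  assumes "(\<lambda>\<nu>. lam \<nu> - \<nu> * a) \<in> O[at 0 within {\<nu>. Re \<nu> = 0}](\<lambda>\<nu>. \<nu>\<^sup>2)"
  shows "((\<lambda>\<xi>::real. lam (\<i> * of_real \<xi>) / (\<i> * of_real \<xi>)) \<longlongrightarrow> a) (at 0)"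
proof -
  obtain C where C: "\<forall>\<^sub>F \<nu> in at 0 within {\<nu>. Re \<nu> = 0}. norm (lam \<nu> - \<nu> * a) \<le> C * norm (\<nu>\<^sup>2)"
    using assms by (elim landau_o.bigE)
  have "filterlim (\<lambda>\<xi>::real. \<i> * of_real \<xi>) (at 0 within {\<nu>. Re \<nu> = 0}) (at 0)"
  proof (rule filterlim_at_withinI)
    have "((\<lambda>\<xi>::real. \<i> * complex_of_real \<xi>) \<longlongrightarrow> \<i> * of_real 0) (at 0)"
      by (intro tendsto_intros)
    then show "((\<lambda>\<xi>::real. \<i> * complex_of_real \<xi>) \<longlongrightarrow> 0) (at 0)" by simp
  qed (auto simp: eventually_at_filter)
  from eventually_compose_filterlim[OF C this]
  have ev: "\<forall>\<^sub>F \<xi>::real in at 0. norm (lam (\<i> * of_real \<xi>) - \<i> * of_real \<xi> * a) \<le> C * norm ((\<i> * complex_of_real \<xi>)\<^sup>2)" .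
  have "((\<lambda>\<xi>::real. lam (\<i> * of_real \<xi>) / (\<i> * of_real \<xi>) - a) \<longlongrightarrow> 0) (at 0)"
  proof (rule Lim_null_comparison)
    show "\<forall>\<^sub>F \<xi>::real in at 0. norm (lam (\<i> * of_real \<xi>) / (\<i> * of_real \<xi>) - a) \<le> C * \<bar>\<xi>\<bar>"
      using ev eventually_neq_at_within[of 0 0 UNIV]
    proof eventually_elim
      case (elim \<xi>)
      then have "lam (\<i> * of_real \<xi>) / (\<i> * of_real \<xi>) - a
          = (lam (\<i> * of_real \<xi>) - \<i> * of_real \<xi> * a) / (\<i> * of_real \<xi>)"
        by (simp add: field_simps)
      then have "norm (lam (\<i> * of_real \<xi>) / (\<i> * of_real \<xi>) - a)
          = norm (lam (\<i> * of_real \<xi>) - \<i> * of_real \<xi> * a) / \<bar>\<xi>\<bar>"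
        by (simp add: norm_divide norm_mult)
      also have "\<dots> \<le> C * norm ((\<i> * complex_of_real \<xi>)\<^sup>2) / \<bar>\<xi>\<bar>"
        using elim by (intro divide_right_mono) auto
      also have "\<dots> = C * \<bar>\<xi>\<bar>"
        using elim by (cases "\<xi> < 0") (simp_all add: norm_power norm_mult power2_eq_square)
      finally show ?case .
    qed
    have "((\<lambda>\<xi>::real. C * \<bar>\<xi>\<bar>) \<longlongrightarrow> C * \<bar>0\<bar>) (at 0)"
      by (intro tendsto_intros)
    then show "((\<lambda>\<xi>::real. C * \<bar>\<xi>\<bar>) \<longlongrightarrow> 0) (at 0)" by simp
  qed
  then show ?thesis by (simp add: LIM_zero_iff)
qed

context elliptic_modulus
begin

text \<open>Divide (B) by k \<kappa>: the potential 6 U - c equals \<kappa> \<open>Q1\<close>, where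
  M cancels, and k^3 = k \<kappa> h / 2 because \<kappa> = 8 K^2 k^2 and h = 1 / (4 K^2).\<close>

lemma bloch_solution_normal:
  fixes u :: "real \<Rightarrow> complex"
  assumes "k > 0" and sol: "bloch_solution k M p \<nu> lam u"
  defines "u1 \<equiv> \<lambda>x. vector_derivative u (at x)"
  defines "u2 \<equiv> \<lambda>x. vector_derivative u1 (at x)"
  defines "u3 \<equiv> \<lambda>x. vector_derivative u2 (at x)"
  shows "(u has_vector_derivative u1 x) (at x)" "(u1 has_vector_derivative u2 x) (at x)"
    "(u2 has_vector_derivative u3 x) (at x)" "u (x + 1) = u x"
    "lam / of_real (k * (wave_amp p * k\<^sup>2)) * u x
      + (of_real (6 * dn_sq_deriv p x) * u x + of_real (Q1 x) * u1 x + \<nu> * of_real (Q1 x) * u x)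
      + of_real (1 / (4 * (elliptic_K p)\<^sup>2) / 2)
        * (u3 x + 3 * \<nu> * u2 x + 3 * \<nu>\<^sup>2 * u1 x + \<nu>^3 * u x) = 0"
proof -
  let ?\<kappa> = "wave_amp p * k\<^sup>2" and ?h = "1 / (4 * (elliptic_K p)\<^sup>2)"
  have h: "higher_differentiable_on UNIV u (Suc (Suc (Suc 0)))"
    using sol by (simp only: bloch_solution_def numeral_3_eq_3)
  note hd = higher_differentiable_on_Suc_vector_derivative
  have d1: "(u has_vector_derivative u1 x) (at x)" for x
    unfolding u1_def by (rule hd(1)[OF h])
  have h1: "higher_differentiable_on UNIV u1 (Suc (Suc 0))"
    unfolding u1_def by (rule hd(2)[OF h])
  have d2: "(u1 has_vector_derivative u2 x) (at x)" for x
    unfolding u2_def by (rule hd(1)[OF h1])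
  have h2: "higher_differentiable_on UNIV u2 (Suc 0)"
    unfolding u2_def by (rule hd(2)[OF h1])
  have d3: "(u2 has_vector_derivative u3 x) (at x)" for x
    unfolding u3_def by (rule hd(1)[OF h2])
  show "(u has_vector_derivative u1 x) (at x)" "(u1 has_vector_derivative u2 x) (at x)"
    "(u2 has_vector_derivative u3 x) (at x)"
    by (rule d1 d2 d3)+
  show "u (x + 1) = u x"
    using sol by (simp add: bloch_solution_def)
  have pot: "6 * kdv_U k M p y - kdv_c k M p = ?\<kappa> * Q1 y" for y
    unfolding kdv_U_eq kdv_c_eq Q1_def by (simp add: algebra_simps)
  have deriv: "((\<lambda>y. of_real (?\<kappa> * Q1 y) * u y) has_vector_derivative
      of_real (?\<kappa> * Q1 y) * u1 y + of_real (?\<kappa> * (6 * dn_sq_deriv p y)) * u y) (at y)" for y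
    by (intro has_vector_derivative_mult has_vector_derivative_of_real d1 DERIV_cmult deriv_Q1)
  have k3: "k ^ 3 = k * ?\<kappa> * (?h / 2)"
    using K_pos by (simp add: wave_amp_def power2_eq_square power3_eq_cube)
  have nz: "complex_of_real (k * ?\<kappa>) \<noteq> 0"
    unfolding of_real_eq_0_iff using assms(1) wave_amp_pos by auto
  have "lam * u x + of_real k * bloch_D \<nu> (\<lambda>y. of_real (?\<kappa> * Q1 y) * u y) x
      + of_real (k ^ 3) * (bloch_D \<nu> ^^ 3) u x = 0"
    using sol unfolding bloch_solution_def pot by blast
  then have eq: "lam * u x + of_real k * (of_real (?\<kappa> * Q1 x) * u1 x
      + of_real (?\<kappa> * (6 * dn_sq_deriv p x)) * u x + \<nu> * (of_real (?\<kappa> * Q1 x) * u x))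
      + of_real (k * ?\<kappa> * (?h / 2)) * (u3 x + 3 * \<nu> * u2 x + 3 * \<nu>\<^sup>2 * u1 x + \<nu>^3 * u x) = 0"
    unfolding bloch_D_eq[OF deriv] bloch_D_cube[OF d1 d2 d3] k3 .
  let ?L = "lam / of_real (k * ?\<kappa>) * u x
      + (of_real (6 * dn_sq_deriv p x) * u x + of_real (Q1 x) * u1 x + \<nu> * of_real (Q1 x) * u x)
      + of_real (?h / 2) * (u3 x + 3 * \<nu> * u2 x + 3 * \<nu>\<^sup>2 * u1 x + \<nu>^3 * u x)"
  have "of_real (k * ?\<kappa>) * ?L = lam * u x + of_real k * (of_real (?\<kappa> * Q1 x) * u1 x
      + of_real (?\<kappa> * (6 * dn_sq_deriv p x)) * u x + \<nu> * (of_real (?\<kappa> * Q1 x) * u x))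
      + of_real (k * ?\<kappa> * (?h / 2)) * (u3 x + 3 * \<nu> * u2 x + 3 * \<nu>\<^sup>2 * u1 x + \<nu>^3 * u x)"
  proof -
    have "of_real (k * ?\<kappa>) * (lam / of_real (k * ?\<kappa>) * u x) = lam * u x"
      using nz by (simp del: of_real_mult)
    then show ?thesis
      unfolding distrib_left by (simp add: algebra_simps)
  qed
  then show "?L = 0" unfolding eq using nz by (metis mult_eq_0_iff)
qed

lemma bloch_curve_linearized_whitham:
  assumes "k > 0" and curve: "smooth_bloch_curve k M p lam u"
    and slope: "(\<lambda>\<nu>. lam \<nu> - \<nu> * of_real k * lam0) \<in> O[at 0 within {\<nu>. Re \<nu> = 0}](\<lambda>\<nu>. \<nu>\<^sup>2)"
    and nz: "u 0 x0 \<noteq> 0"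
  shows "\<exists>k0 M0 p0. (k0, M0, p0) \<noteq> (0, 0, 0) \<and>
     - of_real (kdv_c k M p) * k0 + lam0 * k0 + cdiff flux_k (k, M, p) (k0, M0, p0) = 0 \<and>
     (lam0 - of_real (kdv_c k M p)) * M0 + cdiff flux_M (k, M, p) (k0, M0, p0) = 0 \<and>
     1 / 2 * (lam0 - of_real (kdv_c k M p)) * cdiff mean_U2 (k, M, p) (k0, M0, p0)
       + cdiff flux_U2 (k, M, p) (k0, M0, p0) = 0"
proof -
  obtain \<epsilon> where \<epsilon>: "\<epsilon> > 0" and smooth_lam: "smooth_on {-\<epsilon><..<\<epsilon>} (\<lambda>\<xi>. lam (\<i> * of_real \<xi>))"
    and smooth_u: "smooth_on ({-\<epsilon><..<\<epsilon>} \<times> UNIV) (\<lambda>(\<xi>, x). u (\<i> * of_real \<xi>) x)"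
    and sol: "\<And>\<xi>. \<bar>\<xi>\<bar> < \<epsilon> \<Longrightarrow> bloch_solution k M p (\<i> * of_real \<xi>) (lam (\<i> * of_real \<xi>)) (u (\<i> * of_real \<xi>))"
    using curve unfolding smooth_bloch_curve_def by (auto simp: abs_less_iff)
  define \<kappa> where "\<kappa> = wave_amp p * k\<^sup>2"
  have \<kappa>: "\<kappa> > 0" using wave_amp_pos assms(1) by (simp add: \<kappa>_def)
  define \<mu> where "\<mu> \<xi> = lam (\<i> * of_real \<xi>) / of_real (k * \<kappa>)" for \<xi> :: real
  have lim: "((\<lambda>\<xi>::real. lam (\<i> * of_real \<xi>) / (\<i> * of_real \<xi>)) \<longlongrightarrow> of_real k * lam0) (at 0)"
    by (rule curve_slope_at_0) (use slope in \<open>simp add: mult.assoc\<close>)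
  \<comment> \<open>The expansion concerns punctured neighbourhoods of 0; the value at 0 itself
    comes from continuity of the curve.\<close>
  have "lam 0 = 0"
  proof -
    have "((\<lambda>\<xi>::real. \<i> * of_real \<xi> * (lam (\<i> * of_real \<xi>) / (\<i> * of_real \<xi>)))
        \<longlongrightarrow> \<i> * of_real 0 * (of_real k * lam0)) (at 0)"
      by (intro tendsto_intros lim)
    then have "((\<lambda>\<xi>::real. lam (\<i> * of_real \<xi>)) \<longlongrightarrow> \<i> * of_real 0 * (of_real k * lam0)) (at 0)"
      by (rule Lim_transform_eventually) (auto simp: eventually_at_filter)
    then have "((\<lambda>\<xi>::real. lam (\<i> * of_real \<xi>)) \<longlongrightarrow> 0) (at 0)"
      by simp
    moreover have "continuous_on {-\<epsilon><..<\<epsilon>} (\<lambda>\<xi>. lam (\<i> * of_real \<xi>))"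
      using smooth_lam unfolding smooth_on_def by (metis higher_differentiable_on.simps(1))
    then have "isCont (\<lambda>\<xi>::real. lam (\<i> * of_real \<xi>)) 0"
      using \<epsilon> by (auto simp: continuous_on_eq_continuous_at)
    then have "((\<lambda>\<xi>::real. lam (\<i> * of_real \<xi>)) \<longlongrightarrow> lam 0) (at 0)"
      by (simp add: isCont_def)
    ultimately show ?thesis by (metis tendsto_unique trivial_limit_at)
  qed
  have \<mu>: "((\<lambda>\<xi>. \<mu> \<xi> / (\<i> * of_real \<xi>)) \<longlongrightarrow> lam0 / of_real \<kappa>) (at 0)"
  proof -
    have "((\<lambda>\<xi>::real. lam (\<i> * of_real \<xi>) / (\<i> * of_real \<xi>) / of_real (k * \<kappa>))
        \<longlongrightarrow> of_real k * lam0 / of_real (k * \<kappa>)) (at 0)"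
      using assms(1) \<kappa> by (intro tendsto_intros lim) auto
    moreover have "of_real k * lam0 / of_real (k * \<kappa>) = lam0 / of_real \<kappa>"
      using assms(1) by simp
    ultimately show ?thesis
      by (simp add: \<mu>_def mult_ac)
  qed
  define w where "w = (\<lambda>(\<xi>, x). u (\<i> * complex_of_real \<xi>) x)"
  have smooth_w: "smooth_on ({-\<epsilon><..<\<epsilon>} \<times> UNIV) w"
    using smooth_u by (simp add: w_def)
  have "\<exists>a b e. (a, b, e) \<noteq> (0, 0, 0)
      \<and> normal_whitham (of_real cs) (of_real (elliptic_E p / elliptic_K p)) (lam0 / of_real \<kappa>) a b e"
  proof (rule bloch_curve_normal_whitham[OF \<epsilon>, where u = "\<lambda>\<xi>. u (\<i> * of_real \<xi>)" and \<mu> = \<mu>])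
    fix \<xi> x :: real assume \<xi>: "\<bar>\<xi>\<bar> < \<epsilon>"
    note B = bloch_solution_normal[OF assms(1) sol[OF \<xi>], folded \<kappa>_def]
    show "(u (\<i> * of_real \<xi>) has_vector_derivative vector_derivative (u (\<i> * of_real \<xi>)) (at x)) (at x)"
      by (rule B(1))
    show "((\<lambda>x. vector_derivative (u (\<i> * of_real \<xi>)) (at x)) has_vector_derivative
        vector_derivative (\<lambda>x. vector_derivative (u (\<i> * of_real \<xi>)) (at x)) (at x)) (at x)"
      by (rule B(2))
    show "((\<lambda>x. vector_derivative (\<lambda>x. vector_derivative (u (\<i> * of_real \<xi>)) (at x)) (at x)) has_vector_derivative
        vector_derivative (\<lambda>x. vector_derivative (\<lambda>x. vector_derivative (u (\<i> * of_real \<xi>)) (at x)) (at x)) (at x)) (at x)"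
      by (rule B(3))
    show "u (\<i> * of_real \<xi>) (x + 1) = u (\<i> * of_real \<xi>) x"
      by (rule B(4))
    show "\<mu> \<xi> * u (\<i> * of_real \<xi>) x + (of_real (6 * dn_sq_deriv p x) * u (\<i> * of_real \<xi>) x
          + of_real (Q1 x) * vector_derivative (u (\<i> * of_real \<xi>)) (at x)
          + \<i> * of_real \<xi> * of_real (Q1 x) * u (\<i> * of_real \<xi>) x)
        + of_real (1 / (4 * (elliptic_K p)\<^sup>2) / 2)
          * (vector_derivative (\<lambda>x. vector_derivative (\<lambda>x. vector_derivative (u (\<i> * of_real \<xi>)) (at x)) (at x)) (at x)
             + 3 * (\<i> * of_real \<xi>) * vector_derivative (\<lambda>x. vector_derivative (u (\<i> * of_real \<xi>)) (at x)) (at x)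
             + 3 * (\<i> * of_real \<xi>)\<^sup>2 * vector_derivative (u (\<i> * of_real \<xi>)) (at x)
             + (\<i> * of_real \<xi>) ^ 3 * u (\<i> * of_real \<xi>) x) = 0"
      unfolding \<mu>_def by (rule B(5))
  next
    show "\<mu> 0 = 0" by (simp add: \<mu>_def \<open>lam 0 = 0\<close>)
    show "((\<lambda>\<xi>. \<mu> \<xi> / (\<i> * of_real \<xi>)) \<longlongrightarrow> lam0 / of_real \<kappa>) (at 0)" by (rule \<mu>)
    show "u (\<i> * of_real 0) x0 \<noteq> 0" using nz by simp
    have "continuous_on ({-\<epsilon><..<\<epsilon>} \<times> UNIV) (\<lambda>z. frechet_derivative w (at z) (1, 0))"
      using smooth_w unfolding smooth_on_def
      by (metis higher_differentiable_on.simps(1) higher_differentiable_on.simps(2))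
    then show "continuous_on {0..1} (\<lambda>x. frechet_derivative w (at (0, x)) (1, 0))"
      by (rule continuous_on_compose2) (use \<epsilon> in \<open>auto intro!: continuous_intros\<close>)
    show "((\<lambda>\<xi>. pair (u (\<i> * of_real \<xi>)) \<phi>) has_vector_derivative
        pair (\<lambda>x. frechet_derivative w (at (0, x)) (1, 0)) \<phi>) (at 0)"
      if "continuous_on {0..1} \<phi>" for \<phi>
      using pair_has_vector_derivative[OF \<epsilon> smooth_w that] by (simp add: w_def)
  qed
  then obtain a b e where abe: "(a, b, e) \<noteq> (0, 0, 0)"
    and nw: "normal_whitham (of_real cs) (of_real ek) (lam0 / of_real \<kappa>) a b e"
    unfolding ell_ratio_def by blast
  have ne: "complex_of_real k \<noteq> 0" "complex_of_real \<kappa> \<noteq> 0" "complex_of_real (cs * p) \<noteq> 0"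
    unfolding of_real_eq_0_iff using assms(1) \<kappa> p_pos p_sq by auto
  let ?k0 = "of_real k * a" and ?M0 = "of_real \<kappa> * b" and ?p0 = "- (of_real (cs * p) * e)"
  have "?k0 / of_real k = a" "?M0 / of_real \<kappa> = b" "- ?p0 / of_real (cs * p) = e"
    using ne by (simp_all del: of_real_mult)
  then have "normal_whitham (of_real cs) (of_real ek) (lam0 / of_real \<kappa>) (?k0 / of_real k)
      (?M0 / of_real \<kappa>) (- ?p0 / of_real (cs * p))"
    using nw by (simp only:)
  note this[folded linearized_whitham_iff_normal[OF assms(1), of M, folded \<kappa>_def]]
  moreover have "(?k0, ?M0, ?p0) \<noteq> (0, 0, 0)"
    using abe ne by (simp del: of_real_mult) 
  ultimately show ?thesis by blast
qed

end

section \<open>Hyperbolicity\<close>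

lemma three_linear_equations_trivial:
  fixes a b c :: "'a::field"
  assumes "a1 * a + b1 * b + c1 * c = 0" and "a2 * a + b2 * b + c2 * c = 0"
    and "a3 * a + b3 * b + c3 * c = 0"
    and "a1 * (b2 * c3 - b3 * c2) - b1 * (a2 * c3 - a3 * c2) + c1 * (a2 * b3 - a3 * b2) \<noteq> 0"
  shows "a = 0 \<and> b = 0 \<and> c = 0"
proof -
  let ?d = "a1 * (b2 * c3 - b3 * c2) - b1 * (a2 * c3 - a3 * c2) + c1 * (a2 * b3 - a3 * b2)"
  have "?d * a = (b2 * c3 - b3 * c2) * (a1 * a + b1 * b + c1 * c)
      - (b1 * c3 - b3 * c1) * (a2 * a + b2 * b + c2 * c)
      + (b1 * c2 - b2 * c1) * (a3 * a + b3 * b + c3 * c)"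
    by (simp add: algebra_simps)
  moreover have "?d * b = - (a2 * c3 - a3 * c2) * (a1 * a + b1 * b + c1 * c)
      + (a1 * c3 - a3 * c1) * (a2 * a + b2 * b + c2 * c)
      - (a1 * c2 - a2 * c1) * (a3 * a + b3 * b + c3 * c)"
    by (simp add: algebra_simps)
  moreover have "?d * c = (a2 * b3 - a3 * b2) * (a1 * a + b1 * b + c1 * c)
      - (a1 * b3 - a3 * b1) * (a2 * a + b2 * b + c2 * c)
      + (a1 * b2 - a2 * b1) * (a3 * a + b3 * b + c3 * c)"
    by (simp add: algebra_simps)
  ultimately have "?d * a = 0" "?d * b = 0" "?d * c = 0"
    by (simp_all add: assms(1-3))
  then show ?thesis using assms(4) by simp
qed

\<comment> \<open>The roots \<tau> = 2 (1 - s) / (1 - m), 2 s (1 - s) / (m - s) and - 2 s / m are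
  the classical characteristic velocities of Whitham's equations in Riemann invariants, as (c -
  \<sigma>) / \<kappa>. Knowing them in advance turns the factorization into a polynomial
  identity.\<close>
schematic_goal normal_whitham_determinant:
  "((?\<tau> :: 'a::field_char_0) + 4 * (1 + ?s) - 12 * ?m)
       * ((?\<tau> + 6 * ?m - 2 * (1 + ?s)) * (whitham_dw ?s ?m - 6 * (?m - ?s) * whitham_w ?s ?m
             - (?\<tau> + 6 * ?m - 2 * (1 + ?s)) * (?m * (1 - ?m) * (?m - ?s)))
           - 6 * whitham_v ?s ?m * (- 6 * (?m * (1 - ?m) * (?m - ?s))))
     - 6 * (12 * whitham_v ?s ?m * (whitham_dw ?s ?m - 6 * (?m - ?s) * whitham_w ?s ?m
             - (?\<tau> + 6 * ?m - 2 * (1 + ?s)) * (?m * (1 - ?m) * (?m - ?s)))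
           - (2 * whitham_v ?s ?m * (?\<tau> + 6 * ?m - 2 * (1 + ?s)) + 6 * whitham_w ?s ?m)
             * (- 6 * (?m * (1 - ?m) * (?m - ?s))))
     + - 6 * whitham_v ?s ?m * (12 * whitham_v ?s ?m * (6 * whitham_v ?s ?m)
           - (2 * whitham_v ?s ?m * (?\<tau> + 6 * ?m - 2 * (1 + ?s)) + 6 * whitham_w ?s ?m)
             * (?\<tau> + 6 * ?m - 2 * (1 + ?s)))
   + (((1 - ?m) * ?\<tau> - 2 * (1 - ?s)) * ((?m - ?s) * ?\<tau> - 2 * ?s * (1 - ?s)) * (?m * ?\<tau> + 2 * ?s)) = 0"
  unfolding whitham_dw_def whitham_v_def whitham_w_def
  by (simp add: field_simps power2_eq_square power3_eq_cube)

text \<open>A nonzero solution makes the determinant vanish, so \<tau> satisfies one of three linear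
  equations with real coefficients; their leading coefficients 1 - m, m - s and m are nonzero for 0
  < s < m < 1.\<close>

lemma normal_whitham_real_speed:
  fixes \<tau> a b e :: complex and s m :: real
  assumes nw: "normal_whitham (of_real s) (of_real m) \<tau> a b e" and nz: "(a, b, e) \<noteq> (0, 0, 0)"
    and "0 < s" "s < m" "m < 1"
  shows "\<tau> \<in> \<real>"
proof -
  define S M where "S = complex_of_real s" and "M = complex_of_real m"
  have nw': "normal_whitham S M \<tau> a b e"
    using nw by (simp add: S_def M_def)
  let ?v = "whitham_v S M" and ?w = "whitham_w S M" and ?dw = "whitham_dw S M"
  let ?r = "M * (1 - M) * (M - S)" and ?t = "\<tau> + 6 * M - 2 * (1 + S)"
  let ?a1 = "\<tau> + 4 * (1 + S) - 12 * M" and ?b1 = "6" and ?c1 = "- 6 * ?v"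
  let ?a2 = "12 * ?v" and ?b2 = "?t" and ?c2 = "- 6 * ?r"
  let ?a3 = "2 * ?v * ?t + 6 * ?w" and ?b3 = "6 * ?v"
  let ?c3 = "?dw - 6 * (M - S) * ?w - ?t * ?r"
  let ?det = "?a1 * (?b2 * ?c3 - ?b3 * ?c2) - ?b1 * (?a2 * ?c3 - ?a3 * ?c2)
    + ?c1 * (?a2 * ?b3 - ?a3 * ?b2)"
  have "?det = 0"
    using three_linear_equations_trivial[of ?a1 a ?b1 b ?c1 e ?a2 ?b2 ?c2 ?a3 ?b3 ?c3] nw' nz
    by (auto simp: normal_whitham_def)
  moreover have "?det = - (((1 - M) * \<tau> - 2 * (1 - S)) * ((M - S) * \<tau> - 2 * S * (1 - S))
      * (M * \<tau> + 2 * S))"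
    using normal_whitham_determinant[of \<tau> S M] by (simp only: eq_neg_iff_add_eq_0)
  ultimately consider "(1 - M) * \<tau> = 2 * (1 - S)" | "(M - S) * \<tau> = 2 * S * (1 - S)"
    | "M * \<tau> = - 2 * S"
    by (auto simp: eq_neg_iff_add_eq_0)
  then show ?thesis
  proof cases
    case 1
    then have "\<tau> = of_real (2 * (1 - s) / (1 - m))"
      using assms by (simp add: S_def M_def eq_divide_eq mult.commute)
    then show ?thesis by simp
  next
    case 2
    then have "\<tau> = of_real (2 * s * (1 - s) / (m - s))"
      using assms by (simp add: S_def M_def eq_divide_eq mult.commute)
    then show ?thesis by simp
  next
    case 3
    then have "\<tau> = (- 2 * S) / M"
      using assms by (intro eq_divide_imp) (simp_all add: M_def mult.commute)
    then have "\<tau> = of_real ((- 2 * s) / m)"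
      unfolding S_def M_def by simp
    then show ?thesis by simp
  qed
qed

context elliptic_modulus
begin

lemma whitham_hyperbolic_cnoidal:
  assumes "k > 0"
  shows "whitham_hyperbolic (k, M, p)"
  unfolding whitham_hyperbolic_def whitham_characteristic_speed_def
proof (intro allI impI, elim exE conjE)
  fix \<sigma> :: complex and V
  assume V: "V \<noteq> (0, 0, 0)"
    and laws: "\<forall>(Q, F)\<in>whitham_laws. cdiff F (k, M, p) V = \<sigma> * cdiff Q (k, M, p) V"
  obtain k0 M0 p0 where V_eq: "V = (k0, M0, p0)" by (cases V)
  define \<kappa> where "\<kappa> = wave_amp p * k\<^sup>2"
  have \<kappa>: "\<kappa> > 0" using wave_amp_pos assms by (simp add: \<kappa>_def)
  let ?c = "complex_of_real (kdv_c k M p)"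
  \<comment> \<open>A speed \<sigma> corresponds to the exponential rate c - \<sigma> in the frame
    moving with c, which brings the laws into the form covered by the normal form. As c and \<kappa>
    are real, it then suffices that \<tau> is real.\<close>
  have "- ?c * k0 + (?c - \<sigma>) * k0 + cdiff flux_k (k, M, p) (k0, M0, p0) = 0 \<and>
     ((?c - \<sigma>) - ?c) * M0 + cdiff flux_M (k, M, p) (k0, M0, p0) = 0 \<and>
     1 / 2 * ((?c - \<sigma>) - ?c) * cdiff mean_U2 (k, M, p) (k0, M0, p0)
       + cdiff flux_U2 (k, M, p) (k0, M0, p0) = 0"
    using laws
    unfolding V_eq whitham_laws_def ball_simps prod.case cdiff_k cdiff_M cdiff_half_mean_U2[OF assms]
    by (simp add: algebra_simps)
  then have nw: "normal_whitham (of_real cs) (of_real ek) ((?c - \<sigma>) / of_real \<kappa>) (k0 / of_real k)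
       (M0 / of_real \<kappa>) (- p0 / of_real (cs * p))"
    unfolding linearized_whitham_iff_normal[OF assms] \<kappa>_def .
  have "(k0 / of_real k, M0 / of_real \<kappa>, - p0 / of_real (cs * p)) \<noteq> (0, 0, 0)"
    unfolding prod.inject divide_eq_0_iff of_real_eq_0_iff neg_equal_0_iff_equal
    using V V_eq assms \<kappa> p_pos p_sq by auto
  from normal_whitham_real_speed[OF nw this] have "(?c - \<sigma>) / of_real \<kappa> \<in> \<real>"
    using p_sq ell_ratio_bounds by simp
  then have "?c - \<sigma> \<in> \<real>"
    using \<kappa> by (metis Reals_mult Reals_of_real nonzero_divide_eq_eq of_real_eq_0_iff less_irrefl)
  then have "?c - (?c - \<sigma>) \<in> \<real>"
    by (rule Reals_diff[OF Reals_of_real])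
  then show "\<sigma> \<in> \<real>" by (simp only: diff_diff_eq2 add_diff_cancel_left')
qed

end

theorem mainTheorem7:
  fixes k M p :: real
  assumes "k > 0" and "0 < p" and "p < 1"
  shows
    "(\<forall>(lam :: complex \<Rightarrow> complex) (u :: complex \<Rightarrow> real \<Rightarrow> complex) (lam\<^sub>0 :: complex).
        smooth_bloch_curve k M p lam u \<longrightarrow>
        (\<lambda>\<nu>. lam \<nu> - \<nu> * of_real k * lam\<^sub>0) \<in> O[at 0 within {\<nu>. Re \<nu> = 0}](\<lambda>\<nu>. \<nu>\<^sup>2) \<longrightarrow>
        (\<exists>x. u 0 x \<noteq> 0) \<longrightarrow>
        (\<exists>k\<^sub>0 M\<^sub>0 p\<^sub>0 :: complex.
           (k\<^sub>0, M\<^sub>0, p\<^sub>0) \<noteq> (0, 0, 0) \<and>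
           - of_real (kdv_c k M p) * k\<^sub>0 + lam\<^sub>0 * k\<^sub>0
             + cdiff flux_k (k, M, p) (k\<^sub>0, M\<^sub>0, p\<^sub>0) = 0 \<and>
           (lam\<^sub>0 - of_real (kdv_c k M p)) * M\<^sub>0
             + cdiff flux_M (k, M, p) (k\<^sub>0, M\<^sub>0, p\<^sub>0) = 0 \<and>
           1 / 2 * (lam\<^sub>0 - of_real (kdv_c k M p)) * cdiff mean_U2 (k, M, p) (k\<^sub>0, M\<^sub>0, p\<^sub>0)
             + cdiff flux_U2 (k, M, p) (k\<^sub>0, M\<^sub>0, p\<^sub>0) = 0 \<and>
           (\<forall>\<nu>. Re \<nu> = 0 \<longrightarrow>
              solves_linearized_whitham (k, M, p) (kdv_c k M p)
                (\<lambda>X T. let e = exp (\<nu> * (of_real X + lam\<^sub>0 * of_real T))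
                       in (e * k\<^sub>0, e * M\<^sub>0, e * p\<^sub>0)))))
     \<and> (spectrally_stable k M p \<longrightarrow> whitham_hyperbolic (k, M, p))"
proof -
  have modulus: "elliptic_modulus p"
    using assms by unfold_locales
  show ?thesis
  proof (intro conjI allI impI, elim exE)
    fix lam :: "complex \<Rightarrow> complex" and u :: "complex \<Rightarrow> real \<Rightarrow> complex" and lam\<^sub>0 x
    assume "smooth_bloch_curve k M p lam u"
      and "(\<lambda>\<nu>. lam \<nu> - \<nu> * of_real k * lam\<^sub>0) \<in> O[at 0 within {\<nu>. Re \<nu> = 0}](\<lambda>\<nu>. \<nu>\<^sup>2)"
      and "u 0 x \<noteq> 0"
    from elliptic_modulus.bloch_curve_linearized_whitham[OF modulus assms(1) this]
    obtain k\<^sub>0 M\<^sub>0 p\<^sub>0 where *: "(k\<^sub>0, M\<^sub>0, p\<^sub>0) \<noteq> (0, 0, 0)"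
      "- of_real (kdv_c k M p) * k\<^sub>0 + lam\<^sub>0 * k\<^sub>0 + cdiff flux_k (k, M, p) (k\<^sub>0, M\<^sub>0, p\<^sub>0) = 0"
      "(lam\<^sub>0 - of_real (kdv_c k M p)) * M\<^sub>0 + cdiff flux_M (k, M, p) (k\<^sub>0, M\<^sub>0, p\<^sub>0) = 0"
      "1 / 2 * (lam\<^sub>0 - of_real (kdv_c k M p)) * cdiff mean_U2 (k, M, p) (k\<^sub>0, M\<^sub>0, p\<^sub>0)
        + cdiff flux_U2 (k, M, p) (k\<^sub>0, M\<^sub>0, p\<^sub>0) = 0"
      by blast
    show "\<exists>k\<^sub>0 M\<^sub>0 p\<^sub>0 :: complex.
           (k\<^sub>0, M\<^sub>0, p\<^sub>0) \<noteq> (0, 0, 0) \<and>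
           - of_real (kdv_c k M p) * k\<^sub>0 + lam\<^sub>0 * k\<^sub>0
             + cdiff flux_k (k, M, p) (k\<^sub>0, M\<^sub>0, p\<^sub>0) = 0 \<and>
           (lam\<^sub>0 - of_real (kdv_c k M p)) * M\<^sub>0
             + cdiff flux_M (k, M, p) (k\<^sub>0, M\<^sub>0, p\<^sub>0) = 0 \<and>
           1 / 2 * (lam\<^sub>0 - of_real (kdv_c k M p)) * cdiff mean_U2 (k, M, p) (k\<^sub>0, M\<^sub>0, p\<^sub>0)
             + cdiff flux_U2 (k, M, p) (k\<^sub>0, M\<^sub>0, p\<^sub>0) = 0 \<and>
           (\<forall>\<nu>. Re \<nu> = 0 \<longrightarrow>
              solves_linearized_whitham (k, M, p) (kdv_c k M p)
                (\<lambda>X T. let e = exp (\<nu> * (of_real X + lam\<^sub>0 * of_real T))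
                       in (e * k\<^sub>0, e * M\<^sub>0, e * p\<^sub>0)))"
      using * elliptic_modulus.exponential_solves_linearized_whitham[OF modulus assms(1) *(2-4)]
      by blast
  next
    show "whitham_hyperbolic (k, M, p)"
      by (rule elliptic_modulus.whitham_hyperbolic_cnoidal[OF modulus assms(1)])
  qed
qed

end
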